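(* Let $K$ be a field and let $E$ be an arbitrary graph with finitely many vertices for which $L_K(E)$ is a nontrivial simple Leavitt path algebra. Write $E^0 = \{v_1, \ldots, v_m\}$. For each $1\le i\le m$ let $B_i\in K^m$ be defined as follows: if $v_i$ is a regular vertex, then $B_i=(a_{ij})_{j=1}^m-\epsilon_i$, where $a_{ij}$ is the number of edges $e\in E^1$ with $r(e)=v_i$ and $s(e)=v_j$ (viewed in $K$) and $\epsilon_i$ is the $i$-th standard basis vector of $K^m$; if $v_i$ is not a regular vertex, then $B_i=0$. Then the Lie $K$-algebra $[L_K(E), L_K(E)]$ is simple if and only if $(1, \ldots, 1)\notin \mathrm{Span}_K\{B_1, \ldots, B_m\}$.
   Context: A (directed) graph $E=(E^0,E^1,s,r)$ consists of disjoint sets $E^0$ (vertices) and $E^1$ (edges) and maps $s,r:E^1\to E^0$ (source and range). A vertex $v$ is regular if $0<|r^{-1}(v)|<\infty$. The Leavitt path algebra $L_K(E)$ is the $K$-algebra generated by $E^0$ together with two disjoint copies $E^1$ and $\{e^*\mid e\in E^1\}$ of $E^1$, subject to the following relations for all $v,w\in E^0$, $e,f\in E^1$ ($\delta$ is the Kronecker delta): (1) $vw=\delta_{v,w}w$; (2) $r(e)e=e=e\,s(e)$ and $s(e)e^*=e^*=e^*r(e)$; (3) $e^*f=\delta_{e,f}s(e)$; (4) $v=\sum_{e\in r^{-1}(v)}ee^*$ for every regular vertex $v$. A simple Leavitt path algebra $L_K(E)$ is nontrivial if $L_K(E)\not\cong K$. For an associative $K$-algebra $R$, $[R,R]$ is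 the $K$-span of all commutators $[x,y]=xy-yx$, $x,y\in R$; it is a Lie $K$-algebra under $[x,y]=xy-yx$. A Lie $K$-algebra $L$ is simple if $[L,L]\neq 0$ and its only Lie ideals ($K$-subspaces $I$ with $[L,I]\subseteq I$) are $0$ and $L$. *)

theory Defs
  imports
    "HOL-Library.Poly_Mapping"
    "HOL-Analysis.Cartesian_Space"
    "Graph_Theory.Digraph"
begin

section \<open>Algebras over a field\<close>

text \<open>
  The rings of HOL-Algebra are unital, whereas neither \<open>L\<^sub>K(E)\<close> for a general graph nor a Lie
  algebra has a unit. Hence a separate record for algebras with an arbitrary bilinear
  multiplication, which is used for associative algebras and (with the bracket as
  multiplication) for Lie algebras. The field is the type \<open>'k\<close>.
\<close>

record ('k, 'a) k_algebra =
  alg_carrier :: "'a set"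
  alg_zero :: 'a
  alg_add :: "'a \<Rightarrow> 'a \<Rightarrow> 'a"
  alg_smult :: "'k \<Rightarrow> 'a \<Rightarrow> 'a"
  alg_mult :: "'a \<Rightarrow> 'a \<Rightarrow> 'a"

definition alg_subspace :: "('k, 'a) k_algebra \<Rightarrow> 'a set \<Rightarrow> bool" where
  "alg_subspace A S \<longleftrightarrow>
     S \<subseteq> alg_carrier A \<and> alg_zero A \<in> S \<and>
     (\<forall>x\<in>S. \<forall>y\<in>S. alg_add A x y \<in> S) \<and>
     (\<forall>c. \<forall>x\<in>S. alg_smult A c x \<in> S)"

abbreviation alg_span :: "('k, 'a) k_algebra \<Rightarrow> 'a set \<Rightarrow> 'a set" where
  "alg_span A S \<equiv> alg_subspace A hull S"

definition alg_ideal :: "('k, 'a) k_algebra \<Rightarrow> 'a set \<Rightarrow> bool" where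
  "alg_ideal A I \<longleftrightarrow>
     alg_subspace A I \<and>
     (\<forall>a\<in>alg_carrier A. \<forall>x\<in>I. alg_mult A a x \<in> I \<and> alg_mult A x a \<in> I)"

definition alg_coset :: "('k, 'a) k_algebra \<Rightarrow> 'a set \<Rightarrow> 'a \<Rightarrow> 'a set" where
  "alg_coset A I x = alg_add A x ` I"

definition quotient_algebra :: "('k, 'a) k_algebra \<Rightarrow> 'a set \<Rightarrow> ('k, 'a set) k_algebra" where
  "quotient_algebra A I =
     \<lparr> alg_carrier = alg_coset A I ` alg_carrier A,
       alg_zero = alg_coset A I (alg_zero A),
       alg_add = (\<lambda>X Y. \<Union>x\<in>X. \<Union>y\<in>Y. alg_coset A I (alg_add A x y)),
       alg_smult = (\<lambda>c X. \<Union>x\<in>X. alg_coset A I (alg_smult A c x)),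
       alg_mult = (\<lambda>X Y. \<Union>x\<in>X. \<Union>y\<in>Y. alg_coset A I (alg_mult A x y)) \<rparr>"

definition simple_algebra :: "('k, 'a) k_algebra \<Rightarrow> bool" where
  "simple_algebra A \<longleftrightarrow>
     (\<exists>x\<in>alg_carrier A. \<exists>y\<in>alg_carrier A. alg_mult A x y \<noteq> alg_zero A) \<and>
     (\<forall>I. alg_ideal A I \<longrightarrow> I = {alg_zero A} \<or> I = alg_carrier A)"

definition alg_iso :: "('k, 'a) k_algebra \<Rightarrow> ('k, 'b) k_algebra \<Rightarrow> ('a \<Rightarrow> 'b) set" where
  "alg_iso A B =
     {h. bij_betw h (alg_carrier A) (alg_carrier B) \<and>
         (\<forall>x\<in>alg_carrier A. \<forall>y\<in>alg_carrier A. h (alg_add A x y) = alg_add B (h x) (h y)) \<and>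
         (\<forall>c. \<forall>x\<in>alg_carrier A. h (alg_smult A c x) = alg_smult B c (h x)) \<and>
         (\<forall>x\<in>alg_carrier A. \<forall>y\<in>alg_carrier A. h (alg_mult A x y) = alg_mult B (h x) (h y))}"

definition isomorphic_algebras :: "('k, 'a) k_algebra \<Rightarrow> ('k, 'b) k_algebra \<Rightarrow> bool" where
  "isomorphic_algebras A B \<longleftrightarrow> alg_iso A B \<noteq> {}"

definition base_field_algebra :: "('k::field, 'k) k_algebra" where
  "base_field_algebra =
     \<lparr> alg_carrier = UNIV, alg_zero = 0, alg_add = (+), alg_smult = (*), alg_mult = (*) \<rparr>"


section \<open>Lie algebras\<close>

definition commutator :: "('k::field, 'a) k_algebra \<Rightarrow> 'a \<Rightarrow> 'a \<Rightarrow> 'a" where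
  "commutator A x y = alg_add A (alg_mult A x y) (alg_smult A (-1) (alg_mult A y x))"

text \<open>The Lie algebra \<open>[A, A]\<close> of an associative algebra \<open>A\<close>; its multiplication is the bracket.\<close>

definition commutator_lie_algebra :: "('k::field, 'a) k_algebra \<Rightarrow> ('k, 'a) k_algebra" where
  "commutator_lie_algebra A =
     A \<lparr> alg_carrier :=
            alg_span A {commutator A x y | x y. x \<in> alg_carrier A \<and> y \<in> alg_carrier A},
         alg_mult := commutator A \<rparr>"

definition lie_ideal :: "('k, 'a) k_algebra \<Rightarrow> 'a set \<Rightarrow> bool" where
  "lie_ideal L I \<longleftrightarrow>
     alg_subspace L I \<and> (\<forall>x\<in>alg_carrier L. \<forall>y\<in>I. alg_mult L x y \<in> I)"

definition simple_lie_algebra :: "('k, 'a) k_algebra \<Rightarrow> bool" where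
  "simple_lie_algebra L \<longleftrightarrow>
     alg_span L {alg_mult L x y | x y. x \<in> alg_carrier L \<and> y \<in> alg_carrier L} \<noteq> {alg_zero L} \<and>
     (\<forall>I. lie_ideal L I \<longrightarrow> I = {alg_zero L} \<or> I = alg_carrier L)"


section \<open>Free associative algebras\<close>

text \<open>
  Words form a monoid under concatenation, written additively because multiplication of
  \<open>'a \<Rightarrow>\<^sub>0 'b\<close> is convolution with respect to \<open>+\<close> on \<open>'a\<close>.
\<close>

datatype 'g word = Word (letters: "'g list")

instantiation word :: (type) monoid_add
begin

definition zero_word :: "'a word" where
  "zero_word = Word []"

definition plus_word :: "'a word \<Rightarrow> 'a word \<Rightarrow> 'a word" where
  "plus_word u w = Word (letters u @ letters w)"

instance
  by standard (simp_all add: zero_word_def plus_word_def)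

end

text \<open>The free (non-unital) algebra on \<open>X\<close>: its basis consists of the nonempty words over \<open>X\<close>.\<close>

definition free_algebra :: "'g set \<Rightarrow> ('k::field, 'g word \<Rightarrow>\<^sub>0 'k) k_algebra" where
  "free_algebra X =
     \<lparr> alg_carrier = {p. \<forall>w\<in>Poly_Mapping.keys p. letters w \<noteq> [] \<and> set (letters w) \<subseteq> X},
       alg_zero = 0,
       alg_add = (+),
       alg_smult = (\<lambda>c. Poly_Mapping.map ((*) c)),
       alg_mult = (*) \<rparr>"

definition free_gen :: "'g \<Rightarrow> 'g word \<Rightarrow>\<^sub>0 'k::field" where
  "free_gen g = Poly_Mapping.single (Word [g]) 1"


section \<open>Leavitt path algebras\<close>

text \<open>
  A graph is a \<^typ>\<open>('v, 'e) pre_digraph\<close> \<open>E\<close> satisfying \<^locale>\<open>wf_digraph\<close>; the source and range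
  maps are \<open>tail E\<close> and \<open>head E\<close>, and \<open>r\<^sup>-\<^sup>1(v)\<close> is \<open>in_arcs E v\<close>. There is no restriction on the
  number of edges.
\<close>

definition regular_vertex :: "('v, 'e) pre_digraph \<Rightarrow> 'v \<Rightarrow> bool" where
  "regular_vertex E v \<longleftrightarrow> in_arcs E v \<noteq> {} \<and> finite (in_arcs E v)"

datatype ('v, 'e) lpa_gen = Vertex 'v | Edge 'e | Ghost 'e

definition lpa_gens :: "('v, 'e) pre_digraph \<Rightarrow> ('v, 'e) lpa_gen set" where
  "lpa_gens E = Vertex ` verts E \<union> Edge ` arcs E \<union> Ghost ` arcs E"

abbreviation vtx :: "'v \<Rightarrow> ('v, 'e) lpa_gen word \<Rightarrow>\<^sub>0 'k::field" where
  "vtx v \<equiv> free_gen (Vertex v)"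

abbreviation edg :: "'e \<Rightarrow> ('v, 'e) lpa_gen word \<Rightarrow>\<^sub>0 'k::field" where
  "edg e \<equiv> free_gen (Edge e)"

abbreviation gst :: "'e \<Rightarrow> ('v, 'e) lpa_gen word \<Rightarrow>\<^sub>0 'k::field" where
  "gst e \<equiv> free_gen (Ghost e)"

text \<open>A relation \<open>p = q\<close> is represented by \<open>p - q\<close>.\<close>

inductive_set lpa_relations ::
    "('v, 'e) pre_digraph \<Rightarrow> (('v, 'e) lpa_gen word \<Rightarrow>\<^sub>0 'k::field) set"
  for E :: "('v, 'e) pre_digraph" where
  vertex_vertex: "\<lbrakk>v \<in> verts E; w \<in> verts E\<rbrakk> \<Longrightarrow>
     vtx v * vtx w - (if v = w then vtx w else 0) \<in> lpa_relations E"
| range_edge: "e \<in> arcs E \<Longrightarrow> vtx (head E e) * edg e - edg e \<in> lpa_relations E"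
| edge_source: "e \<in> arcs E \<Longrightarrow> edg e * vtx (tail E e) - edg e \<in> lpa_relations E"
| source_ghost: "e \<in> arcs E \<Longrightarrow> vtx (tail E e) * gst e - gst e \<in> lpa_relations E"
| ghost_range: "e \<in> arcs E \<Longrightarrow> gst e * vtx (head E e) - gst e \<in> lpa_relations E"
| ghost_edge: "\<lbrakk>e \<in> arcs E; f \<in> arcs E\<rbrakk> \<Longrightarrow>
     gst e * edg f - (if e = f then vtx (tail E e) else 0) \<in> lpa_relations E"
| regular: "\<lbrakk>v \<in> verts E; regular_vertex E v\<rbrakk> \<Longrightarrow>
     vtx v - (\<Sum>e\<in>in_arcs E v. edg e * gst e) \<in> lpa_relations E"

text \<open>The type argument \<open>K\<close> only determines the field.\<close>

definition leavitt_path_algebra ::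
    "'k::field itself \<Rightarrow> ('v, 'e) pre_digraph \<Rightarrow>
       ('k, (('v, 'e) lpa_gen word \<Rightarrow>\<^sub>0 'k) set) k_algebra" where
  "leavitt_path_algebra K E =
     quotient_algebra (free_algebra (lpa_gens E))
       (alg_ideal (free_algebra (lpa_gens E)) hull lpa_relations E)"

end

theory Submission
  imports Defs
begin

text \<open>
  Let \<open>R\<close> be the algebra \<open>L\<close>, whose unit is the sum of the vertices, and \<open>T = [R, R]\<close>. Two independent
  facts combine: \<open>T\<close> is a simple Lie algebra iff \<open>1 \<notin> T\<close>, and \<open>1 \<in> T\<close> iff \<open>(1, \<dots>, 1)\<close> lies in the span of
  the rows \<open>B\<^sub>i\<close>.

  The first fact (\<open>simple_lie_iff\<close>) is Herstein's theory of Lie ideals, for a simple unital ring with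
  an idempotent \<open>e \<noteq> 0, 1\<close>. If \<open>1 \<in> T\<close>, the scalars are an ideal of \<open>T\<close> that brackets to \<open>0\<close>. Let
  \<open>1 \<notin> T\<close> and let \<open>U \<noteq> 0\<close> be an ideal of \<open>T\<close>. Then \<open>U\<close> is not abelian
  (\<open>derived_stable_noncommutative\<close>): it has no nonzero central element, as that would be invertible and
  put \<open>1\<close> into \<open>T\<close>, so some element has a nonzero off-diagonal Peirce component with respect to \<open>e\<close>. In
  an abelian \<open>U\<close> such a component satisfies Jordan identities that force \<open>1 = [w, y]\<close> for a suitable \<open>w\<close>
  and \<open>y\<close> (\<open>jordan_nondegenerate\<close>). This is uniform in the characteristic; the familiar exception of
  characteristic 2 and dimension 4 is excluded by \<open>1 \<notin> T\<close>. Hence also \<open>[U, U]\<close> and its derived ideal are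
  not abelian, and from two elements that do not commute there one gets a nonzero two-sided ideal of \<open>R\<close>
  inside \<open>{x. [x, R] \<subseteq> U}\<close>, whence \<open>[R, R] \<subseteq> U\<close> (\<open>derived_simple\<close>).

  The idempotent comes from nontriviality (\<open>nontrivial_idempotent\<close>): if \<open>0\<close> and \<open>1\<close> are the only
  idempotents, a single vertex and at most one edge (a loop) survive in \<open>L\<close>, and evaluating all of them
  at \<open>1\<close> is a homomorphism onto the field, injective by simplicity.

  For the second fact (\<open>one_in_derived_iff\<close>), at a regular vertex \<open>v\<close> one has
  \<open>v = \<Sum> e e\<^sup>* \<equiv> \<Sum> e\<^sup>* e = \<Sum> s(e)\<close> modulo \<open>T\<close>, so each row \<open>B\<^sub>i\<close> gives an element \<open>\<Sum>\<^sub>j B\<^sub>i\<^sub>j v\<^sub>j\<close> of \<open>T\<close>.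
  Conversely a linear functional that kills all rows extends from the vertices to a trace on \<open>L\<close>
  (\<open>trace_functional_path_trace\<close>), which separates \<open>1\<close> from \<open>T\<close> if it does not kill \<open>(1, \<dots>, 1)\<close>.

  The ring theory is done for subsets of a ring type. The cosets that make up \<open>L\<close> do not form
  such a type, so \<open>L\<close> is first represented faithfully by linear endomorphisms of the space of all
  noncommutative polynomials (\<open>quotient_representation\<close>).
\<close>

section \<open>Lie ideals of the commutator ring of a simple ring\<close>

definition additive_subgroup :: "'a::ab_group_add set \<Rightarrow> bool" where
  "additive_subgroup S \<longleftrightarrow> 0 \<in> S \<and> (\<forall>x\<in>S. \<forall>y\<in>S. x + y \<in> S) \<and> (\<forall>x\<in>S. - x \<in> S)"

abbreviation additive_span :: "'a::ab_group_add set \<Rightarrow> 'a set" where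
  "additive_span S \<equiv> additive_subgroup hull S"

definition bracket :: "'a::ring \<Rightarrow> 'a \<Rightarrow> 'a" where
  "bracket x y = x * y - y * x"

lemma additive_subgroup_0: "additive_subgroup S \<Longrightarrow> 0 \<in> S"
  and additive_subgroup_add: "additive_subgroup S \<Longrightarrow> x \<in> S \<Longrightarrow> y \<in> S \<Longrightarrow> x + y \<in> S"
  and additive_subgroup_minus: "additive_subgroup S \<Longrightarrow> x \<in> S \<Longrightarrow> - x \<in> S"
  by (auto simp: additive_subgroup_def)

lemma additive_subgroup_diff: "additive_subgroup S \<Longrightarrow> x \<in> S \<Longrightarrow> y \<in> S \<Longrightarrow> x - y \<in> S"
  using additive_subgroup_add[of S x "- y"] additive_subgroup_minus[of S y] by simp

lemma additive_subgroupI: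
  assumes "0 \<in> S" "\<And>x y. x \<in> S \<Longrightarrow> y \<in> S \<Longrightarrow> x + y \<in> S" "\<And>x. x \<in> S \<Longrightarrow> - x \<in> S"
  shows "additive_subgroup S"
  using assms by (auto simp: additive_subgroup_def)

lemma additive_subgroup_span: "additive_subgroup (additive_span S)"
  by (rule hull_in) (auto simp: additive_subgroup_def)

lemma additive_span_induct [consumes 1, case_names base zero add minus]:
  assumes "x \<in> additive_span S"
    and "\<And>x. x \<in> S \<Longrightarrow> P x" "P 0" "\<And>x y. P x \<Longrightarrow> P y \<Longrightarrow> P (x + y)" "\<And>x. P x \<Longrightarrow> P (- x)"
  shows "P x"
  using assms(1) by (rule hull_induct) (auto simp: additive_subgroup_def intro: assms(2-))

lemma bracket_anticomm: "bracket x y = - bracket y x"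
  by (simp add: bracket_def)

lemma bracket_add_left: "bracket (x + y) z = bracket x z + bracket y z"
  and bracket_add_right: "bracket z (x + y) = bracket z x + bracket z y"
  and bracket_minus_left: "bracket (- x) z = - bracket x z"
  and bracket_minus_right: "bracket z (- x) = - bracket z x"
  and bracket_0_left: "bracket 0 z = 0"
  and bracket_0_right: "bracket z 0 = 0"
  by (simp_all add: bracket_def algebra_simps)

lemmas bracket_linear = bracket_add_left bracket_add_right bracket_minus_left bracket_minus_right
  bracket_0_left bracket_0_right

lemma bracket_jacobi: "bracket (bracket x y) z = bracket (bracket x z) y + bracket x (bracket y z)"
  by (simp add: bracket_def algebra_simps)

lemma bracket_between:
  assumes "p * (u * x) = u * x" "p * (x * u) = x * u" "(u * x) * q = u * x" "(x * u) * q = x * u"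
  shows "p * bracket u x * q = bracket u x"
  using assms by (simp add: bracket_def left_diff_distrib right_diff_distrib)

text \<open>The unit \<open>i\<close> belongs to the subring and may differ from the identity of the ambient ring: the
  representation used below sends the unit of the algebra to a projection.\<close>

locale unital_subring =
  fixes R :: "'a::ring set" and i :: 'a
  assumes subgroup: "additive_subgroup R"
    and mult_closed [intro, simp]: "x \<in> R \<Longrightarrow> y \<in> R \<Longrightarrow> x * y \<in> R"
    and unit_closed [intro, simp]: "i \<in> R"
    and unit_left [simp]: "x \<in> R \<Longrightarrow> i * x = x"
    and unit_right [simp]: "x \<in> R \<Longrightarrow> x * i = x"
begin

lemma zero_closed [intro, simp]: "0 \<in> R"
  and add_closed [intro, simp]: "x \<in> R \<Longrightarrow> y \<in> R \<Longrightarrow> x + y \<in> R"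
  and minus_closed [intro, simp]: "x \<in> R \<Longrightarrow> - x \<in> R"
  and diff_closed [intro, simp]: "x \<in> R \<Longrightarrow> y \<in> R \<Longrightarrow> x - y \<in> R"
  using subgroup additive_subgroup_diff by (auto simp: additive_subgroup_def)

lemma bracket_closed [intro, simp]: "x \<in> R \<Longrightarrow> y \<in> R \<Longrightarrow> bracket x y \<in> R"
  by (simp add: bracket_def)

definition derived :: "'a set" where
  "derived = additive_span {bracket x y | x y. x \<in> R \<and> y \<in> R}"

lemma derived_subgroup: "additive_subgroup derived"
  by (simp add: derived_def additive_subgroup_span)

lemma bracket_in_derived [intro, simp]: "x \<in> R \<Longrightarrow> y \<in> R \<Longrightarrow> bracket x y \<in> derived"
  unfolding derived_def by (rule hull_inc) auto

lemma derived_subset: "derived \<subseteq> R"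
  unfolding derived_def by (rule hull_minimal) (use subgroup in auto)

lemma derivedD [dest, simp]: "x \<in> derived \<Longrightarrow> x \<in> R"
  using derived_subset by auto

lemma derived_induct [consumes 1, case_names base zero add minus]:
  assumes "x \<in> derived"
    and "\<And>x y. x \<in> R \<Longrightarrow> y \<in> R \<Longrightarrow> P (bracket x y)" "P 0"
      "\<And>x y. P x \<Longrightarrow> P y \<Longrightarrow> P (x + y)" "\<And>x. P x \<Longrightarrow> P (- x)"
  shows "P x"
  using assms(1) unfolding derived_def
  by (rule additive_span_induct) (auto intro: assms(2-))

definition two_sided_ideal :: "'a set \<Rightarrow> bool" where
  "two_sided_ideal I \<longleftrightarrow>
     I \<subseteq> R \<and> additive_subgroup I \<and> (\<forall>a\<in>R. \<forall>x\<in>I. a * x \<in> I \<and> x * a \<in> I)"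

text \<open>
  Ideals of the Lie ring \<open>[R, R]\<close>, except that they need not be contained in it. This generality is
  for sets such as \<open>{x. [x, R] \<subseteq> U}\<close>.
\<close>

definition derived_stable :: "'a set \<Rightarrow> bool" where
  "derived_stable U \<longleftrightarrow>
     U \<subseteq> R \<and> additive_subgroup U \<and> (\<forall>u\<in>U. \<forall>t\<in>derived. bracket u t \<in> U)"

lemma derived_stable_derived: "derived_stable derived"
  by (auto simp: derived_stable_def derived_subgroup)

end

locale simple_unital_subring = unital_subring +
  assumes simple: "two_sided_ideal I \<Longrightarrow> I = {0} \<or> I = R"
begin

lemma ideal_with_nonzero: "two_sided_ideal I \<Longrightarrow> x \<in> I \<Longrightarrow> x \<noteq> 0 \<Longrightarrow> I = R"
  using simple by blast

text \<open>Simple rings are prime: the elements \<open>x\<close> with \<open>x R b = 0\<close> form a two-sided ideal.\<close>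

lemma prime:
  assumes "a \<in> R" "b \<in> R" "a \<noteq> 0" and z: "\<And>r. r \<in> R \<Longrightarrow> a * r * b = 0"
  shows "b = 0"
proof -
  let ?I = "{x \<in> R. \<forall>r\<in>R. x * r * b = 0}"
  have "two_sided_ideal ?I"
    unfolding two_sided_ideal_def additive_subgroup_def
    by (auto simp: algebra_simps) (metis mult.assoc mult_closed mult_zero_right)+
  then have "?I = R"
    by (rule ideal_with_nonzero[of _ a]) (use assms in auto)
  then have "i * i * b = 0" by blast
  then show ?thesis using assms by simp
qed

text \<open>A nonzero central element of \<open>R\<close> is invertible, so it cannot be a sum of commutators unless
  the unit is one: \<open>[x, y] z = [x, y z]\<close> for central \<open>z\<close>.\<close>

lemma central_in_derived:
  assumes u: "u \<in> derived" "u \<noteq> 0" and central: "\<And>r. r \<in> R \<Longrightarrow> u * r = r * u"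
  shows "i \<in> derived"
proof -
  have uR: "u \<in> R" using u by auto
  let ?I = "{u * r | r. r \<in> R}"
  have "two_sided_ideal ?I"
    unfolding two_sided_ideal_def
  proof (intro conjI ballI)
    show "?I \<subseteq> R" using uR by auto
    show "additive_subgroup ?I"
    proof (rule additive_subgroupI)
      show "0 \<in> ?I" by (rule CollectI, rule exI[of _ 0]) simp
      show "x + y \<in> ?I" if "x \<in> ?I" "y \<in> ?I" for x y
        using that by (auto simp: distrib_left[symmetric])
      show "- x \<in> ?I" if "x \<in> ?I" for x
        using that by (auto simp: mult_minus_right[symmetric] simp del: mult_minus_right)
    qed
    fix a x assume a: "a \<in> R" and "x \<in> ?I"
    then obtain r where r: "x = u * r" "r \<in> R" by auto
    have "a * x = u * (a * r)" using central[OF a] r by (simp add: mult.assoc[symmetric])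
    then show "a * x \<in> ?I" using a r by auto
    show "x * a \<in> ?I" using a r by (auto simp: mult.assoc)
  qed
  moreover have "u \<in> ?I" using uR by (auto intro!: exI[of _ i])
  ultimately have IR: "?I = R" by (rule ideal_with_nonzero[OF _ _ u(2)])
  have "i \<in> ?I" by (subst IR) (rule unit_closed)
  then obtain z where z: "z \<in> R" "u * z = i" by auto
  have zc: "z * r = r * z" if r: "r \<in> R" for r
  proof -
    have "z * r = z * (r * u) * z" using r z by (simp add: mult.assoc)
    also have "\<dots> = z * (u * r) * z" using central[OF r] by simp
    also have "\<dots> = (z * u) * r * z" by (simp add: mult.assoc)
    also have "z * u = i" using central z by metis
    finally show ?thesis using r z by simp
  qed
  have "t * z \<in> derived" if "t \<in> derived" for t
    using that
  proof (induction rule: derived_induct)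
    case (base x y)
    have "bracket x y * z = bracket x (y * z)"
      using base zc[of x] by (simp add: bracket_def algebra_simps)
    then show ?case using base z by simp
  qed (auto simp: algebra_simps intro: additive_subgroup_0 additive_subgroup_add
        additive_subgroup_minus derived_subgroup)
  from this[OF u(1)] show ?thesis using z by simp
qed

text \<open>A right ideal \<open>w R e\<close> of the corner ring \<open>e R e\<close> that is central in it is a two-sided ideal of a
  simple ring, hence everything. Instead of proving that the corner is simple, the proof passes to
  the elements of \<open>R\<close> all of whose compressions to the corner lie in \<open>w R e\<close>; they form an ideal of \<open>R\<close>.\<close>

lemma corner_central_unit:
  assumes e: "e \<in> R" "e * e = e" and w: "w \<in> R"
    and central: "\<And>r t. r \<in> R \<Longrightarrow> t \<in> R \<Longrightarrow> (e * t * e) * (w * r * e) = (w * r * e) * (e * t * e)"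
    and ew: "e * w = w" and r0: "r0 \<in> R" "w * r0 * e \<noteq> 0"
  obtains r where "r \<in> R" "w * r * e = e"
proof -
  let ?G = "{x \<in> R. \<forall>r\<in>R. \<forall>s\<in>R. \<exists>y\<in>R. e * r * x * s * e = w * y * e}"
  have "two_sided_ideal ?G"
    unfolding two_sided_ideal_def
  proof (intro conjI ballI)
    show "additive_subgroup ?G"
    proof (rule additive_subgroupI)
      show "0 \<in> ?G" by (auto intro!: bexI[of _ 0])
      show "x + y \<in> ?G" if xy: "x \<in> ?G" "y \<in> ?G" for x y
      proof (rule CollectI, intro conjI ballI)
        fix r s assume "r \<in> R" "s \<in> R"
        with xy obtain a b where "a \<in> R" "b \<in> R" "e * r * x * s * e = w * a * e"
          "e * r * y * s * e = w * b * e" by blast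
        then show "\<exists>c\<in>R. e * r * (x + y) * s * e = w * c * e"
          by (intro bexI[of _ "a + b"]) (auto simp: algebra_simps)
      qed (use xy in auto)
      show "- x \<in> ?G" if x: "x \<in> ?G" for x
      proof (rule CollectI, intro conjI ballI)
        fix r s assume "r \<in> R" "s \<in> R"
        with x obtain a where "a \<in> R" "e * r * x * s * e = w * a * e" by blast
        then show "\<exists>c\<in>R. e * r * (- x) * s * e = w * c * e"
          by (intro bexI[of _ "- a"]) (auto simp: algebra_simps)
      qed (use x in auto)
    qed
    fix a x assume a: "a \<in> R" and x: "x \<in> ?G"
    show "a * x \<in> ?G" "x * a \<in> ?G"
    proof -
      show "a * x \<in> ?G"
      proof (rule CollectI, intro conjI ballI)
        fix r s assume "r \<in> R" "s \<in> R"
        then have "r * a \<in> R" "s \<in> R" using a by auto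
        with x have "\<exists>y\<in>R. e * (r * a) * x * s * e = w * y * e" by blast
        then show "\<exists>y\<in>R. e * r * (a * x) * s * e = w * y * e" by (simp add: mult.assoc)
      qed (use a x in auto)
      show "x * a \<in> ?G"
      proof (rule CollectI, intro conjI ballI)
        fix r s assume "r \<in> R" "s \<in> R"
        then have "r \<in> R" "a * s \<in> R" using a by auto
        with x have "\<exists>y\<in>R. e * r * x * (a * s) * e = w * y * e" by blast
        then show "\<exists>y\<in>R. e * r * (x * a) * s * e = w * y * e" by (simp add: mult.assoc)
      qed (use a x in auto)
    qed
  qed auto
  moreover have "w * r0 * e \<in> ?G"
  proof (rule CollectI, intro conjI ballI)
    fix r s assume rs: "r \<in> R" "s \<in> R"
    have "e * r * (w * r0 * e) * s * e = (e * r * e) * (w * r0 * e) * (s * e)"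
      using ew by (simp add: mult.assoc mult.assoc[of e w, symmetric])
    also have "\<dots> = (w * r0 * e) * (e * r * e) * (s * e)" using central r0 rs by simp
    finally show "\<exists>y\<in>R. e * r * (w * r0 * e) * s * e = w * y * e"
      using r0(1) rs e(1) by (intro bexI[of _ "r0 * e * (e * r * e) * s"]) (auto simp: mult.assoc)
  qed (use w r0 e in auto)
  ultimately have "?G = R" using r0(2) by (rule ideal_with_nonzero)
  then have "i \<in> ?G" by simp
  then obtain y where "y \<in> R" "e * i * i * i * e = w * y * e" using unit_closed by blast
  then show ?thesis using e that by simp
qed

text \<open>If both products vanished for all \<open>r\<close> and \<open>s\<close>, then \<open>1\<close> would be a commutator. By the first
  identity any two elements of \<open>I = w R e\<close> anticommute. For \<open>p, q \<in> I\<close> and \<open>a \<in> e R e\<close> also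
  \<open>p a \<in> I\<close>, so \<open>p a q = - q p a = p q a\<close>, and by primeness \<open>I\<close> is central in \<open>e R e\<close>; hence \<open>e = w y\<close>
  with \<open>y \<in> (1 - e) R e\<close>. Put \<open>g = y w\<close>. The second identity, applied to \<open>y\<close> and
  \<open>z \<in> (1 - e) R e\<close> and multiplied by \<open>y\<close> on the right, gives \<open>g z + z = 0\<close>, so \<open>g = - (1 - e)\<close> by
  primeness and \<open>[w, y] = e - g = 1\<close>.\<close>

lemma jordan_nondegenerate:
  assumes e: "e \<in> R" "e * e = e" "e \<noteq> 0" and w: "w \<in> R" "w \<noteq> 0" "e * w = w" "w * e = 0"
    and ni: "i \<notin> derived"
  obtains r s where "r \<in> R" "s \<in> R"
    "w * (((i - e) * r * e) * w * ((i - e) * s * e) + ((i - e) * s * e) * w * ((i - e) * r * e)) \<noteq> 0 \<or>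
     (((i - e) * r * e) * w * ((i - e) * s * e) + ((i - e) * s * e) * w * ((i - e) * r * e)) * w \<noteq> 0"
proof (rule ccontr)
  note witness = that
  assume "\<not> thesis"
  define f where "f = i - e"
  have f: "f \<in> R" "f * f = f" "e * f = 0" "f * e = 0"
    using e by (auto simp: f_def algebra_simps)
  have wf: "w * f = w" using w by (simp add: f_def algebra_simps)
  have ei: "\<And>x. e * (e * x) = e * x" and fi: "\<And>x. f * (f * x) = f * x"
    and ef: "\<And>x. e * (f * x) = 0" and fe: "\<And>x. f * (e * x) = 0"
    and we: "\<And>x. w * (e * x) = 0" and wfx: "\<And>x. w * (f * x) = w * x"
    and ewx: "\<And>x. e * (w * x) = w * x"
    using e f w wf by (auto simp: mult.assoc[symmetric])
  note rules = mult.assoc ei fi ef fe we wfx ewx e(2) f(2-) w(3,4) wf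
  have A: "w * ((f * r * e) * w * (f * s * e) + (f * s * e) * w * (f * r * e)) = 0"
   and B: "((f * r * e) * w * (f * s * e) + (f * s * e) * w * (f * r * e)) * w = 0"
    if "r \<in> R" "s \<in> R" for r s
    using \<open>\<not> thesis\<close> witness[OF that] unfolding f_def by blast+
  have A': "(w * r * e) * (w * s * e) = - ((w * s * e) * (w * r * e))" if "r \<in> R" "s \<in> R" for r s
    using A[OF that] by (simp add: rules distrib_left eq_neg_iff_add_eq_0)
  obtain r0 where r0: "r0 \<in> R" "w * r0 * e \<noteq> 0"
    using prime[of w e] w e by blast
  have central: "(e * t * e) * (w * r * e) = (w * r * e) * (e * t * e)" if rt: "r \<in> R" "t \<in> R" for r t
  proof -
    define q where "q = w * r * e"
    define a where "a = e * t * e"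
    have qa: "q \<in> R" "a \<in> R" "e * q = q" "q * e = q" "e * a = a" "a * e = a"
      using rt w e by (auto simp: q_def a_def rules)
    have ea: "e * (a * x) = a * x" "a * (e * x) = a * x" for x using qa by (simp_all add: mult.assoc[symmetric])
    have *: "(w * s * e) * (a * q - q * a) = 0" if s: "s \<in> R" for s
    proof -
      have "(w * s * e) * (a * q) = (w * (s * a) * e) * (w * r * e)"
        using qa ea by (simp add: q_def rules)
      also have "\<dots> = - ((w * r * e) * (w * (s * a) * e))"
        by (rule A') (use s qa rt in auto)
      also have "\<dots> = - ((w * r * e) * (w * s * e)) * a"
        using qa ea by (simp add: rules)
      also have "\<dots> = (w * s * e) * (w * r * e) * a"
        using A'[OF rt(1) s] by simp
      finally show ?thesis by (simp add: q_def algebra_simps)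
    qed
    have "(w * r0 * e) * s * (a * q - q * a) = 0" if s: "s \<in> R" for s
    proof -
      have "s * (a * q - q * a) = s * e * (a * q - q * a)"
        using qa by (simp add: algebra_simps) (simp add: mult.assoc[symmetric] qa)
      moreover have "(w * (r0 * e * s) * e) * (a * q - q * a) = 0"
        by (rule *) (use r0 s e in auto)
      ultimately show ?thesis by (simp add: mult.assoc)
    qed
    then have "a * q - q * a = 0"
      by (rule prime[rotated 3]) (use r0 w e qa in auto)
    then show ?thesis by (simp add: q_def a_def)
  qed
  obtain r1 where r1: "r1 \<in> R" "w * r1 * e = e"
    using corner_central_unit[OF e(1,2) w(1) central w(3) r0] by auto
  define y where "y = f * r1 * e"
  define g where "g = y * w"
  have y: "y \<in> R" "w * y = e" "f * y = y" "y * e = y"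
    using r1 f e by (auto simp: y_def rules)
  have g: "g \<in> R" "f * g = g" "g * f = g" 
    using y w by (simp add: g_def, simp only: g_def mult.assoc[symmetric] y, simp only: g_def mult.assoc wf)
  have "(g + f) * s * e = 0" if s: "s \<in> R" for s
  proof -
    define z where "z = f * s * e"
    have z: "z * e = z" by (simp add: z_def rules)
    have "(y * w * z + z * w * y) * w = 0"
      using B[OF r1(1) s] by (simp add: y_def z_def)
    then have "g * z * w + z * w = 0"
      using y z w by (simp add: g_def algebra_simps)
    then have "(g * z * w + z * w) * y = 0" by simp
    then have "g * z + z = 0"
      using y(2) z by (simp add: distrib_right mult.assoc)
    moreover have "g * z = g * s * e" using g by (simp add: z_def mult.assoc[symmetric])
    ultimately show ?thesis by (simp add: z_def distrib_right)
  qed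
  moreover have "g + f \<in> R" using g f by simp
  ultimately have "g + f = 0" using prime[of "g + f" e] e by blast
  then have "g = - f" by (simp add: eq_neg_iff_add_eq_0)
  then have "bracket w y = i" using y by (simp add: bracket_def g_def[symmetric] f_def)
  then show False using ni w(1) y(1) bracket_in_derived by metis
qed

lemma off_diagonal_in_derived:
  assumes "e \<in> R" "e * e = e" "r \<in> R"
  shows "e * r * (i - e) \<in> derived" "(i - e) * r * e \<in> derived"
proof -
  have "e * r * (i - e) = bracket e (e * r * (i - e))"
    using assms by (simp add: bracket_def algebra_simps) (simp add: mult.assoc[symmetric])
  then show "e * r * (i - e) \<in> derived" using assms by (metis bracket_in_derived diff_closed mult_closed unit_closed)
  have "(i - e) * r * e = bracket ((i - e) * r * e) e"
    using assms by (simp add: bracket_def algebra_simps) (simp add: mult.assoc[symmetric])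
  then show "(i - e) * r * e \<in> derived" using assms by (metis bracket_in_derived diff_closed mult_closed unit_closed)
qed

text \<open>The products \<open>y z\<close> and \<open>z y\<close> of two elements of \<open>e R (1 - e)\<close> vanish; what remains of the double
  bracket is, up to sign, the triple product of the Jordan pair \<open>(e R (1 - e), (1 - e) R e)\<close>.\<close>

lemma double_bracket_off_diagonal:
  assumes e: "e \<in> R" "e * e = e" and rs: "u \<in> R" "r \<in> R" "s \<in> R"
  defines "y \<equiv> e * r * (i - e)" and "z \<equiv> e * s * (i - e)"
  shows "bracket (bracket u y) z = - (y * u * z + z * u * y)"
proof -
  have fe: "(i - e) * e = 0" using e by (simp add: algebra_simps)
  have "y * z = 0" "z * y = 0"
    by (simp_all add: y_def z_def mult.assoc) (simp_all add: mult.assoc[symmetric] fe)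
  then show ?thesis
    by (simp add: bracket_def algebra_simps) (simp add: mult.assoc[symmetric])
qed

text \<open>Double brackets of \<open>u\<close> with elements of \<open>e R (1 - e)\<close> depend only on the component
  \<open>c = (1 - e) u e\<close>, so nondegeneracy at \<open>c\<close> yields a nonzero \<open>w \<in> U \<inter> e R (1 - e)\<close>. Double brackets of
  \<open>w\<close> with elements of \<open>(1 - e) R e\<close> yield \<open>w' \<in> U \<inter> (1 - e) R e\<close>. If \<open>w\<close> and \<open>w'\<close> commuted, both products
  \<open>w w' \<in> e R e\<close> and \<open>w' w \<in> (1 - e) R (1 - e)\<close> would vanish, against nondegeneracy at \<open>w\<close>.\<close>

lemma bracket_nonzero_of_off_diagonal:
  assumes e: "e \<in> R" "e * e = e" "e \<noteq> 0" "e \<noteq> i" and ni: "i \<notin> derived"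
    and U: "derived_stable U" "u \<in> U" "(i - e) * u * e \<noteq> 0"
  obtains x y where "x \<in> U" "y \<in> U" "bracket x y \<noteq> 0"
proof (rule ccontr)
  note witness = that
  assume "\<not> thesis"
  then have comm: "bracket x y = 0" if "x \<in> U" "y \<in> U" for x y using witness[OF that] by blast
  define f where "f = i - e"
  have f: "f \<in> R" "f * f = f" "e * f = 0" "f * e = 0" "f \<noteq> 0" "i - f = e"
    using e by (auto simp: f_def algebra_simps)
  have ei: "\<And>x. e * (e * x) = e * x" and fi: "\<And>x. f * (f * x) = f * x"
    and ef: "\<And>x. e * (f * x) = 0" and fe: "\<And>x. f * (e * x) = 0"
    using e f by (auto simp: mult.assoc[symmetric])
  note rules = mult.assoc ei fi ef fe e(2) f(2-4)
  have UR: "U \<subseteq> R" and Uadd: "additive_subgroup U"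
    and UT: "\<And>x t. x \<in> U \<Longrightarrow> t \<in> derived \<Longrightarrow> bracket x t \<in> U"
    using U(1) by (auto simp: derived_stable_def)
  have step: "y * x * z + z * x * y \<in> U"
    if "x \<in> U" "p \<in> R" "p * p = p" "r \<in> R" "s \<in> R" "y = p * r * (i - p)" "z = p * s * (i - p)"
    for x y z p r s
  proof -
    have "bracket (bracket x y) z \<in> U"
      using UT that off_diagonal_in_derived[of p r] off_diagonal_in_derived[of p s] by auto
    then have "- (y * x * z + z * x * y) \<in> U"
      using that UR double_bracket_off_diagonal[of p x r s] by auto
    then show ?thesis using additive_subgroup_minus[OF Uadd] by (metis minus_minus)
  qed
  define c where "c = f * u * e"
  have c: "c \<in> R" "c \<noteq> 0" "f * c = c" "c * f = 0" "u \<in> R"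
    using U UR e f by (auto simp: c_def rules)
  obtain r s where rs: "r \<in> R" "s \<in> R" and
    "c * ((e * r * f) * c * (e * s * f) + (e * s * f) * c * (e * r * f)) \<noteq> 0 \<or>
     ((e * r * f) * c * (e * s * f) + (e * s * f) * c * (e * r * f)) * c \<noteq> 0"
    by (rule jordan_nondegenerate[OF f(1,2,5) c(1-4) ni, unfolded f(6)])
  then have nz: "(e * r * f) * c * (e * s * f) + (e * s * f) * c * (e * r * f) \<noteq> 0" by auto
  define w where "w = (e * r * f) * c * (e * s * f) + (e * s * f) * c * (e * r * f)"
  have "w = (e * r * f) * u * (e * s * f) + (e * s * f) * u * (e * r * f)"
    by (simp add: w_def c_def rules)
  moreover have "\<dots> \<in> U"
    by (rule step[of u e r s]) (use U e rs in \<open>auto simp: f_def\<close>)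
  ultimately have wU: "w \<in> U" by simp
  have w: "w \<in> R" "w \<noteq> 0" "e * w = w" "w * e = 0"
    using nz rs e f c by (auto simp: w_def rules distrib_left distrib_right)
  obtain r' s' where rs': "r' \<in> R" "s' \<in> R" and
    nz': "w * ((f * r' * e) * w * (f * s' * e) + (f * s' * e) * w * (f * r' * e)) \<noteq> 0 \<or>
     ((f * r' * e) * w * (f * s' * e) + (f * s' * e) * w * (f * r' * e)) * w \<noteq> 0"
    by (rule jordan_nondegenerate[OF e(1-3) w ni]) (auto simp: f_def)
  define w' where "w' = (f * r' * e) * w * (f * s' * e) + (f * s' * e) * w * (f * r' * e)"
  have "w' \<in> U" unfolding w'_def
    by (rule step[of w f r' s']) (use wU f rs' in auto)
  then have "bracket w w' = 0" using comm wU by blast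
  then have eq: "w * w' = w' * w" by (simp add: bracket_def)
  have "e * w' = 0" by (simp add: w'_def distrib_left rules)
  have "w * w' = e * (w * w')" using w by (simp add: mult.assoc[symmetric])
  also have "\<dots> = e * w' * w" by (simp add: eq mult.assoc)
  also have "\<dots> = 0" using \<open>e * w' = 0\<close> by simp
  finally show False using nz' eq by (simp add: w'_def)
qed

text \<open>The off-diagonal parts determine the corners: for \<open>a \<in> p R p\<close> and \<open>x \<in> p R (1 - p)\<close> the element \<open>u\<close>
  commutes with \<open>x\<close> and with \<open>a x\<close>, so \<open>[u, a] x = 0\<close>, and \<open>[u, a] = 0\<close> by primeness.\<close>

lemma commutes_off_diagonal_central:
  assumes e: "e \<in> R" "e * e = e" "e \<noteq> 0" "e \<noteq> i" and u: "u \<in> R" "u * e = e * u"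
    and a: "\<And>r. r \<in> R \<Longrightarrow> bracket u (e * r * (i - e)) = 0"
    and b: "\<And>r. r \<in> R \<Longrightarrow> bracket u ((i - e) * r * e) = 0"
    and r: "r \<in> R"
  shows "u * r = r * u"
proof -
  have corner: "bracket u (p * r * p) = 0"
    if p: "p \<in> R" "p * p = p" "p \<noteq> i" "u * p = p * u"
      and c: "\<And>s. s \<in> R \<Longrightarrow> bracket u (p * s * (i - p)) = 0" for p
  proof -
    let ?d = "bracket u (p * r * p)"
    have "p * (p * x) = p * x" for x using p(2) by (simp add: mult.assoc[symmetric])
    then have dp: "?d * p = ?d"
      using p by (simp add: bracket_def algebra_simps)
    have d0: "?d * s * (i - p) = 0" if s: "s \<in> R" for s
    proof -
      have 1: "bracket u (p * s * (i - p)) = 0" "bracket u (p * (r * p * s) * (i - p)) = 0"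
        using c s r p by auto
      have "?d * (p * s * (i - p)) =
          bracket u (p * r * p * (p * s * (i - p))) - p * r * p * bracket u (p * s * (i - p))"
        by (simp add: bracket_def left_diff_distrib right_diff_distrib mult.assoc)
      also have "p * r * p * (p * s * (i - p)) = p * (r * p * s) * (i - p)"
        using p by (simp add: mult.assoc) (metis mult.assoc)
      finally have "?d * (p * s * (i - p)) = 0" using 1 by simp
      moreover have "?d * (p * s * (i - p)) = ?d * p * s * (i - p)" by (simp add: mult.assoc)
      ultimately show ?thesis by (simp add: dp)
    qed
    show ?thesis
    proof (rule ccontr)
      assume nz: "?d \<noteq> 0"
      have "i - p = 0"
        by (rule prime[OF _ _ nz d0]) (use p u r in auto)
      with p show False by simp
    qed
  qed
  have "bracket u (e * r * e) = 0" using corner[of e] e u a by blast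
  moreover have "bracket u ((i - e) * r * (i - e)) = 0"
    by (rule corner[of "i - e"]) (use e u b in \<open>auto simp: algebra_simps\<close>)
  moreover have "r = e * r * e + e * r * (i - e) + (i - e) * r * e + (i - e) * r * (i - e)"
    using e r by (simp add: algebra_simps)
  ultimately have "bracket u r = 0"
    using a[OF r] b[OF r] by (metis bracket_add_right add.right_neutral)
  then show ?thesis by (simp add: bracket_def)
qed

text \<open>If every element of \<open>U\<close> were diagonal, then so would be its brackets with the off-diagonal part of
  \<open>R\<close>, which lies in \<open>[R, R]\<close>. These brackets are off-diagonal, so they vanish, and \<open>U\<close> would be
  central.\<close>

lemma derived_stable_noncommutative:
  assumes e: "e \<in> R" "e * e = e" "e \<noteq> 0" "e \<noteq> i" and ni: "i \<notin> derived"
    and U: "derived_stable U" "U \<subseteq> derived" "U \<noteq> {0}"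
  obtains x y where "x \<in> U" "y \<in> U" "bracket x y \<noteq> 0"
proof -
  have f: "i - e \<in> R" "(i - e) * (i - e) = i - e" "i - e \<noteq> 0" "i - e \<noteq> i" "i - (i - e) = e"
    using e by (auto simp: algebra_simps)
  show ?thesis
  proof (cases "\<exists>u\<in>U. (i - e) * u * e \<noteq> 0 \<or> e * u * (i - e) \<noteq> 0")
    case True
    then show ?thesis
      using bracket_nonzero_of_off_diagonal[OF e ni U(1)]
        bracket_nonzero_of_off_diagonal[OF f(1-4) ni U(1)] that unfolding f(5) by metis
  next
    case False
    then have z: "(i - e) * u * e = 0" "e * u * (i - e) = 0" if "u \<in> U" for u using that by auto
    have "0 \<in> U" using U(1) by (auto simp: derived_stable_def additive_subgroup_def)
    then obtain u where u: "u \<in> U" "u \<noteq> 0" using U(3) by blast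
    have uR: "u \<in> R" using u U by auto
    have ue1: "u * e = e * u * e" "e * u = e * u * e" using z[OF u(1)] uR e by (auto simp: algebra_simps)
    have ue: "u * e = e * u" using ue1 by simp
    have UT: "\<And>t. t \<in> derived \<Longrightarrow> bracket u t \<in> U"
      using U(1) u by (auto simp: derived_stable_def)
    have uf: "u * (i - e) = (i - e) * u" using ue uR by (simp add: algebra_simps)
    have "u * r = r * u" if "r \<in> R" for r
    proof (rule commutes_off_diagonal_central[OF e uR ue _ _ that])
      fix r assume r: "r \<in> R"
      let ?x = "e * r * (i - e)" and ?y = "(i - e) * r * e"
      have "e * bracket u ?x * (i - e) = 0" using z UT off_diagonal_in_derived[OF e(1,2) r] by blast
      moreover have "e * bracket u ?x * (i - e) = bracket u ?x"
      proof -
        have "e * (u * ?x) = u * ?x" by (simp add: mult.assoc[symmetric] ue[symmetric]) (simp add: mult.assoc e)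
        moreover have "e * (?x * u) = ?x * u" by (simp add: mult.assoc[symmetric] e)
        moreover have "(u * ?x) * (i - e) = u * ?x" by (simp add: mult.assoc f)
        moreover have "(?x * u) * (i - e) = ?x * u"
          by (simp only: mult.assoc uf) (simp add: mult.assoc[symmetric] , simp add: mult.assoc f)
        ultimately show ?thesis by (rule bracket_between)
      qed
      ultimately show "bracket u ?x = 0" by simp
      have "(i - e) * bracket u ?y * e = 0" using z UT off_diagonal_in_derived[OF e(1,2) r] by blast
      moreover have "(i - e) * bracket u ?y * e = bracket u ?y"
      proof -
        have "(i - e) * (u * ?y) = u * ?y"
          by (simp only: mult.assoc[symmetric] uf[symmetric]) (simp only: mult.assoc f)
        moreover have "(i - e) * (?y * u) = ?y * u" by (simp only: mult.assoc[symmetric] f)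
        moreover have "(u * ?y) * e = u * ?y" by (simp add: mult.assoc e)
        moreover have "(?y * u) * e = ?y * u"
          by (simp only: mult.assoc ue) (simp add: mult.assoc[symmetric], simp add: mult.assoc e)
        ultimately show ?thesis by (rule bracket_between)
      qed
      ultimately show "bracket u ?y = 0" by simp
    qed
    then have "i \<in> derived" using central_in_derived[of u] u U by blast
    with ni show ?thesis by simp
  qed
qed

text \<open>The Lie ideal \<open>[U, U]\<close>, by the Jacobi identity.\<close>

lemma derived_stable_bracket_span:
  assumes "derived_stable U"
  defines "V \<equiv> additive_span {bracket u v | u v. u \<in> U \<and> v \<in> U}"
  shows "derived_stable V" and "U \<subseteq> derived \<Longrightarrow> V \<subseteq> U"
    and "\<And>u v. u \<in> U \<Longrightarrow> v \<in> U \<Longrightarrow> bracket u v \<in> V"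
proof -
  show br: "bracket u v \<in> V" if "u \<in> U" "v \<in> U" for u v
    unfolding V_def by (rule hull_inc) (use that in auto)
  have UR: "U \<subseteq> R" and UT: "\<And>x t. x \<in> U \<Longrightarrow> t \<in> derived \<Longrightarrow> bracket x t \<in> U"
    and Uadd: "additive_subgroup U"
    using assms(1) by (auto simp: derived_stable_def)
  have Vadd: "additive_subgroup V" by (simp add: V_def additive_subgroup_span)
  have "V \<subseteq> R" unfolding V_def by (rule hull_minimal) (use UR subgroup in auto)
  moreover have "bracket x t \<in> V" if "x \<in> V" and t: "t \<in> derived" for x t
    using that(1) unfolding V_def
  proof (induction rule: additive_span_induct)
    case (base x)
    then obtain u v where "u \<in> U" "v \<in> U" "x = bracket u v" by auto
    then show ?case
      using br UT t Vadd by (auto simp: bracket_jacobi[of u v t] V_def[symmetric] intro!: additive_subgroup_add)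
  qed (use Vadd in \<open>auto simp: bracket_linear V_def[symmetric]
      intro: additive_subgroup_0 additive_subgroup_add additive_subgroup_minus\<close>)
  ultimately show "derived_stable V" using Vadd by (auto simp: derived_stable_def)
  show "V \<subseteq> U" if "U \<subseteq> derived"
    unfolding V_def by (rule hull_minimal) (use UT that Uadd in auto)
qed

definition transporter :: "'a set \<Rightarrow> 'a set" where
  "transporter U = {x \<in> R. \<forall>r\<in>R. bracket x r \<in> U}"

lemma transporter_subgroup:
  assumes "additive_subgroup U"
  shows "additive_subgroup (transporter U)"
  by (rule additive_subgroupI)
    (use assms in \<open>auto simp: transporter_def bracket_linear
      intro: additive_subgroup_0 additive_subgroup_add additive_subgroup_minus\<close>)

text \<open>This is where the whole ring \<open>R\<close> in the definition of the transporter matters: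
  \<open>[x y, r] = [x, y r] + [y, r x]\<close>.\<close>

lemma transporter_mult:
  assumes U: "additive_subgroup U" and x: "x \<in> transporter U" "y \<in> transporter U"
  shows "x * y \<in> transporter U"
  unfolding transporter_def
proof (intro CollectI conjI ballI)
  fix r assume r: "r \<in> R"
  have "bracket (x * y) r = bracket x (y * r) + bracket y (r * x)"
    by (simp add: bracket_def algebra_simps)
  then show "bracket (x * y) r \<in> U"
    using x r U by (auto simp: transporter_def intro: additive_subgroup_add)
qed (use x in \<open>auto simp: transporter_def\<close>)

lemma transporter_stable:
  assumes "derived_stable U"
  shows "derived_stable (transporter U)"
  unfolding derived_stable_def
proof (intro conjI ballI)
  have U: "additive_subgroup U" "\<And>x t. x \<in> U \<Longrightarrow> t \<in> derived \<Longrightarrow> bracket x t \<in> U"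
    using assms by (auto simp: derived_stable_def)
  then show "additive_subgroup (transporter U)" by (simp add: transporter_subgroup)
  fix x t assume x: "x \<in> transporter U" and t: "t \<in> derived"
  show "bracket x t \<in> transporter U"
    unfolding transporter_def
  proof (intro CollectI conjI ballI)
    fix r assume "r \<in> R"
    then show "bracket (bracket x t) r \<in> U"
      using x t U by (auto simp: bracket_jacobi[of x t r] transporter_def intro!: additive_subgroup_add)
  qed (use x t in \<open>auto simp: transporter_def\<close>)
qed (auto simp: transporter_def)

text \<open>A subring \<open>S\<close> that contains \<open>[R, R]\<close> contains \<open>[t, t'] r = [t, t' r] - t' [t, r]\<close>, and then, by
  bracketing with \<open>s\<close>, the two-sided ideal generated by \<open>[t, t']\<close>.\<close>

lemma left_stabiliser_everything:
  assumes S: "S \<subseteq> R" "additive_subgroup S" "\<And>x y. x \<in> S \<Longrightarrow> y \<in> S \<Longrightarrow> x * y \<in> S"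
    and T: "derived \<subseteq> S" and nc: "t \<in> derived" "t' \<in> derived" "bracket t t' \<noteq> 0"
  shows "S = R"
proof -
  let ?d = "bracket t t'"
  let ?I = "{x \<in> R. \<forall>r\<in>R. \<forall>s\<in>R. s * x * r \<in> S}"
  have dr: "?d * r \<in> S" if r: "r \<in> R" for r
  proof -
    have "?d * r = bracket t (t' * r) - t' * bracket t r"
      by (simp add: bracket_def algebra_simps)
    moreover have "bracket t (t' * r) \<in> S" "t' * bracket t r \<in> S"
      using r nc subsetD[OF T] by (simp_all add: S(3))
    ultimately show ?thesis using additive_subgroup_diff[OF S(2)] by simp
  qed
  have "s * ?d * r \<in> S" if "s \<in> R" "r \<in> R" for s r
  proof -
    have "s * ?d * r = bracket s (?d * r) + ?d * (r * s)"
      by (simp add: bracket_def algebra_simps)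
    moreover have "bracket s (?d * r) \<in> S" using that nc by (auto intro!: subsetD[OF T])
    ultimately show ?thesis using additive_subgroup_add[OF S(2)] dr that by simp
  qed
  then have dI: "?d \<in> ?I" using nc by auto
  have ideal: "two_sided_ideal ?I"
    unfolding two_sided_ideal_def
  proof (intro conjI ballI)
    show "additive_subgroup ?I"
      by (rule additive_subgroupI)
        (use S(2) in \<open>auto simp: distrib_left distrib_right
          intro: additive_subgroup_0 additive_subgroup_add additive_subgroup_minus\<close>)
    fix a x assume a: "a \<in> R" and x: "x \<in> ?I"
    have "s * (a * x) * r \<in> S" "s * (x * a) * r \<in> S" if "r \<in> R" "s \<in> R" for r s
    proof -
      have "(s * a) * x * r \<in> S" "s * x * (a * r) \<in> S" using x a that by blast+
      then show "s * (a * x) * r \<in> S" "s * (x * a) * r \<in> S" by (simp_all add: mult.assoc)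
    qed
    then show "a * x \<in> ?I" "x * a \<in> ?I" using a x by auto
  qed auto
  have IR: "?I = R" by (rule ideal_with_nonzero[OF ideal dI nc(3)])
  have "i \<in> ?I" by (subst IR) (rule unit_closed)
  then have "i * i * r \<in> S" if "r \<in> R" for r using that unit_closed by blast
  then show ?thesis using S(1) by auto
qed

text \<open>Let \<open>V = [U, U]\<close>, \<open>W = [V, V]\<close> and \<open>A = {x. [x, R] \<subseteq> U}\<close>. By the Jacobi identity \<open>V \<subseteq> A\<close> and
  \<open>[W, R] \<subseteq> A\<close>. For \<open>u, v \<in> W\<close> with \<open>c = [u, v] \<noteq> 0\<close> the identity \<open>c r = [u, v r] - v [u, r]\<close> then shows
  \<open>c R \<subseteq> A\<close>, because \<open>A\<close> is a subring. So the largest right ideal \<open>J\<close> inside \<open>A\<close> is not zero. Its left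
  stabiliser is a subring that contains \<open>[R, R]\<close>, since \<open>A\<close> is stable under \<open>[R, R]\<close>; hence \<open>J\<close> is
  two-sided, \<open>A = R\<close>, and \<open>[R, R] \<subseteq> U\<close>.\<close>

theorem derived_simple:
  assumes e: "e \<in> R" "e * e = e" "e \<noteq> 0" "e \<noteq> i" and ni: "i \<notin> derived"
    and U: "derived_stable U" "U \<subseteq> derived" "U \<noteq> {0}"
  shows "U = derived"
proof -
  note nc = derived_stable_noncommutative[OF e ni]
  let ?D = "\<lambda>U. additive_span {bracket u v | u v. u \<in> U \<and> v \<in> U}"
  have Uadd: "additive_subgroup U"
    and UT: "\<And>x t. x \<in> U \<Longrightarrow> t \<in> derived \<Longrightarrow> bracket x t \<in> U"
    using U(1) by (auto simp: derived_stable_def)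
  define V where "V = ?D U"
  have V: "derived_stable V" "V \<subseteq> U" and brV: "\<And>u v. u \<in> U \<Longrightarrow> v \<in> U \<Longrightarrow> bracket u v \<in> V"
    using derived_stable_bracket_span[OF U(1)] U(2) by (auto simp: V_def)
  have "V \<noteq> {0}" using nc[OF U] brV by (metis singletonD)
  define W where "W = ?D V"
  have VD: "V \<subseteq> derived" using V(2) U(2) by blast
  have W: "derived_stable W" "W \<subseteq> V" and brW: "\<And>u v. u \<in> V \<Longrightarrow> v \<in> V \<Longrightarrow> bracket u v \<in> W"
    using derived_stable_bracket_span[OF V(1)] VD by (auto simp: W_def)
  have WD: "W \<subseteq> derived" using W(2) VD by blast
  have "W \<noteq> {0}" using nc[OF V(1) VD \<open>V \<noteq> {0}\<close>] brW by (metis singletonD)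
  then obtain u v where uv: "u \<in> W" "v \<in> W" "bracket u v \<noteq> 0" using nc[OF W(1) WD] by blast
  define A where "A = transporter U"
  have A: "additive_subgroup A" "derived_stable A" "\<And>x y. x \<in> A \<Longrightarrow> y \<in> A \<Longrightarrow> x * y \<in> A"
    using transporter_subgroup[OF Uadd] transporter_stable[OF U(1)] transporter_mult[OF Uadd]
    by (auto simp: A_def)
  have AR: "A \<subseteq> R" by (auto simp: A_def transporter_def)
  have VA: "V \<subseteq> A" unfolding V_def
  proof (rule hull_minimal)
    show "{bracket u v |u v. u \<in> U \<and> v \<in> U} \<subseteq> A"
    proof clarify
      fix u v assume uv: "u \<in> U" "v \<in> U"
      then have R: "u \<in> R" "v \<in> R" using U(2) by auto
      have "bracket (bracket u v) r \<in> U" if r: "r \<in> R" for r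
      proof -
        have "bracket (bracket u r) v \<in> U"
          using UT[OF uv(2), of "bracket u r"] R r additive_subgroup_minus[OF Uadd]
          by (simp add: bracket_anticomm[of "bracket u r"])
        then show ?thesis
          using UT[OF uv(1), of "bracket v r"] R r Uadd
          by (auto simp: bracket_jacobi[of u v r] intro!: additive_subgroup_add)
      qed
      then show "bracket u v \<in> A" using R by (auto simp: A_def transporter_def)
    qed
  qed (rule A(1))
  have WA: "W \<subseteq> transporter A" unfolding W_def
  proof (rule hull_minimal)
    show "{bracket u v |u v. u \<in> V \<and> v \<in> V} \<subseteq> transporter A"
    proof clarify
      fix u v assume uv: "u \<in> V" "v \<in> V"
      then have R: "u \<in> R" "v \<in> R" and uvA: "u \<in> A" "v \<in> A" and uvU: "u \<in> U" "v \<in> U"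
        using VD VA V(2) by auto
      have "bracket (bracket u v) r \<in> A" if r: "r \<in> R" for r
      proof -
        have "bracket u r \<in> U" "bracket v r \<in> U" using uvA r by (auto simp: A_def transporter_def)
        then have "bracket (bracket u r) v \<in> V" "bracket u (bracket v r) \<in> V"
          using brV uvU by auto
        then show ?thesis
          using VA A(1) by (auto simp: bracket_jacobi[of u v r] intro!: additive_subgroup_add)
      qed
      then show "bracket u v \<in> transporter A" using R by (auto simp: transporter_def)
    qed
  qed (rule transporter_subgroup[OF A(1)])
  let ?c = "bracket u v"
  have uvR: "u \<in> R" "v \<in> R" using uv WD by auto
  have vA: "v \<in> A" and uA: "u \<in> A" using uv W(2) VA by auto
  have cr: "?c * r \<in> A" if r: "r \<in> R" for r
  proof -
    have "?c * r = bracket u (v * r) - v * bracket u r"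
      by (simp add: bracket_def algebra_simps)
    moreover have "bracket u (v * r) \<in> A" "bracket u r \<in> A"
      using uv(1) WA r uvR by (auto simp: transporter_def)
    ultimately show ?thesis using A vA additive_subgroup_diff by metis
  qed
  define J where "J = {x \<in> R. \<forall>r\<in>R. x * r \<in> A}"
  define S where "S = {a \<in> R. \<forall>x\<in>J. a * x \<in> J}"
  have Jadd: "additive_subgroup J" unfolding J_def
    by (rule additive_subgroupI)
      (use A(1) in \<open>auto simp: distrib_right
        intro: additive_subgroup_0 additive_subgroup_add additive_subgroup_minus\<close>)
  have JR: "x \<in> R" if "x \<in> J" for x using that by (simp add: J_def)
  have Jr: "x * a \<in> J" if "x \<in> J" "a \<in> R" for x a
    using that by (auto simp: J_def mult.assoc)
  have "derived \<subseteq> S"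
  proof
    fix t assume t: "t \<in> derived"
    have "t * x * r \<in> A" if x: "x \<in> J" and r: "r \<in> R" for x r
    proof -
      have "x * r \<in> A" "x * (r * t) \<in> A" using x r t by (auto simp: J_def)
      moreover have "bracket (x * r) t \<in> A" using A(2) \<open>x * r \<in> A\<close> t by (auto simp: derived_stable_def)
      moreover have "t * x * r = x * (r * t) - bracket (x * r) t" by (simp add: bracket_def algebra_simps)
      ultimately show ?thesis using additive_subgroup_diff[OF A(1)] by simp
    qed
    moreover have "t \<in> R" using t by simp
    ultimately show "t \<in> S" using JR unfolding S_def J_def by blast
  qed
  moreover have "additive_subgroup S"
    by (rule additive_subgroupI)
      (simp_all add: S_def distrib_right additive_subgroup_0[OF Jadd]
        additive_subgroup_add[OF Jadd] additive_subgroup_minus[OF Jadd])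
  moreover have "x * y \<in> S" if "x \<in> S" "y \<in> S" for x y
    using that by (auto simp: S_def mult.assoc)
  moreover have "S \<subseteq> R" by (auto simp: S_def)
  moreover have "u \<in> derived" "v \<in> derived" using uv WD by auto
  ultimately have "S = R" using left_stabiliser_everything[of S u v] uv(3) by blast
  then have "two_sided_ideal J"
    using Jadd JR Jr by (auto simp: two_sided_ideal_def S_def)
  moreover have "?c \<in> J" using cr uvR by (auto simp: J_def)
  ultimately have JR': "J = R" by (rule ideal_with_nonzero[OF _ _ uv(3)])
  have "i \<in> J" unfolding JR' by (rule unit_closed)
  then have "i * r \<in> A" if "r \<in> R" for r using that unfolding J_def by blast
  then have "R \<subseteq> A" by auto
  then have "bracket x y \<in> U" if "x \<in> R" "y \<in> R" for x y
    using that by (auto simp: A_def transporter_def)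
  then have "derived \<subseteq> U" unfolding derived_def by (intro hull_minimal) (use Uadd in auto)
  then show ?thesis using U(2) by simp
qed

lemma derived_not_abelian:
  assumes e: "e \<in> R" "e * e = e" "e \<noteq> 0" "e \<noteq> i" and ni: "i \<notin> derived"
  obtains x y where "x \<in> derived" "y \<in> derived" "bracket x y \<noteq> 0"
proof -
  have "derived \<noteq> {0}"
  proof
    assume 0: "derived = {0}"
    have z: "e * r * (i - e) = 0" if "r \<in> R" for r
      using off_diagonal_in_derived(1)[OF e(1,2) that] 0 by simp
    have "i - e = 0" by (rule prime[OF e(1) _ e(3) z]) (simp_all add: e(1))
    with e(4) show False by simp
  qed
  then show ?thesis
    by (rule derived_stable_noncommutative[OF e ni derived_stable_derived subset_refl _ that])
qed

end

section \<open>Isomorphisms and quotients of algebras\<close>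

text \<open>The record type imposes no laws. Closure of the carrier under the operations is all that
  transporting ideals, spans and brackets along an isomorphism requires.\<close>

definition closed_algebra :: "('k, 'a) k_algebra \<Rightarrow> bool" where
  "closed_algebra A \<longleftrightarrow> alg_zero A \<in> alg_carrier A \<and>
     (\<forall>x\<in>alg_carrier A. \<forall>y\<in>alg_carrier A. alg_add A x y \<in> alg_carrier A) \<and>
     (\<forall>c. \<forall>x\<in>alg_carrier A. alg_smult A c x \<in> alg_carrier A) \<and>
     (\<forall>x\<in>alg_carrier A. \<forall>y\<in>alg_carrier A. alg_mult A x y \<in> alg_carrier A)"

lemma alg_subspace_carrier: "closed_algebra A \<Longrightarrow> alg_subspace A (alg_carrier A)"
  by (auto simp: closed_algebra_def alg_subspace_def)

lemma alg_subspace_span: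
  assumes "closed_algebra A" "X \<subseteq> alg_carrier A"
  shows "alg_subspace A (alg_span A X)"
proof -
  have "alg_span A X \<subseteq> alg_carrier A"
    using assms alg_subspace_carrier by (intro hull_minimal)
  then show ?thesis
    by (auto simp: alg_subspace_def hull_def)
qed

lemma alg_ideal_hull:
  assumes "closed_algebra A" "X \<subseteq> alg_carrier A"
  shows "alg_ideal A (alg_ideal A hull X)"
proof -
  have "alg_ideal A (alg_carrier A)"
    using assms alg_subspace_carrier by (auto simp: alg_ideal_def closed_algebra_def)
  then have "alg_ideal A hull X \<subseteq> alg_carrier A"
    using assms by (intro hull_minimal)
  then show ?thesis
    by (auto simp: alg_ideal_def alg_subspace_def hull_def)
qed

text \<open>Preservation of zero is a separate assumption, because it follows from the other conditions only
  in the presence of the vector space laws.\<close>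

locale algebra_iso =
  fixes A :: "('k, 'a) k_algebra" and B :: "('k, 'b) k_algebra" and h :: "'a \<Rightarrow> 'b"
  assumes iso: "h \<in> alg_iso A B" and closed: "closed_algebra A"
    and zero: "h (alg_zero A) = alg_zero B"
begin

lemma inj: "inj_on h (alg_carrier A)"
  and carrier_image: "h ` alg_carrier A = alg_carrier B"
  and add: "x \<in> alg_carrier A \<Longrightarrow> y \<in> alg_carrier A \<Longrightarrow> h (alg_add A x y) = alg_add B (h x) (h y)"
  and smult: "x \<in> alg_carrier A \<Longrightarrow> h (alg_smult A c x) = alg_smult B c (h x)"
  and mult: "x \<in> alg_carrier A \<Longrightarrow> y \<in> alg_carrier A \<Longrightarrow> h (alg_mult A x y) = alg_mult B (h x) (h y)"
  using iso by (auto simp: alg_iso_def bij_betw_def)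

lemma closed_A: "alg_zero A \<in> alg_carrier A"
    "x \<in> alg_carrier A \<Longrightarrow> y \<in> alg_carrier A \<Longrightarrow> alg_add A x y \<in> alg_carrier A"
    "x \<in> alg_carrier A \<Longrightarrow> alg_smult A c x \<in> alg_carrier A"
    "x \<in> alg_carrier A \<Longrightarrow> y \<in> alg_carrier A \<Longrightarrow> alg_mult A x y \<in> alg_carrier A"
  using closed by (auto simp: closed_algebra_def)

lemma image_mem: "S \<subseteq> alg_carrier A \<Longrightarrow> x \<in> alg_carrier A \<Longrightarrow> h x \<in> h ` S \<longleftrightarrow> x \<in> S"
  using inj by (meson inj_on_image_mem_iff)

lemma image_eq: "S \<subseteq> alg_carrier A \<Longrightarrow> T \<subseteq> alg_carrier A \<Longrightarrow> h ` S = h ` T \<longleftrightarrow> S = T"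
  using inj by (meson inj_on_image_eq_iff)

lemma subspace_image:
  assumes "S \<subseteq> alg_carrier A"
  shows "alg_subspace B (h ` S) \<longleftrightarrow> alg_subspace A S"
proof -
  have [simp]: "x \<in> alg_carrier A" if "x \<in> S" for x using assms that by auto
  show ?thesis
    using assms unfolding alg_subspace_def carrier_image[symmetric]
    by (auto simp: zero[symmetric] add[symmetric] smult[symmetric] image_mem closed_A)
qed

lemma subset_image: "T \<subseteq> alg_carrier B \<Longrightarrow> \<exists>S\<subseteq>alg_carrier A. T = h ` S"
  unfolding carrier_image[symmetric] by (meson subset_imageE)

lemma ideal_image:
  assumes "S \<subseteq> alg_carrier A"
  shows "alg_ideal B (h ` S) \<longleftrightarrow> alg_ideal A S"
proof -
  have [simp]: "x \<in> alg_carrier A" if "x \<in> S" for x using assms that by auto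
  show ?thesis
    using assms unfolding alg_ideal_def subspace_image[OF assms]
    by (auto simp: mult[symmetric] carrier_image[symmetric] image_mem closed_A)
qed

lemma simple_image: "simple_algebra A \<Longrightarrow> simple_algebra B"
proof -
  assume A: "simple_algebra A"
  then obtain x y where xy: "x \<in> alg_carrier A" "y \<in> alg_carrier A" "alg_mult A x y \<noteq> alg_zero A"
    by (auto simp: simple_algebra_def)
  then have "h (alg_mult A x y) \<noteq> h (alg_zero A)"
    using inj closed_A by (metis inj_on_contraD)
  then have 1: "alg_mult B (h x) (h y) \<noteq> alg_zero B" using xy by (simp add: mult zero)
  have 2: "T = {alg_zero B} \<or> T = alg_carrier B" if T: "alg_ideal B T" for T
  proof -
    have "T \<subseteq> alg_carrier B" using T by (auto simp: alg_ideal_def alg_subspace_def)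
    then obtain S where S: "S \<subseteq> alg_carrier A" "T = h ` S" using subset_image by blast
    then have "alg_ideal A S" using T ideal_image by simp
    then have "S = {alg_zero A} \<or> S = alg_carrier A" using A by (auto simp: simple_algebra_def)
    then show ?thesis unfolding S(2) by (metis zero carrier_image image_empty image_insert)
  qed
  have "h x \<in> alg_carrier B" "h y \<in> alg_carrier B" using xy carrier_image by auto
  with 1 2 show ?thesis by (auto simp: simple_algebra_def)
qed

lemma span_image:
  assumes X: "X \<subseteq> alg_carrier A"
  shows "alg_span B (h ` X) = h ` alg_span A X"
proof
  have sub: "alg_subspace A (alg_span A X)" by (rule alg_subspace_span[OF closed X])
  then have "alg_span A X \<subseteq> alg_carrier A" by (auto simp: alg_subspace_def)
  then show "alg_span B (h ` X) \<subseteq> h ` alg_span A X"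
    using sub subspace_image by (intro hull_minimal image_mono hull_subset) auto
  have "h ` alg_span A X \<subseteq> T" if T: "alg_subspace B T" "h ` X \<subseteq> T" for T
  proof -
    have "T \<subseteq> alg_carrier B" using T(1) by (simp add: alg_subspace_def)
    then obtain S where S: "S \<subseteq> alg_carrier A" "T = h ` S" using subset_image by blast
    then have "alg_subspace A S" using T subspace_image by simp
    moreover have "X \<subseteq> S" using T(2) X S image_mem by blast
    ultimately have "alg_span A X \<subseteq> S" by (intro hull_minimal)
    then show ?thesis using S by auto
  qed
  then show "h ` alg_span A X \<subseteq> alg_span B (h ` X)" unfolding hull_def[of _ "h ` X"] by blast
qed

lemma simple_lie_image: "simple_lie_algebra A \<longleftrightarrow> simple_lie_algebra B"
proof -
  let ?X = "{alg_mult A x y | x y. x \<in> alg_carrier A \<and> y \<in> alg_carrier A}"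
  let ?Y = "{alg_mult B x y | x y. x \<in> alg_carrier B \<and> y \<in> alg_carrier B}"
  have X: "?X \<subseteq> alg_carrier A" using closed_A by auto
  have "h ` ?X = ?Y"
    unfolding carrier_image[symmetric] using mult by (auto simp: image_iff) metis+
  then have "alg_span B ?Y = h ` alg_span A ?X" using span_image[OF X] by simp
  moreover have "alg_span A ?X \<subseteq> alg_carrier A"
    using alg_subspace_span[OF closed X] by (auto simp: alg_subspace_def)
  ultimately have 1: "alg_span B ?Y = {alg_zero B} \<longleftrightarrow> alg_span A ?X = {alg_zero A}"
    using image_eq[of "alg_span A ?X" "{alg_zero A}"] closed_A by (simp add: zero)
  have ideal: "lie_ideal B (h ` S) \<longleftrightarrow> lie_ideal A S" if S: "S \<subseteq> alg_carrier A" for S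
  proof -
    have [simp]: "x \<in> alg_carrier A" if "x \<in> S" for x using S that by auto
    show ?thesis
      using S unfolding lie_ideal_def subspace_image[OF S]
      by (auto simp: mult[symmetric] carrier_image[symmetric] image_mem closed_A)
  qed
  have eq: "(h ` S = {alg_zero B} \<or> h ` S = alg_carrier B) \<longleftrightarrow> (S = {alg_zero A} \<or> S = alg_carrier A)"
    if "S \<subseteq> alg_carrier A" for S
    using image_eq[OF that, of "{alg_zero A}"] image_eq[OF that, of "alg_carrier A"] closed_A
    by (simp add: zero carrier_image)
  have sub: "S \<subseteq> alg_carrier A" if "lie_ideal A S" for S
    using that by (auto simp: lie_ideal_def alg_subspace_def)
  have subB: "T \<subseteq> alg_carrier B" if "lie_ideal B T" for T
    using that by (auto simp: lie_ideal_def alg_subspace_def)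
  have "(\<forall>T. lie_ideal B T \<longrightarrow> T = {alg_zero B} \<or> T = alg_carrier B) \<longleftrightarrow>
        (\<forall>S. lie_ideal A S \<longrightarrow> S = {alg_zero A} \<or> S = alg_carrier A)" (is "?L \<longleftrightarrow> ?R")
  proof
    assume L: ?L
    show ?R
    proof (intro allI impI)
      fix S assume S: "lie_ideal A S"
      then have "lie_ideal B (h ` S)" using ideal sub by simp
      then have "h ` S = {alg_zero B} \<or> h ` S = alg_carrier B" using L by blast
      then show "S = {alg_zero A} \<or> S = alg_carrier A" using eq[OF sub[OF S]] by simp
    qed
  next
    assume R: ?R
    show ?L
    proof (intro allI impI)
      fix T assume T: "lie_ideal B T"
      then obtain S where S: "S \<subseteq> alg_carrier A" "T = h ` S" using subset_image subB by blast
      then have "lie_ideal A S" using T ideal by simp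
      then show "T = {alg_zero B} \<or> T = alg_carrier B" using R eq[OF S(1)] S(2) by blast
    qed
  qed
  then show ?thesis unfolding simple_lie_algebra_def 1 by simp
qed

lemma isomorphic_trans:
  assumes "isomorphic_algebras B C"
  shows "isomorphic_algebras A C"
proof -
  obtain g where g: "g \<in> alg_iso B C" using assms by (auto simp: isomorphic_algebras_def)
  have "h x \<in> alg_carrier B" if "x \<in> alg_carrier A" for x using that carrier_image by auto
  then have "g \<circ> h \<in> alg_iso A C"
    using g iso unfolding alg_iso_def by (auto intro: bij_betw_trans)
  then show ?thesis by (auto simp: isomorphic_algebras_def)
qed

end

lemma commutator_lie_algebra_iso:
  fixes A :: "('k::field, 'a) k_algebra" and B :: "('k, 'b) k_algebra"
  assumes "algebra_iso A B h"
  shows "algebra_iso (commutator_lie_algebra A) (commutator_lie_algebra B) h"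
proof -
  interpret algebra_iso A B h by fact
  let ?X = "{commutator A x y | x y. x \<in> alg_carrier A \<and> y \<in> alg_carrier A}"
  let ?Y = "{commutator B x y | x y. x \<in> alg_carrier B \<and> y \<in> alg_carrier B}"
  have comm: "commutator A x y \<in> alg_carrier A" "h (commutator A x y) = commutator B (h x) (h y)"
    if "x \<in> alg_carrier A" "y \<in> alg_carrier A" for x y
    using that by (auto simp: commutator_def closed_A add smult mult)
  have X: "?X \<subseteq> alg_carrier A" using comm by auto
  have "h ` ?X = ?Y"
    unfolding carrier_image[symmetric]
  proof (intro subset_antisym subsetI)
    fix z assume "z \<in> h ` ?X"
    then obtain x y where "x \<in> alg_carrier A" "y \<in> alg_carrier A" "z = h (commutator A x y)" by blast
    then show "z \<in> {commutator B x y | x y. x \<in> h ` alg_carrier A \<and> y \<in> h ` alg_carrier A}"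
      using comm(2) by blast
  next
    fix z assume "z \<in> {commutator B x y | x y. x \<in> h ` alg_carrier A \<and> y \<in> h ` alg_carrier A}"
    then obtain x y where "x \<in> alg_carrier A" "y \<in> alg_carrier A" "z = commutator B (h x) (h y)" by blast
    then have "z = h (commutator A x y)" "commutator A x y \<in> ?X" using comm(2) by auto
    then show "z \<in> h ` ?X" by blast
  qed
  then have YX: "alg_span B ?Y = h ` alg_span A ?X" using span_image[OF X] by simp
  define S where "S = alg_span A ?X"
  have sub: "alg_subspace A S" unfolding S_def by (rule alg_subspace_span[OF closed X])
  have in_A: "x \<in> alg_carrier A" if "x \<in> S" for x
    using sub that by (auto simp: alg_subspace_def)
  have in_S: "commutator A x y \<in> S" if "x \<in> alg_carrier A" "y \<in> alg_carrier A" for x y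
    unfolding S_def by (rule hull_inc) (use that in auto)
  have fields [simp]: "alg_carrier (commutator_lie_algebra A) = S"
    "alg_carrier (commutator_lie_algebra B) = h ` S"
    "alg_zero (commutator_lie_algebra A) = alg_zero A" "alg_zero (commutator_lie_algebra B) = alg_zero B"
    "alg_add (commutator_lie_algebra A) = alg_add A" "alg_add (commutator_lie_algebra B) = alg_add B"
    "alg_smult (commutator_lie_algebra A) = alg_smult A"
    "alg_smult (commutator_lie_algebra B) = alg_smult B"
    "alg_mult (commutator_lie_algebra A) = commutator A"
    "alg_mult (commutator_lie_algebra B) = commutator B"
    by (simp_all add: commutator_lie_algebra_def S_def YX)
  show ?thesis
  proof
    have "inj_on h S" by (rule inj_on_subset[OF inj subsetI]) (rule in_A)
    then show "h \<in> alg_iso (commutator_lie_algebra A) (commutator_lie_algebra B)"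
      by (simp add: alg_iso_def bij_betw_def in_A add smult comm(2))
    show "closed_algebra (commutator_lie_algebra A)"
      using sub in_S in_A by (simp add: closed_algebra_def alg_subspace_def)
    show "h (alg_zero (commutator_lie_algebra A)) = alg_zero (commutator_lie_algebra B)"
      by (simp add: zero)
  qed
qed

text \<open>The link between the records and type classes: a subset of a ring type, with the operations of
  the type. Free algebras, and the images of algebras under representations, have this form.\<close>

definition set_algebra :: "'a::ring set \<Rightarrow> ('k \<Rightarrow> 'a \<Rightarrow> 'a) \<Rightarrow> ('k, 'a) k_algebra" where
  "set_algebra R s =
     \<lparr> alg_carrier = R, alg_zero = 0, alg_add = (+), alg_smult = s, alg_mult = (*) \<rparr>"

lemma set_algebra_simps [simp]:
  "alg_carrier (set_algebra R s) = R" "alg_zero (set_algebra R s) = 0"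
  "alg_add (set_algebra R s) = (+)" "alg_smult (set_algebra R s) = s"
  "alg_mult (set_algebra R s) = (*)"
  by (simp_all add: set_algebra_def)

lemma UN_constant_on: "a \<in> X \<Longrightarrow> (\<And>x. x \<in> X \<Longrightarrow> F x = K) \<Longrightarrow> (\<Union>x\<in>X. F x) = K"
  by auto

text \<open>The first isomorphism theorem. The operations on cosets are unions over all representatives, and
  each of these unions is over a constant family.\<close>

lemma quotient_iso_image:
  fixes A :: "'a::ring set" and s :: "'k::field \<Rightarrow> 'a \<Rightarrow> 'a" and \<kappa> :: "'a \<Rightarrow> 'b::ring"
  assumes A: "closed_algebra (set_algebra A s)" and N: "alg_ideal (set_algebra A s) N"
    and s_neg: "\<And>x. s (- 1) x = - x"
    and add: "\<And>a b. a \<in> A \<Longrightarrow> b \<in> A \<Longrightarrow> \<kappa> (a + b) = \<kappa> a + \<kappa> b"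
    and smult: "\<And>c a. a \<in> A \<Longrightarrow> \<kappa> (s c a) = s' c (\<kappa> a)"
    and mult: "\<And>a b. a \<in> A \<Longrightarrow> b \<in> A \<Longrightarrow> \<kappa> (a * b) = \<kappa> a * \<kappa> b"
    and ker: "\<And>a. a \<in> A \<Longrightarrow> \<kappa> a = 0 \<longleftrightarrow> a \<in> N"
    and s_add: "\<And>c a b. s c (a + b) = s c a + s c b"
  shows "\<exists>h. algebra_iso (quotient_algebra (set_algebra A s) N) (set_algebra (\<kappa> ` A) s') h"
proof -
  let ?Q = "quotient_algebra (set_algebra A s) N"
  have A': "0 \<in> A" "\<And>x y. x \<in> A \<Longrightarrow> y \<in> A \<Longrightarrow> x + y \<in> A" "\<And>c x. x \<in> A \<Longrightarrow> s c x \<in> A"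
    "\<And>x y. x \<in> A \<Longrightarrow> y \<in> A \<Longrightarrow> x * y \<in> A"
    using A by (auto simp: closed_algebra_def)
  have N': "N \<subseteq> A" "0 \<in> N" "\<And>x y. x \<in> N \<Longrightarrow> y \<in> N \<Longrightarrow> x + y \<in> N" "\<And>c x. x \<in> N \<Longrightarrow> s c x \<in> N"
    "\<And>a x. a \<in> A \<Longrightarrow> x \<in> N \<Longrightarrow> a * x \<in> N" "\<And>a x. a \<in> A \<Longrightarrow> x \<in> N \<Longrightarrow> x * a \<in> N"
    using N by (auto simp: alg_ideal_def alg_subspace_def)
  have Nneg: "- x \<in> N" if "x \<in> N" for x using N'(4)[OF that, of "- 1"] s_neg by simp
  have Aneg: "- x \<in> A" if "x \<in> A" for x using A'(3)[OF that, of "- 1"] s_neg by simp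
  define C where "C a = (+) a ` N" for a
  have C: "alg_coset (set_algebra A s) N = C" by (auto simp: C_def alg_coset_def)
  have mem: "x \<in> C a \<longleftrightarrow> (\<exists>n\<in>N. x = a + n)" for x a by (auto simp: C_def)
  have self: "a \<in> C a" for a using N' by (auto simp: mem intro: bexI[of _ 0])
  have shift: "C (a + n) = C a" if "n \<in> N" for a n
  proof -
    have "\<exists>k\<in>N. a + n + m = a + k" "\<exists>k\<in>N. a + m = a + n + k" if "m \<in> N" for m
      using that N'(3)[OF \<open>n \<in> N\<close> that] N'(3)[OF Nneg[OF \<open>n \<in> N\<close>] that]
      by (auto simp: add.assoc intro: bexI[of _ "n + m"] bexI[of _ "- n + m"])
    then show ?thesis by (auto simp: mem set_eq_iff)
  qed
  have car: "alg_carrier ?Q = C ` A" and z: "alg_zero ?Q = C 0"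
    by (simp_all add: quotient_algebra_def C)
  have qadd: "alg_add ?Q (C a) (C b) = C (a + b)" for a b
  proof -
    have "C (x + y) = C (a + b)" if x: "x \<in> C a" and y: "y \<in> C b" for x y
    proof -
      obtain m n where "x = a + m" "y = b + n" "m \<in> N" "n \<in> N" using x y mem by auto
      moreover have "(a + m) + (b + n) = (a + b) + (m + n)" by (simp add: ac_simps)
      ultimately show ?thesis using shift N'(3) by metis
    qed
    then have "(\<Union>x\<in>C a. \<Union>y\<in>C b. C (x + y)) = C (a + b)"
      by (intro UN_constant_on[OF self[of a]] UN_constant_on[OF self[of b]])
    then show ?thesis by (simp add: quotient_algebra_def C)
  qed
  have qsmult: "alg_smult ?Q c (C a) = C (s c a)" for c a
  proof -
    have "C (s c x) = C (s c a)" if x: "x \<in> C a" for x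
      using x shift N'(4) by (auto simp: mem s_add)
    then have "(\<Union>x\<in>C a. C (s c x)) = C (s c a)"
      by (intro UN_constant_on[OF self[of a]])
    then show ?thesis by (simp add: quotient_algebra_def C)
  qed
  have qmult: "alg_mult ?Q (C a) (C b) = C (a * b)" if ab: "a \<in> A" "b \<in> A" for a b
  proof -
    have "C (x * y) = C (a * b)" if x: "x \<in> C a" and y: "y \<in> C b" for x y
    proof -
      obtain m n where mn: "x = a + m" "y = b + n" "m \<in> N" "n \<in> N" using x y mem by auto
      have "a * n + m * b + m * n \<in> N"
        by (intro N'(3) N'(5,6) mn ab subsetD[OF N'(1)])
      moreover have "x * y = a * b + (a * n + m * b + m * n)"
        by (simp add: mn distrib_left distrib_right ac_simps)
      ultimately show ?thesis using shift by metis
    qed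
    then have "(\<Union>x\<in>C a. \<Union>y\<in>C b. C (x * y)) = C (a * b)"
      by (intro UN_constant_on[OF self[of a]] UN_constant_on[OF self[of b]])
    then show ?thesis by (simp add: quotient_algebra_def C)
  qed
  define h where "h X = \<kappa> (SOME x. x \<in> X)" for X
  have hC: "h (C a) = \<kappa> a" if a: "a \<in> A" for a
  proof -
    have "(SOME x. x \<in> C a) \<in> C a" using self by (rule someI)
    then obtain n where n: "(SOME x. x \<in> C a) = a + n" "n \<in> N" by (auto simp: mem)
    then have "\<kappa> n = 0" "n \<in> A" using ker N' by auto
    then show ?thesis using n add a by (simp add: h_def)
  qed
  have k0: "\<kappa> 0 = 0" using ker A' N' by simp
  have inj: "inj_on h (C ` A)"
  proof (rule inj_onI)
    fix X Y assume "X \<in> C ` A" "Y \<in> C ` A" "h X = h Y"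
    then obtain a b where ab: "a \<in> A" "b \<in> A" "X = C a" "Y = C b" "\<kappa> a = \<kappa> b" using hC by auto
    show "X = Y"
    proof -
      have "a - b \<in> A" using A'(2)[OF ab(1) Aneg[OF ab(2)]] by simp
      then have "\<kappa> a = \<kappa> (a - b) + \<kappa> b" using add[of "a - b" b] ab by simp
      then have "a - b \<in> N" using ker \<open>a - b \<in> A\<close> ab by simp
      then show ?thesis using shift[of "a - b" b] ab by simp
    qed
  qed
  have "algebra_iso ?Q (set_algebra (\<kappa> ` A) s') h"
  proof
    show "h \<in> alg_iso ?Q (set_algebra (\<kappa> ` A) s')"
      using inj A' by (auto simp: alg_iso_def car bij_betw_def image_image hC qadd qsmult qmult
          add smult mult)
    show "closed_algebra ?Q"
      using A' by (auto simp: closed_algebra_def car z qadd qsmult qmult)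
    show "h (alg_zero ?Q) = alg_zero (set_algebra (\<kappa> ` A) s')" using A' by (simp add: z hC k0)
  qed
  then show ?thesis by blast
qed

section \<open>A simple algebra and its Lie algebra of commutators\<close>

definition poly_scale :: "'k::field \<Rightarrow> ('b \<Rightarrow>\<^sub>0 'k) \<Rightarrow> ('b \<Rightarrow>\<^sub>0 'k)" where
  "poly_scale c = Poly_Mapping.map ((*) c)"

lemma lookup_poly_scale [simp]:
  "Poly_Mapping.lookup (poly_scale c p) k = c * Poly_Mapping.lookup p k"
  by (simp add: poly_scale_def Poly_Mapping.map.rep_eq when_def)

global_interpretation poly: vector_space poly_scale
  by unfold_locales (auto intro!: poly_mapping_eqI simp: lookup_add algebra_simps)

global_interpretation poly: vector_space_pair poly_scale poly_scale ..

lemma poly_mapping_single_induct [case_names single add]: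
  fixes p :: "'b \<Rightarrow>\<^sub>0 'k::ab_group_add"
  assumes "\<And>w c. P (Poly_Mapping.single w c)" "\<And>p q. P p \<Longrightarrow> P q \<Longrightarrow> P (p + q)"
  shows "P p"
proof (induction p rule: update_induct)
  case const
  then show ?case using assms(1)[of undefined 0] by simp
next
  case (update p a b)
  have "Poly_Mapping.update a b p = p + Poly_Mapping.single a b"
    using update by (intro poly_mapping_eqI)
      (auto simp: lookup_update lookup_add lookup_single when_def in_keys_iff)
  then show ?case using assms update by simp
qed

lemma poly_scale_mult:
  fixes p q :: "'b::monoid_add \<Rightarrow>\<^sub>0 'k::field"
  shows "poly_scale c (p * q) = poly_scale c p * q" "poly_scale c (p * q) = p * poly_scale c q"
proof -
  have comm: "Poly_Mapping.single 0 c * p = p * Poly_Mapping.single 0 c"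
    by (induction p rule: poly_mapping_single_induct)
      (simp_all add: mult_single mult.commute distrib_left distrib_right)
  show "poly_scale c (p * q) = poly_scale c p * q"
    by (simp add: poly_scale_def mult_map_scale_conv_mult mult.assoc)
  then show "poly_scale c (p * q) = p * poly_scale c q"
    by (simp add: poly_scale_def mult_map_scale_conv_mult mult.assoc[symmetric] comm)
qed

text \<open>The endomorphisms are required to be linear, and not merely additive, so that scalars can be moved
  past both factors of a product.\<close>

typedef (overloaded) ('b, 'k) linear_endo =
  "{f :: ('b \<Rightarrow>\<^sub>0 'k::field) \<Rightarrow> ('b \<Rightarrow>\<^sub>0 'k). Vector_Spaces.linear poly_scale poly_scale f}"
  morphisms endo_apply Endo
  by (rule exI[of _ "\<lambda>x. 0"]) (simp add: Vector_Spaces.linear_iff poly.vector_space_axioms)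

setup_lifting type_definition_linear_endo

instantiation linear_endo :: (type, field) ring
begin

lift_definition zero_linear_endo :: "('a, 'b) linear_endo" is "\<lambda>x. 0"
  by (simp add: Vector_Spaces.linear_iff poly.vector_space_axioms)

lift_definition plus_linear_endo :: "('a, 'b) linear_endo \<Rightarrow> ('a, 'b) linear_endo \<Rightarrow> ('a, 'b) linear_endo"
  is "\<lambda>f g x. f x + g x" by (rule poly.linear_compose_add)

lift_definition uminus_linear_endo :: "('a, 'b) linear_endo \<Rightarrow> ('a, 'b) linear_endo"
  is "\<lambda>f x. - f x" by (rule poly.linear_compose_neg)

lift_definition minus_linear_endo :: "('a, 'b) linear_endo \<Rightarrow> ('a, 'b) linear_endo \<Rightarrow> ('a, 'b) linear_endo"
  is "\<lambda>f g x. f x - g x" by (rule poly.linear_compose_sub)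

lift_definition times_linear_endo :: "('a, 'b) linear_endo \<Rightarrow> ('a, 'b) linear_endo \<Rightarrow> ('a, 'b) linear_endo"
  is "\<lambda>f g x. f (g x)" by (simp add: Vector_Spaces.linear_iff)

instance
proof
  fix a b c :: "('a, 'b) linear_endo"
  show "(a + b) * c = a * c + b * c" by transfer simp
  show "a * (b + c) = a * b + a * c" by transfer (auto simp: poly.linear_add)
qed (transfer; auto simp: algebra_simps)+

end

lift_definition endo_scale :: "'k::field \<Rightarrow> ('b, 'k) linear_endo \<Rightarrow> ('b, 'k) linear_endo"
  is "\<lambda>c f x. poly_scale c (f x)" by (rule poly.linear_compose_scale_right)

lemma endo_eqI: "(\<And>x. endo_apply f x = endo_apply g x) \<Longrightarrow> f = g"
  by transfer auto

lemma endo_scale_vector_space: "vector_space endo_scale"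
  by unfold_locales (transfer; auto simp: algebra_simps poly.scale_right_distrib poly.scale_left_distrib)+

lemma endo_scale_mult: "endo_scale c (f * g) = endo_scale c f * g" "endo_scale c (f * g) = f * endo_scale c g"
  by (transfer; simp add: poly.linear_scale)+

text \<open>Choose a linear projection \<open>\<pi>\<close> with values in \<open>A\<close> whose restriction to \<open>A\<close> has kernel \<open>N\<close>. It
  identifies \<open>A / N\<close> with a complement of \<open>N\<close> in \<open>A\<close>, and left multiplication by \<open>a\<close> on \<open>A / N\<close> becomes
  \<open>\<pi> a \<pi>\<close>. Since \<open>i\<close> is a right unit of the quotient, evaluating at \<open>i\<close> shows that this representation
  is faithful.\<close>

lemma quotient_representation:
  fixes A :: "('b::monoid_add \<Rightarrow>\<^sub>0 'k::field) set"
  assumes A: "closed_algebra (set_algebra A poly_scale)" and N: "alg_ideal (set_algebra A poly_scale) N"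
    and i: "i \<in> A" "\<And>a. a \<in> A \<Longrightarrow> a * i - a \<in> N"
  obtains \<kappa> :: "('b \<Rightarrow>\<^sub>0 'k) \<Rightarrow> ('b, 'k) linear_endo"
  where "\<And>a b. \<kappa> (a + b) = \<kappa> a + \<kappa> b" "\<And>c a. \<kappa> (poly_scale c a) = endo_scale c (\<kappa> a)"
    "\<And>a b. a \<in> A \<Longrightarrow> b \<in> A \<Longrightarrow> \<kappa> (a * b) = \<kappa> a * \<kappa> b"
    "\<And>a. a \<in> A \<Longrightarrow> \<kappa> a = 0 \<longleftrightarrow> a \<in> N"
proof -
  have A': "0 \<in> A" "\<And>x y. x \<in> A \<Longrightarrow> y \<in> A \<Longrightarrow> x + y \<in> A" "\<And>c x. x \<in> A \<Longrightarrow> poly_scale c x \<in> A"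
    "\<And>x y. x \<in> A \<Longrightarrow> y \<in> A \<Longrightarrow> x * y \<in> A"
    using A by (auto simp: closed_algebra_def)
  have N': "N \<subseteq> A" "0 \<in> N" "\<And>x y. x \<in> N \<Longrightarrow> y \<in> N \<Longrightarrow> x + y \<in> N"
    "\<And>c x. x \<in> N \<Longrightarrow> poly_scale c x \<in> N"
    "\<And>a x. a \<in> A \<Longrightarrow> x \<in> N \<Longrightarrow> a * x \<in> N" "\<And>a x. a \<in> A \<Longrightarrow> x \<in> N \<Longrightarrow> x * a \<in> N"
    using N by (auto simp: alg_ideal_def alg_subspace_def)
  have sA: "poly.subspace A" and sN: "poly.subspace N"
    using A' N' by (auto intro: poly.subspaceI)
  obtain BN where BN: "BN \<subseteq> N" "poly.independent BN" "N \<subseteq> poly.span BN"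
    using poly.maximal_independent_subset[of N] by blast
  obtain BA where BA: "BN \<subseteq> BA" "BA \<subseteq> A" "poly.independent BA" "A \<subseteq> poly.span BA"
    using poly.maximal_independent_subset_extend[of BN A] BN N'(1) by blast
  obtain \<pi> where lin: "Vector_Spaces.linear poly_scale poly_scale \<pi>"
    and \<pi>B: "\<And>x. x \<in> BA \<Longrightarrow> \<pi> x = (if x \<in> BN then 0 else x)"
    and rng: "range \<pi> = poly.span ((\<lambda>x. if x \<in> BN then 0 else x) ` BA)"
    using poly.linear_independent_extend_subspace[OF BA(3), of "\<lambda>x. if x \<in> BN then 0 else x"] by auto
  interpret \<pi>: Vector_Spaces.linear poly_scale poly_scale \<pi> by (rule lin)
  have \<pi>A: "\<pi> x \<in> A" for x
  proof -
    have "poly.span ((\<lambda>x. if x \<in> BN then 0 else x) ` BA) \<subseteq> A"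
      by (rule poly.span_minimal[OF _ sA]) (use BA A' in auto)
    then show ?thesis using rng by blast
  qed
  have \<pi>N: "\<pi> x = 0" if "x \<in> N" for x
  proof (rule poly.linear_eq_0_on_span[OF lin, of BN])
    show "\<pi> b = 0" if "b \<in> BN" for b using \<pi>B BA that by auto
    show "x \<in> poly.span BN" using that BN by auto
  qed
  have \<pi>diff: "x - \<pi> x \<in> N" if "x \<in> A" for x
  proof -
    have "x \<in> poly.span BA" using that BA by auto
    then show ?thesis
    proof (induction rule: poly.span_induct)
      case base
      show ?case
      proof (rule poly.subspaceI)
        fix x y assume "x \<in> {x. x - \<pi> x \<in> N}" "y \<in> {x. x - \<pi> x \<in> N}"
        then have "(x - \<pi> x) + (y - \<pi> y) \<in> N" using N' by simp
        then show "x + y \<in> {x. x - \<pi> x \<in> N}" by (simp add: \<pi>.add algebra_simps)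
      next
        fix c x assume "x \<in> {x. x - \<pi> x \<in> N}"
        then have "poly_scale c (x - \<pi> x) \<in> N" using N' by simp
        then show "poly_scale c x \<in> {x. x - \<pi> x \<in> N}"
          by (simp add: \<pi>.scale poly.scale_right_diff_distrib)
      qed (use N' in \<open>simp add: \<pi>.zero\<close>)
    next
      case (step x)
      then show ?case using \<pi>B BN N' by auto
    qed
  qed
  have \<pi>mult: "\<pi> (a * \<pi> x) = \<pi> (a * x)" if "a \<in> A" "x \<in> A" for a x
  proof -
    have "a * (x - \<pi> x) \<in> N" using that \<pi>diff N' by blast
    then have "\<pi> (a * x - a * \<pi> x) = 0" using \<pi>N by (simp add: right_diff_distrib)
    then show ?thesis by (simp add: \<pi>.diff)
  qed
  have linf: "Vector_Spaces.linear poly_scale poly_scale (\<lambda>x. \<pi> (a * \<pi> x))" for a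
    by (simp add: Vector_Spaces.linear_iff poly.vector_space_axioms \<pi>.add \<pi>.scale distrib_left poly_scale_mult(2)[symmetric])
  define \<kappa> where "\<kappa> a = Endo (\<lambda>x. \<pi> (a * \<pi> x))" for a
  have ap: "endo_apply (\<kappa> a) = (\<lambda>x. \<pi> (a * \<pi> x))" for a
    using linf by (simp add: \<kappa>_def Endo_inverse)
  show ?thesis
  proof
    show "\<kappa> (a + b) = \<kappa> a + \<kappa> b" for a b
      by (rule endo_eqI) (simp add: ap plus_linear_endo.rep_eq distrib_right \<pi>.add)
    show "\<kappa> (poly_scale c a) = endo_scale c (\<kappa> a)" for c a
      by (rule endo_eqI) (simp add: ap endo_scale.rep_eq poly_scale_mult(1)[symmetric] \<pi>.scale)
    show "\<kappa> (a * b) = \<kappa> a * \<kappa> b" if "a \<in> A" "b \<in> A" for a b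
    proof (rule endo_eqI)
      fix x
      have "\<pi> (a * \<pi> (\<pi> (b * \<pi> x))) = \<pi> (a * (b * \<pi> x))"
        using that \<pi>A A' by (simp add: \<pi>mult)
      then show "endo_apply (\<kappa> (a * b)) x = endo_apply (\<kappa> a * \<kappa> b) x"
        by (simp add: ap times_linear_endo.rep_eq mult.assoc)
    qed
    show "\<kappa> a = 0 \<longleftrightarrow> a \<in> N" if a: "a \<in> A" for a
    proof
      assume "\<kappa> a = 0"
      then have "endo_apply (\<kappa> a) i = endo_apply 0 i" by simp
      then have "\<pi> (a * i) = 0" using a i \<pi>mult by (simp add: ap zero_linear_endo.rep_eq)
      then have "a * i \<in> N" using \<pi>diff[of "a * i"] a i A' by simp
      moreover have "- (a * i - a) \<in> N" using N'(4)[OF i(2)[OF a], of "- 1"] by simp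
      ultimately have "a * i + - (a * i - a) \<in> N" using N' by blast
      then show "a \<in> N" by simp
    next
      assume "a \<in> N"
      have "\<pi> (a * \<pi> x) = 0" for x
        by (rule \<pi>N) (rule N'(6)[OF \<pi>A \<open>a \<in> N\<close>])
      then show "\<kappa> a = 0" by (intro endo_eqI) (simp add: ap zero_linear_endo.rep_eq)
    qed
  qed
qed

locale unital_subalgebra = unital_subring R i + vector_space s
  for R :: "'a::ring set" and i :: 'a and s :: "'k::field \<Rightarrow> 'a \<Rightarrow> 'a" +
  assumes scale_closed: "x \<in> R \<Longrightarrow> s c x \<in> R"
    and scale_mult_left: "s c (x * y) = s c x * y"
    and scale_mult_right: "s c (x * y) = x * s c y"
begin

lemma closed: "closed_algebra (set_algebra R s)"
  by (auto simp: closed_algebra_def scale_closed)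

lemma two_sided_ideal_alg_ideal: "two_sided_ideal I \<longleftrightarrow> alg_ideal (set_algebra R s) I"
proof
  assume I: "two_sided_ideal I"
  have "s c x \<in> I" if x: "x \<in> I" for c x
  proof -
    have "x \<in> R" using I x by (auto simp: two_sided_ideal_def)
    then have "s c x = s c i * x" by (simp add: scale_mult_left[symmetric])
    then show ?thesis using I x scale_closed by (auto simp: two_sided_ideal_def)
  qed
  with I show "alg_ideal (set_algebra R s) I"
    by (auto simp: two_sided_ideal_def alg_ideal_def alg_subspace_def additive_subgroup_def)
next
  assume I: "alg_ideal (set_algebra R s) I"
  then have "s c x \<in> I" if "x \<in> I" for c x
    using that by (auto simp: alg_ideal_def alg_subspace_def)
  from this[of _ "- 1"] have "- x \<in> I" if "x \<in> I" for x using that by simp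
  with I show "two_sided_ideal I"
    by (auto simp: two_sided_ideal_def alg_ideal_def alg_subspace_def additive_subgroup_def)
qed

lemma subspace_additive_subgroup:
  "alg_subspace (set_algebra R s) S \<longleftrightarrow> S \<subseteq> R \<and> additive_subgroup S \<and> (\<forall>c. \<forall>x\<in>S. s c x \<in> S)"
proof -
  have "- x \<in> S" if "\<forall>c. \<forall>x\<in>S. s c x \<in> S" "x \<in> S" for x
    using that(1)[rule_format, OF that(2), of "- 1"] by simp
  then show ?thesis by (auto simp: alg_subspace_def additive_subgroup_def)
qed

lemma derived_scale: "x \<in> derived \<Longrightarrow> s c x \<in> derived"
proof (induction rule: derived_induct)
  case (base x y)
  have "s c (bracket x y) = bracket (s c x) y"
    by (simp add: bracket_def scale_right_diff_distrib scale_mult_left[symmetric] scale_mult_right[symmetric])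
  then show ?case using base scale_closed by simp
qed (auto simp: scale_right_distrib intro: additive_subgroup_0 additive_subgroup_add
      additive_subgroup_minus derived_subgroup)

lemma span_brackets: "alg_span (set_algebra R s) {bracket x y | x y. x \<in> R \<and> y \<in> R} = derived"
proof
  have "alg_subspace (set_algebra R s) derived"
    by (auto simp: subspace_additive_subgroup derived_subgroup derived_scale)
  then show "alg_span (set_algebra R s) {bracket x y | x y. x \<in> R \<and> y \<in> R} \<subseteq> derived"
    by (intro hull_minimal) auto
  show "derived \<subseteq> alg_span (set_algebra R s) {bracket x y | x y. x \<in> R \<and> y \<in> R}"
    unfolding hull_def[of "alg_subspace (set_algebra R s)"] derived_def
    by (auto simp: subspace_additive_subgroup intro: hull_minimal[THEN subsetD])
qed

lemma lie_algebra_simps [simp]: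
  "alg_carrier (commutator_lie_algebra (set_algebra R s)) = derived"
  "alg_zero (commutator_lie_algebra (set_algebra R s)) = 0"
  "alg_add (commutator_lie_algebra (set_algebra R s)) = (+)"
  "alg_smult (commutator_lie_algebra (set_algebra R s)) = s"
  "alg_mult (commutator_lie_algebra (set_algebra R s)) = bracket"
proof -
  have "commutator (set_algebra R s) = bracket"
    by (intro ext) (simp add: commutator_def bracket_def)
  then show "alg_carrier (commutator_lie_algebra (set_algebra R s)) = derived"
    "alg_mult (commutator_lie_algebra (set_algebra R s)) = bracket"
    using span_brackets by (simp_all add: commutator_lie_algebra_def)
qed (simp_all add: commutator_lie_algebra_def)

lemma lie_ideal_iff:
  "lie_ideal (commutator_lie_algebra (set_algebra R s)) U \<longleftrightarrow>
   derived_stable U \<and> U \<subseteq> derived \<and> (\<forall>c. \<forall>x\<in>U. s c x \<in> U)" (is "?L \<longleftrightarrow> ?R")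
proof
  assume L: ?L
  have neg: "- x \<in> U" if "x \<in> U" for x
  proof -
    have "\<forall>c. \<forall>x\<in>U. s c x \<in> U" using L by (simp add: lie_ideal_def alg_subspace_def)
    then have "s (- 1) x \<in> U" using that by blast
    then show ?thesis by simp
  qed
  have br: "bracket x t \<in> U" if "x \<in> U" "t \<in> derived" for x t
    using L neg that bracket_anticomm[of x t] by (auto simp: lie_ideal_def)
  show ?R
    using L neg br derived_subset
    by (auto simp: lie_ideal_def alg_subspace_def derived_stable_def additive_subgroup_def)
next
  assume R: ?R
  have br: "bracket t x \<in> U" if "x \<in> U" "t \<in> derived" for x t
    using R that bracket_anticomm[of t x] by (auto simp: derived_stable_def additive_subgroup_def)
  then show ?L
    using R by (auto simp: lie_ideal_def alg_subspace_def derived_stable_def additive_subgroup_def)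
qed

text \<open>In a unital algebra every additive ideal is a subspace, so simplicity as an algebra is simplicity
  as a ring, and the results on additive Lie ideals apply. If the unit is a sum of commutators,
  its multiples form a Lie ideal; it cannot be all of \<open>[R, R]\<close>, which would then be abelian.\<close>

theorem simple_lie_iff:
  assumes simple: "simple_algebra (set_algebra R s)"
    and e: "e \<in> R" "e * e = e" "e \<noteq> 0" "e \<noteq> i"
  shows "simple_lie_algebra (commutator_lie_algebra (set_algebra R s)) \<longleftrightarrow> i \<notin> derived"
proof -
  have i0: "i \<noteq> 0" using e(3) unit_left[OF e(1)] by (metis mult_zero_left)
  interpret simple_unital_subring R i
    using simple by unfold_locales (auto simp: two_sided_ideal_alg_ideal simple_algebra_def)
  let ?L = "commutator_lie_algebra (set_algebra R s)"
  let ?B = "{bracket x y | x y. x \<in> derived \<and> y \<in> derived}"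
  show ?thesis
  proof
    assume L: "simple_lie_algebra ?L"
    show "i \<notin> derived"
    proof
      assume iT: "i \<in> derived"
      let ?I = "range (\<lambda>c. s c i)"
      have comm: "bracket (s c i) t = 0" if "t \<in> R" for c t
        using that by (simp add: bracket_def scale_mult_left[symmetric] scale_mult_right[symmetric])
      have zero: "0 \<in> ?I" using scale_zero_left[of i] by (metis rangeI)
      have "lie_ideal ?L ?I"
        unfolding lie_ideal_iff derived_stable_def additive_subgroup_def
        using iT zero
        by (auto simp: comm derived_scale scale_left_distrib[symmetric] scale_closed
            scale_minus_left[symmetric] simp del: scale_minus_left)
      then have "?I = {0} \<or> ?I = derived" using L by (auto simp: simple_lie_algebra_def)
      moreover have "i \<in> ?I" using scale_one[of i] by (metis rangeI)
      ultimately have ID: "?I = derived" using i0 by auto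
      have "alg_span ?L ?B \<subseteq> {0}"
      proof (rule hull_minimal)
        show "?B \<subseteq> {0}" using comm by (auto simp: ID[symmetric] scale_closed)
        show "alg_subspace ?L {0}"
          using derived_subgroup by (auto simp: alg_subspace_def additive_subgroup_def)
      qed
      moreover have "0 \<in> alg_span ?L ?B" by (auto simp: hull_def alg_subspace_def)
      ultimately have "alg_span ?L ?B = {0}" by blast
      then show False using L by (simp add: simple_lie_algebra_def)
    qed
  next
    assume ni: "i \<notin> derived"
    obtain x y where xy: "x \<in> derived" "y \<in> derived" "bracket x y \<noteq> 0"
      by (rule derived_not_abelian[OF e ni])
    have "bracket x y \<in> alg_span ?L ?B" by (rule hull_inc) (use xy in blast)
    then have "alg_span ?L ?B \<noteq> {0}" using xy by auto
    moreover have "U = {0} \<or> U = derived" if "lie_ideal ?L U" for U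
      using derived_simple[OF e ni, of U] that by (auto simp: lie_ideal_iff)
    ultimately show "simple_lie_algebra ?L" by (simp add: simple_lie_algebra_def)
  qed
qed

end

section \<open>The ideal of relations of a Leavitt path algebra\<close>

definition linear_extension :: "('b \<Rightarrow> 'k::field) \<Rightarrow> ('b \<Rightarrow>\<^sub>0 'k) \<Rightarrow> 'k" where
  "linear_extension t p = (\<Sum>w\<in>Poly_Mapping.keys p. Poly_Mapping.lookup p w * t w)"

lemma linear_extension_superset:
  assumes "finite S" "Poly_Mapping.keys p \<subseteq> S"
  shows "linear_extension t p = (\<Sum>w\<in>S. Poly_Mapping.lookup p w * t w)"
  unfolding linear_extension_def
  by (rule sum.mono_neutral_left) (use assms in \<open>auto simp: in_keys_iff\<close>)

lemma linear_extension_add: "linear_extension t (p + q) = linear_extension t p + linear_extension t q"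
proof -
  let ?S = "Poly_Mapping.keys p \<union> Poly_Mapping.keys q"
  have "Poly_Mapping.keys (p + q) \<subseteq> ?S" by (rule Poly_Mapping.keys_add)
  then show ?thesis
    by (simp add: linear_extension_superset[of ?S] lookup_add distrib_right sum.distrib)
qed

lemma linear_extension_scale: "linear_extension t (poly_scale c p) = c * linear_extension t p"
proof -
  have "Poly_Mapping.keys (poly_scale c p) \<subseteq> Poly_Mapping.keys p" by (auto simp: in_keys_iff)
  then show ?thesis
    by (simp add: linear_extension_superset[of "Poly_Mapping.keys p"] sum_distrib_left mult.assoc)
qed

lemma linear_extension_0 [simp]: "linear_extension t 0 = 0"
  by (simp add: linear_extension_def)

lemma linear_extension_minus: "linear_extension t (- p) = - linear_extension t p"
  using linear_extension_add[of t p "- p"] by (simp add: eq_neg_iff_add_eq_0 add.commute)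

lemma linear_extension_diff: "linear_extension t (p - q) = linear_extension t p - linear_extension t q"
  using linear_extension_add[of t p "- q"] by (simp add: linear_extension_minus)

lemma linear_extension_sum: "linear_extension t (\<Sum>x\<in>S. f x) = (\<Sum>x\<in>S. linear_extension t (f x))"
  by (induction S rule: infinite_finite_induct) (simp_all add: linear_extension_add)

lemma linear_extension_single [simp]: "linear_extension t (Poly_Mapping.single w c) = c * t w"
  by (cases "c = 0") (simp_all add: linear_extension_def)

lemma linear_extension_commute:
  fixes t :: "'b::monoid_add \<Rightarrow> 'k::field"
  assumes cyclic: "\<And>u w. t (u + w) = t (w + u)"
  shows "linear_extension t (p * q) = linear_extension t (q * p)"
proof (induction p rule: poly_mapping_single_induct)
  case (single u c)
  show ?case
  proof (induction q rule: poly_mapping_single_induct)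
    case (single w d)
    then show ?case using cyclic[of u w] by (simp add: mult_single)
  qed (simp add: distrib_left distrib_right linear_extension_add)
qed (simp add: distrib_left distrib_right linear_extension_add)

abbreviation free_carrier :: "'g set \<Rightarrow> ('g word \<Rightarrow>\<^sub>0 'k::field) set" where
  "free_carrier X \<equiv> alg_carrier (free_algebra X)"

lemma free_algebra_set_algebra: "free_algebra X = set_algebra (free_carrier X) poly_scale"
  by (simp add: free_algebra_def set_algebra_def poly_scale_def fun_eq_iff)

lemma in_free_carrier: "p \<in> free_carrier X \<longleftrightarrow>
    (\<forall>w\<in>Poly_Mapping.keys p. letters w \<noteq> [] \<and> set (letters w) \<subseteq> X)"
  by (simp add: free_algebra_def)

lemma free_carrier_closed:
  shows "0 \<in> free_carrier X"
    and "p \<in> free_carrier X \<Longrightarrow> q \<in> free_carrier X \<Longrightarrow> p + q \<in> free_carrier X"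
    and "p \<in> free_carrier X \<Longrightarrow> poly_scale c p \<in> free_carrier X"
    and "p \<in> free_carrier X \<Longrightarrow> q \<in> free_carrier X \<Longrightarrow> p * q \<in> free_carrier X"
proof -
  show "0 \<in> free_carrier X" by (simp add: in_free_carrier)
  show "p + q \<in> free_carrier X" if "p \<in> free_carrier X" "q \<in> free_carrier X"
    using that Poly_Mapping.keys_add[of p q] by (auto simp: in_free_carrier)
  have "Poly_Mapping.keys (poly_scale c p) \<subseteq> Poly_Mapping.keys p" by (auto simp: in_keys_iff)
  then show "poly_scale c p \<in> free_carrier X" if "p \<in> free_carrier X"
    using that unfolding in_free_carrier by blast
  show "p * q \<in> free_carrier X" if pq: "p \<in> free_carrier X" "q \<in> free_carrier X"
    unfolding in_free_carrier
  proof
    fix w assume "w \<in> Poly_Mapping.keys (p * q)"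
    then obtain a b where "w = a + b" "a \<in> Poly_Mapping.keys p" "b \<in> Poly_Mapping.keys q"
      using keys_mult[of p q] by blast
    then show "letters w \<noteq> [] \<and> set (letters w) \<subseteq> X"
      using pq by (simp add: in_free_carrier plus_word_def)
  qed
qed

lemma free_carrier_neg: "p \<in> free_carrier X \<Longrightarrow> - p \<in> free_carrier X"
  using free_carrier_closed(3)[of p X "- 1"] by simp

lemma free_carrier_diff: "p \<in> free_carrier X \<Longrightarrow> q \<in> free_carrier X \<Longrightarrow> p - q \<in> free_carrier X"
  using free_carrier_closed(2)[of p X "- q"] free_carrier_neg[of q] by simp

lemma free_carrier_sum: "(\<And>x. x \<in> S \<Longrightarrow> f x \<in> free_carrier X) \<Longrightarrow> (\<Sum>x\<in>S. f x) \<in> free_carrier X"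
  by (induction S rule: infinite_finite_induct) (simp_all add: free_carrier_closed)

lemma free_gen_in_carrier: "g \<in> X \<Longrightarrow> free_gen g \<in> free_carrier X"
  by (simp add: in_free_carrier free_gen_def)

lemma free_carrier_induct [consumes 1, case_names zero single add]:
  fixes p :: "'g word \<Rightarrow>\<^sub>0 'k::field"
  assumes "p \<in> free_carrier X"
    and zero: "P 0"
    and single: "\<And>w c. letters w \<noteq> [] \<Longrightarrow> set (letters w) \<subseteq> X \<Longrightarrow> P (Poly_Mapping.single w c)"
    and add: "\<And>p q. P p \<Longrightarrow> P q \<Longrightarrow> P (p + q)"
  shows "P p"
  using assms(1)
proof (induction p rule: update_induct)
  case const
  then show ?case by (simp add: zero)
next
  case (update p a b)
  have eq: "Poly_Mapping.update a b p = p + Poly_Mapping.single a b"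
    using update by (intro poly_mapping_eqI)
      (auto simp: lookup_update lookup_add lookup_single when_def in_keys_iff)
  have "Poly_Mapping.keys (Poly_Mapping.update a b p) = insert a (Poly_Mapping.keys p)"
    using update by (auto simp: keys_update)
  then have "letters a \<noteq> [] \<and> set (letters a) \<subseteq> X" "p \<in> free_carrier X"
    using update.prems by (auto simp: in_free_carrier)
  then show ?case unfolding eq using add single update.IH by blast
qed

lemma closed_free_algebra: "closed_algebra (free_algebra X :: ('k::field, 'g word \<Rightarrow>\<^sub>0 'k) k_algebra)"
proof -
  have "closed_algebra (set_algebra (free_carrier X) poly_scale :: ('k, 'g word \<Rightarrow>\<^sub>0 'k) k_algebra)"
    by (simp add: closed_algebra_def free_carrier_closed)
  then show ?thesis by (simp add: free_algebra_set_algebra[symmetric])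
qed

context wf_digraph
begin

abbreviation words :: "(('a, 'b) lpa_gen word \<Rightarrow>\<^sub>0 'k::field) set" where
  "words \<equiv> free_carrier (lpa_gens G)"

definition lpa_ideal :: "(('a, 'b) lpa_gen word \<Rightarrow>\<^sub>0 'k::field) set" where
  "lpa_ideal = alg_ideal (free_algebra (lpa_gens G)) hull lpa_relations G"

lemma gens_in_words:
  shows "v \<in> verts G \<Longrightarrow> vtx v \<in> words" and "e \<in> arcs G \<Longrightarrow> edg e \<in> words"
    and "e \<in> arcs G \<Longrightarrow> gst e \<in> words"
  by (auto intro!: free_gen_in_carrier simp: lpa_gens_def)

lemma relations_in_words: "lpa_relations G \<subseteq> words"
proof
  fix r :: "('a, 'b) lpa_gen word \<Rightarrow>\<^sub>0 'k::field" assume "r \<in> lpa_relations G"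
  then show "r \<in> words"
    by cases (auto intro!: free_carrier_diff free_carrier_closed free_carrier_sum gens_in_words)
qed

lemma alg_ideal_lpa_ideal: "alg_ideal (free_algebra (lpa_gens G)) lpa_ideal"
  unfolding lpa_ideal_def by (intro alg_ideal_hull closed_free_algebra relations_in_words)

lemma lpa_ideal:
  shows "lpa_ideal \<subseteq> words" and "0 \<in> lpa_ideal"
    and "x \<in> lpa_ideal \<Longrightarrow> y \<in> lpa_ideal \<Longrightarrow> x + y \<in> lpa_ideal"
    and "x \<in> lpa_ideal \<Longrightarrow> poly_scale c x \<in> lpa_ideal"
    and "a \<in> words \<Longrightarrow> x \<in> lpa_ideal \<Longrightarrow> a * x \<in> lpa_ideal"
    and "a \<in> words \<Longrightarrow> x \<in> lpa_ideal \<Longrightarrow> x * a \<in> lpa_ideal"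
    and "r \<in> lpa_relations G \<Longrightarrow> r \<in> lpa_ideal"
proof -
  have "alg_ideal (set_algebra words poly_scale) lpa_ideal"
    using alg_ideal_lpa_ideal free_algebra_set_algebra by metis
  then show "lpa_ideal \<subseteq> words" "0 \<in> lpa_ideal"
    "x \<in> lpa_ideal \<Longrightarrow> y \<in> lpa_ideal \<Longrightarrow> x + y \<in> lpa_ideal"
    "x \<in> lpa_ideal \<Longrightarrow> poly_scale c x \<in> lpa_ideal"
    "a \<in> words \<Longrightarrow> x \<in> lpa_ideal \<Longrightarrow> a * x \<in> lpa_ideal"
    "a \<in> words \<Longrightarrow> x \<in> lpa_ideal \<Longrightarrow> x * a \<in> lpa_ideal"
    by (auto simp: alg_ideal_def alg_subspace_def)
  show "r \<in> lpa_relations G \<Longrightarrow> r \<in> lpa_ideal" unfolding lpa_ideal_def by (rule hull_inc)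
qed

lemma lpa_ideal_neg: "x \<in> lpa_ideal \<Longrightarrow> - x \<in> lpa_ideal"
  using lpa_ideal(4)[of x "- 1"] by simp

lemma lpa_ideal_sum: "(\<And>x. x \<in> S \<Longrightarrow> f x \<in> lpa_ideal) \<Longrightarrow> (\<Sum>x\<in>S. f x) \<in> lpa_ideal"
  by (induction S rule: infinite_finite_induct) (simp_all add: lpa_ideal)

definition vertex_sum :: "('a, 'b) lpa_gen word \<Rightarrow>\<^sub>0 'k::field" where
  "vertex_sum = (\<Sum>v\<in>verts G. vtx v)"

lemma vertex_sum_in_words: "vertex_sum \<in> words"
  unfolding vertex_sum_def by (intro free_carrier_sum gens_in_words)

text \<open>A generator \<open>y\<close> satisfies \<open>x y = y\<close> and \<open>y x' = y\<close> for suitable vertices \<open>x\<close> and \<open>x'\<close>, so the statement for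
  vertices implies the one for edges and ghost edges. The congruences are written as memberships of
  differences in the ideal.\<close>

lemma vertex_sum_gen:
  fixes I :: "('a, 'b) lpa_gen word \<Rightarrow>\<^sub>0 'k::field"
  assumes fin: "finite (verts G)" and I: "I = vertex_sum" and g: "g \<in> lpa_gens G"
  shows "I * free_gen g - free_gen g \<in> lpa_ideal"
    and "free_gen g * I - free_gen g \<in> lpa_ideal"
proof -
  have I_words: "I \<in> words" unfolding I by (rule vertex_sum_in_words)
  have V: "I * vtx v - vtx v \<in> lpa_ideal" "vtx v * I - vtx v \<in> lpa_ideal"
    if v: "v \<in> verts G" for v
  proof -
    have "I * vtx v - vtx v = (\<Sum>w\<in>verts G. vtx w * vtx v - (if w = v then vtx v else 0))"
      using fin v by (simp add: I vertex_sum_def sum_distrib_right sum_subtractf)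
    then show "I * vtx v - vtx v \<in> lpa_ideal"
      by (simp only:) (intro lpa_ideal_sum lpa_ideal(7) lpa_relations.vertex_vertex v)
    have "vtx v * I - vtx v = (\<Sum>w\<in>verts G. vtx v * vtx w - (if v = w then vtx w else 0))"
      using fin v by (simp add: I vertex_sum_def sum_distrib_left sum_subtractf)
    then show "vtx v * I - vtx v \<in> lpa_ideal"
      by (simp only:) (intro lpa_ideal_sum lpa_ideal(7) lpa_relations.vertex_vertex v)
  qed
  have left: "I * y - y \<in> lpa_ideal"
    if "I * x - x \<in> lpa_ideal" "x * y - y \<in> lpa_ideal" "y \<in> words" for x y :: "('a, 'b) lpa_gen word \<Rightarrow>\<^sub>0 'k"
  proof -
    have "(I * x - x) * y + (x * y - y) + - (I * (x * y - y)) \<in> lpa_ideal"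
      by (rule lpa_ideal(3)[OF lpa_ideal(3)[OF lpa_ideal(6)[OF that(3,1)] that(2)]
            lpa_ideal_neg[OF lpa_ideal(5)[OF I_words that(2)]]])
    then show ?thesis by (simp add: algebra_simps)
  qed
  have right: "y * I - y \<in> lpa_ideal"
    if "x * I - x \<in> lpa_ideal" "y * x - y \<in> lpa_ideal" "y \<in> words" for x y :: "('a, 'b) lpa_gen word \<Rightarrow>\<^sub>0 'k"
  proof -
    have "y * (x * I - x) + (y * x - y) + - ((y * x - y) * I) \<in> lpa_ideal"
      by (rule lpa_ideal(3)[OF lpa_ideal(3)[OF lpa_ideal(5)[OF that(3,1)] that(2)]
            lpa_ideal_neg[OF lpa_ideal(6)[OF I_words that(2)]]])
    then show ?thesis by (simp add: algebra_simps)
  qed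
  from g show "I * free_gen g - free_gen g \<in> lpa_ideal"
    unfolding lpa_gens_def
    by (auto intro: V
        left[OF V(1)[OF head_in_verts] lpa_ideal(7)[OF lpa_relations.range_edge] gens_in_words(2)]
        left[OF V(1)[OF tail_in_verts] lpa_ideal(7)[OF lpa_relations.source_ghost] gens_in_words(3)])
  from g show "free_gen g * I - free_gen g \<in> lpa_ideal"
    unfolding lpa_gens_def
    by (auto intro: V
        right[OF V(2)[OF tail_in_verts] lpa_ideal(7)[OF lpa_relations.edge_source] gens_in_words(2)]
        right[OF V(2)[OF head_in_verts] lpa_ideal(7)[OF lpa_relations.ghost_range] gens_in_words(3)])
qed

lemma vertex_sum_unit:
  fixes a :: "('a, 'b) lpa_gen word \<Rightarrow>\<^sub>0 'k::field"
  assumes fin: "finite (verts G)" and a: "a \<in> words"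
  shows "vertex_sum * a - a \<in> lpa_ideal" "a * vertex_sum - a \<in> lpa_ideal"
proof -
  have "vertex_sum * a - a \<in> lpa_ideal \<and> a * vertex_sum - a \<in> lpa_ideal"
    using a
  proof (induction rule: free_carrier_induct)
    case zero
    show ?case by (simp add: lpa_ideal)
  next
    case (add p q)
    then have "(vertex_sum * p - p) + (vertex_sum * q - q) \<in> lpa_ideal"
      "(p * vertex_sum - p) + (q * vertex_sum - q) \<in> lpa_ideal" by (auto intro: lpa_ideal(3))
    then show ?case by (simp add: algebra_simps)
  next
    case (single w c)
    let ?s = "\<lambda>ws. Poly_Mapping.single (Word ws) c :: ('a, 'b) lpa_gen word \<Rightarrow>\<^sub>0 'k"
    obtain g ws where w: "w = Word (g # ws)" "g \<in> lpa_gens G" "set ws \<subseteq> lpa_gens G"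
      using single by (cases w; cases "letters w") auto
    obtain h us where h: "w = Word (us @ [h])" "h \<in> lpa_gens G" "set us \<subseteq> lpa_gens G"
      using single by (cases w; cases "letters w" rule: rev_cases) auto
    have in_words: "?s xs \<in> words" if "xs \<noteq> []" "set xs \<subseteq> lpa_gens G" for xs
      using that by (simp add: in_free_carrier)
    have scale: "?s [x] = poly_scale c (free_gen x)" for x
      by (simp add: free_gen_def poly_scale_def)
    have "vertex_sum * ?s (g # ws) - ?s (g # ws) \<in> lpa_ideal"
    proof (cases "ws = []")
      case True
      have "poly_scale c (vertex_sum * free_gen g - free_gen g) \<in> lpa_ideal"
        using vertex_sum_gen[OF fin refl w(2)] by (intro lpa_ideal(4))
      then show ?thesis
        using True by (simp add: scale poly.scale_right_diff_distrib poly_scale_mult(2))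
    next
      case False
      have "(vertex_sum * free_gen g - free_gen g) * ?s ws \<in> lpa_ideal"
        using False w vertex_sum_gen[OF fin refl w(2)] by (intro lpa_ideal(6) in_words)
      moreover have "?s (g # ws) = free_gen g * ?s ws"
        by (simp add: free_gen_def mult_single plus_word_def)
      ultimately show ?thesis by (simp add: algebra_simps)
    qed
    moreover have "?s (us @ [h]) * vertex_sum - ?s (us @ [h]) \<in> lpa_ideal"
    proof (cases "us = []")
      case True
      have "poly_scale c (free_gen h * vertex_sum - free_gen h) \<in> lpa_ideal"
        using vertex_sum_gen[OF fin refl h(2)] by (intro lpa_ideal(4))
      then show ?thesis
        using True by (simp add: scale poly.scale_right_diff_distrib poly_scale_mult(1))
    next
      case False
      have "?s us * (free_gen h * vertex_sum - free_gen h) \<in> lpa_ideal"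
        using False h vertex_sum_gen[OF fin refl h(2)] by (intro lpa_ideal(5) in_words)
      moreover have "?s (us @ [h]) = ?s us * free_gen h"
        by (simp add: free_gen_def mult_single plus_word_def)
      ultimately show ?thesis by (simp add: algebra_simps)
    qed
    ultimately show ?case using w h by simp
  qed
  then show "vertex_sum * a - a \<in> lpa_ideal" "a * vertex_sum - a \<in> lpa_ideal" by auto
qed

end

section \<open>Traces\<close>

text \<open>A function on words that is invariant under rotation and compatible with the defining relations at
  the end of a word. By rotation invariance this is compatibility anywhere in a word, so that the
  linear extension is a trace on the Leavitt path algebra.\<close>

locale trace_functional = wf_digraph G for G :: "('a, 'b) pre_digraph" +
  fixes t :: "('a, 'b) lpa_gen list \<Rightarrow> 'k::field"
  assumes cyclic: "\<And>us ws. t (us @ ws) = t (ws @ us)"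
    and vv: "\<And>us v w. v \<in> verts G \<Longrightarrow> w \<in> verts G \<Longrightarrow>
      t (us @ [Vertex v, Vertex w]) = (if v = w then t (us @ [Vertex w]) else 0)"
    and he: "\<And>us e. e \<in> arcs G \<Longrightarrow> t (us @ [Vertex (head G e), Edge e]) = t (us @ [Edge e])"
    and et: "\<And>us e. e \<in> arcs G \<Longrightarrow> t (us @ [Edge e, Vertex (tail G e)]) = t (us @ [Edge e])"
    and tg: "\<And>us e. e \<in> arcs G \<Longrightarrow> t (us @ [Vertex (tail G e), Ghost e]) = t (us @ [Ghost e])"
    and gh: "\<And>us e. e \<in> arcs G \<Longrightarrow> t (us @ [Ghost e, Vertex (head G e)]) = t (us @ [Ghost e])"
    and ge: "\<And>us e f. e \<in> arcs G \<Longrightarrow> f \<in> arcs G \<Longrightarrow>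
      t (us @ [Ghost e, Edge f]) = (if e = f then t (us @ [Vertex (tail G e)]) else 0)"
    and reg: "\<And>us v. v \<in> verts G \<Longrightarrow> regular_vertex G v \<Longrightarrow>
      t (us @ [Vertex v]) = (\<Sum>e\<in>in_arcs G v. t (us @ [Edge e, Ghost e]))"

begin

lemma commute: "linear_extension (\<lambda>w. t (letters w)) (p * q) = linear_extension (\<lambda>w. t (letters w)) (q * p)"
  by (rule linear_extension_commute) (simp add: plus_word_def cyclic)

lemma vanishes:
  assumes "p \<in> lpa_ideal"
  shows "linear_extension (\<lambda>w. t (letters w)) p = 0"
proof -
  let ?T = "linear_extension (\<lambda>w. t (letters w))"
  \<comment> \<open>The radical of the trace form is an ideal, and it contains the relations.\<close>
  let ?J = "{p \<in> words. \<forall>q. ?T (q * p) = 0}"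
  have ideal: "alg_ideal (set_algebra words poly_scale) ?J"
    unfolding alg_ideal_def alg_subspace_def
  proof (simp, intro conjI ballI allI impI)
    fix a x q :: "('a, 'b) lpa_gen word \<Rightarrow>\<^sub>0 'k::field"
    assume x: "x \<in> words \<and> (\<forall>q. ?T (q * x) = 0)"
    show "?T (q * (a * x)) = 0" using x by (simp add: mult.assoc[symmetric])
    have "?T (q * (x * a)) = ?T (a * q * x)" using commute[of "q * x" a] by (simp add: mult.assoc)
    then show "?T (q * (x * a)) = 0" using x by simp
  qed (auto simp: free_carrier_closed distrib_left linear_extension_add
      poly_scale_mult(2)[symmetric] linear_extension_scale)
  have "lpa_relations G \<subseteq> ?J"
  proof
    fix r :: "('a, 'b) lpa_gen word \<Rightarrow>\<^sub>0 'k::field" assume r: "r \<in> lpa_relations G"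
    have "?T (q * r) = 0" for q
    proof (induction q rule: poly_mapping_single_induct)
      case (single w c)
      from r show ?case
        by cases (simp_all add: free_gen_def mult_single right_diff_distrib linear_extension_diff
            plus_word_def if_distrib[of "\<lambda>x. _ * x"] sum_distrib_left linear_extension_sum
            vv he et tg gh ge reg cong: if_cong)
    qed (simp add: distrib_right linear_extension_add)
    then show "r \<in> ?J" using r relations_in_words by auto
  qed
  moreover have "alg_ideal (free_algebra (lpa_gens G)) ?J"
    by (subst free_algebra_set_algebra) (rule ideal)
  ultimately have "lpa_ideal \<subseteq> ?J"
    unfolding lpa_ideal_def by (intro hull_minimal)
  then have "?T (1 * p) = 0" using assms by blast
  then show ?thesis by simp
qed

end

section \<open>The trace of a vertex weighting\<close>

context wf_digraph
begin

text \<open>A finite path is given by its edges, from its range back to its source, together with the source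
  vertex \<open>s\<close>; without \<open>s\<close> the trivial paths could not be told apart. Edges are attached and removed
  at the range end, so a word acts on paths as a partial map that leaves \<open>s\<close> unchanged. All relations
  except the one at regular vertices hold for this action.\<close>

fun target :: "'b list \<Rightarrow> 'a \<Rightarrow> 'a" where
  "target [] s = s"
| "target (e # es) s = head G e"

fun is_path :: "'b list \<Rightarrow> 'a \<Rightarrow> bool" where
  "is_path [] s \<longleftrightarrow> True"
| "is_path (e # es) s \<longleftrightarrow> e \<in> arcs G \<and> tail G e = target es s \<and> is_path es s"

lemma target_append [simp]: "target (p @ z) s = target p (target z s)"
  by (cases p) auto

lemma is_path_append [simp]: "is_path (p @ z) s \<longleftrightarrow> is_path p (target z s) \<and> is_path z s"
  by (induction p) auto

fun act_gen :: "'a \<Rightarrow> ('a, 'b) lpa_gen \<Rightarrow> 'b list \<Rightarrow> 'b list option" where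
  "act_gen s (Vertex v) es = (if is_path es s \<and> target es s = v then Some es else None)"
| "act_gen s (Edge e) es = (if is_path (e # es) s then Some (e # es) else None)"
| "act_gen s (Ghost e) [] = None"
| "act_gen s (Ghost e) (f # fs) = (if e = f \<and> is_path (f # fs) s then Some fs else None)"

fun act :: "'a \<Rightarrow> ('a, 'b) lpa_gen list \<Rightarrow> 'b list \<Rightarrow> 'b list option" where
  "act s [] es = Some es"
| "act s (g # gs) es = Option.bind (act s gs es) (act_gen s g)"

lemma act_append: "act s (us @ ws) es = Option.bind (act s ws es) (act s us)"
  by (induction us) (auto split: bind_splits)

lemma act_path: "is_path es s \<Longrightarrow> act s ws es = Some fs \<Longrightarrow> is_path fs s"
proof (induction ws arbitrary: fs)
  case (Cons g ws)
  then obtain xs where "act s ws es = Some xs" "act_gen s g xs = Some fs"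
    by (auto split: bind_splits)
  with Cons show ?case
    by (cases "(s, g, xs)" rule: act_gen.cases) (auto split: if_splits)
qed auto

text \<open>The action affects only the range end of a path, so it commutes with extending paths at their sources.\<close>

lemma act_extend:
  assumes "is_path z s'" "target z s' = s" "act s ws es = Some fs"
  shows "act s' ws (es @ z) = Some (fs @ z)"
  using assms(3)
proof (induction ws arbitrary: fs)
  case (Cons g ws)
  then obtain xs where "act s ws es = Some xs" "act_gen s g xs = Some fs"
    by (auto split: bind_splits)
  with Cons have "act s' ws (es @ z) = Some (xs @ z)" by blast
  moreover have "act_gen s' g (xs @ z) = Some (fs @ z)"
    using \<open>act_gen s g xs = Some fs\<close> assms(1,2)
    by (cases "(s, g, xs)" rule: act_gen.cases) (auto split: if_splits)
  ultimately show ?case by simp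
qed auto

text \<open>The action of the monomial \<open>p q\<^sup>*\<close>, where the paths \<open>p\<close> and \<open>q\<close> have the same source \<open>v\<close>.\<close>

definition exchange :: "'b list \<Rightarrow> 'b list \<Rightarrow> 'a \<Rightarrow> 'a \<Rightarrow> 'b list \<Rightarrow> 'b list \<Rightarrow> bool" where
  "exchange p q v s es fs \<longleftrightarrow> (\<exists>z. es = q @ z \<and> fs = p @ z \<and> is_path z s \<and> target z s = v)"

text \<open>Every nonempty word acts as \<open>0\<close> or as some monomial \<open>p q\<^sup>*\<close>: multiplying by a generator on the left
  changes \<open>p\<close> at its range end, or, for a ghost edge and trivial \<open>p\<close>, makes \<open>q\<close> longer.\<close>

lemma act_normal_form:
  assumes "ws \<noteq> []"
  shows "(\<forall>s es. act s ws es = None) \<or>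
    (\<exists>p q v. is_path p v \<and> is_path q v \<and> (\<forall>s es fs. act s ws es = Some fs \<longleftrightarrow> exchange p q v s es fs))"
  using assms
proof (induction ws rule: list_nonempty_induct)
  case (single g)
  show ?case
  proof (cases g)
    case (Vertex v)
    have "act s [g] es = Some fs \<longleftrightarrow> exchange [] [] v s es fs" for s es fs
      using Vertex by (auto simp: exchange_def)
    then show ?thesis by (intro disjI2 exI[of _ "[]"] exI[of _ v]) auto
  next
    case (Edge e)
    have "act s [g] es = Some fs \<longleftrightarrow> exchange [e] [] (tail G e) s es fs" if "e \<in> arcs G" for s es fs
      using Edge that by (auto simp: exchange_def)
    moreover have "is_path [e] (tail G e)" if "e \<in> arcs G" using that by simp
    moreover have "act s [g] es = None" if "e \<notin> arcs G" for s es using Edge that by auto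
    ultimately show ?thesis by (metis is_path.simps(1))
  next
    case (Ghost e)
    have "act s [g] es = Some fs \<longleftrightarrow> exchange [] [e] (tail G e) s es fs" if "e \<in> arcs G" for s es fs
      using Ghost that by (cases es) (auto simp: exchange_def)
    moreover have "is_path [e] (tail G e)" if "e \<in> arcs G" using that by simp
    moreover have "act s [g] es = None" if "e \<notin> arcs G" for s es using Ghost that by (cases es) auto
    ultimately show ?thesis by (metis is_path.simps(1))
  qed
next
  case (cons g ws)
  from cons.IH show ?case
  proof
    assume "\<forall>s es. act s ws es = None"
    then show ?thesis by simp
  next
    assume "\<exists>p q v. is_path p v \<and> is_path q v \<and> (\<forall>s es fs. act s ws es = Some fs \<longleftrightarrow> exchange p q v s es fs)"
    then obtain p q v where pq: "is_path p v" "is_path q v"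
      and act: "\<And>s es fs. act s ws es = Some fs \<longleftrightarrow> exchange p q v s es fs" by blast
    have step: "act s (g # ws) es = Some fs \<longleftrightarrow>
      (\<exists>z. es = q @ z \<and> is_path z s \<and> target z s = v \<and> act_gen s g (p @ z) = Some fs)" for s es fs
      by (auto simp: act exchange_def split: bind_splits) (metis act option.distinct(1) exchange_def)
    have none: ?thesis if "\<And>s z. is_path z s \<Longrightarrow> target z s = v \<Longrightarrow> act_gen s g (p @ z) = None"
    proof -
      have "act s (g # ws) es \<noteq> Some fs" for s es fs using step that by auto
      then show ?thesis by (meson not_None_eq)
    qed
    have some: ?thesis if "is_path p' v'" "is_path q' v'"
      "\<And>s es fs. act s (g # ws) es = Some fs \<longleftrightarrow> exchange p' q' v' s es fs" for p' q' v'
      using that by blast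
    show ?thesis
    proof (cases g)
      case (Vertex u)
      show ?thesis
      proof (cases "target p v = u")
        case True
        show ?thesis by (rule some[OF pq]) (unfold step, use True Vertex pq in \<open>auto simp: exchange_def\<close>)
      qed (rule none, use Vertex in auto)
    next
      case (Edge e)
      show ?thesis
      proof (cases "is_path (e # p) v")
        case True
        show ?thesis by (rule some[OF True pq(2)]) (unfold step, use True Edge pq in \<open>auto simp: exchange_def\<close>)
      qed (rule none, use Edge pq in auto)
    next
      case (Ghost e)
      show ?thesis
      proof (cases p)
        case Nil
        show ?thesis
        proof (cases "e \<in> arcs G \<and> head G e = v")
          case True
          have gen: "act_gen s g z = Some fs \<longleftrightarrow> z = e # fs \<and> is_path z s" for s z fs
            using Ghost by (cases z) auto
          show ?thesis
          proof (rule some[of "[]" "tail G e" "q @ [e]"])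
            show "is_path (q @ [e]) (tail G e)" using True pq by simp
            show "act s (g # ws) es = Some fs \<longleftrightarrow> exchange [] (q @ [e]) (tail G e) s es fs" for s es fs
              unfolding step using True Nil by (auto simp: gen exchange_def)
          qed simp
        next
          case False
          have "act_gen s g z = None" if "is_path z s" "target z s = v" for s z
            using False Ghost that by (cases z) auto
          then show ?thesis using none Nil by simp
        qed
      next
        case (Cons f p')
        show ?thesis
        proof (cases "e = f")
          case True
          show ?thesis
            by (rule some[of p' v q]) (unfold step, use True Ghost Cons pq in \<open>auto simp: exchange_def\<close>)
        qed (rule none, use Ghost Cons in auto)
      qed
    qed
  qed
qed

definition fixed_paths :: "('a, 'b) lpa_gen list \<Rightarrow> ('b list \<times> 'a) set" where
  "fixed_paths ws = {(es, s). is_path es s \<and> act s ws es = Some es}"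

definition cone :: "'b list \<Rightarrow> 'a \<Rightarrow> ('b list \<times> 'a) set" where
  "cone p v = {(p @ z, s) | z s. is_path z s \<and> target z s = v}"

lemma cone_self: "(p, v) \<in> cone p v"
  by (force simp: cone_def)

lemma cone_inject: "cone p v = cone q u \<Longrightarrow> p = q \<and> v = u"
proof -
  assume "cone p v = cone q u"
  then have "(p, v) \<in> cone q u" "(q, u) \<in> cone p v" using cone_self by blast+
  then show ?thesis by (auto simp: cone_def)
qed

text \<open>The monomial \<open>p q\<^sup>*\<close> fixes \<open>q z\<close> only if \<open>p z = q z\<close>, that is, if \<open>p = q\<close>; and \<open>p p\<^sup>*\<close> fixes exactly the
  paths that begin with \<open>p\<close>.\<close>

lemma fixed_paths_cone:
  assumes "ws \<noteq> []"
  shows "fixed_paths ws = {} \<or> (\<exists>p v. is_path p v \<and> fixed_paths ws = cone p v)"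
  using act_normal_form[OF assms]
proof
  assume "\<forall>s es. act s ws es = None"
  then show ?thesis by (simp add: fixed_paths_def)
next
  assume "\<exists>p q v. is_path p v \<and> is_path q v \<and> (\<forall>s es fs. act s ws es = Some fs \<longleftrightarrow> exchange p q v s es fs)"
  then obtain p q v where pq: "is_path p v" "is_path q v"
    and act: "\<And>s es fs. act s ws es = Some fs \<longleftrightarrow> exchange p q v s es fs" by blast
  show ?thesis
  proof (cases "p = q")
    case True
    then have "fixed_paths ws = cone p v"
      using pq by (auto simp: fixed_paths_def cone_def act exchange_def)
    then show ?thesis using pq by blast
  next
    case False
    then have "fixed_paths ws = {}" by (auto simp: fixed_paths_def act exchange_def)
    then show ?thesis by blast
  qed
qed

definition fixed_at :: "('a, 'b) lpa_gen list \<Rightarrow> 'a \<Rightarrow> bool" where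
  "fixed_at ws v \<longleftrightarrow> (\<exists>p. is_path p v \<and> fixed_paths ws = cone p v)"

text \<open>The word \<open>ws\<close> maps the fixed paths of \<open>us @ ws\<close> bijectively to those of \<open>ws @ us\<close>. As the action
  preserves sources and commutes with extension, it carries one cone to the other.\<close>

lemma fixed_at_rotate:
  assumes "fixed_at (us @ ws) v"
  shows "fixed_at (ws @ us) v"
proof -
  obtain p where p: "is_path p v" "fixed_paths (us @ ws) = cone p v"
    using assms by (auto simp: fixed_at_def)
  then have "act v (us @ ws) p = Some p" using cone_self[of p v] by (auto simp: fixed_paths_def)
  then obtain q where q: "act v ws p = Some q" "act v us q = Some p"
    by (auto simp: act_append split: bind_splits)
  have "fixed_paths (ws @ us) = cone q v"
  proof (intro equalityI subsetI; clarify)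
    fix es s assume "(es, s) \<in> fixed_paths (ws @ us)"
    then obtain x where es: "is_path es s" and x: "act s us es = Some x" "act s ws x = Some es"
      by (auto simp: fixed_paths_def act_append split: bind_splits)
    then have "(x, s) \<in> fixed_paths (us @ ws)"
      using act_path by (auto simp: fixed_paths_def act_append)
    then obtain z where z: "x = p @ z" "is_path z s" "target z s = v"
      using p by (auto simp: cone_def)
    then have "es = q @ z" using act_extend[OF z(2,3) q(1)] x by simp
    then show "(es, s) \<in> cone q v" using z by (auto simp: cone_def)
  next
    fix es s assume "(es, s) \<in> cone q v"
    then obtain z where z: "es = q @ z" "is_path z s" "target z s = v" by (auto simp: cone_def)
    then have "act s us es = Some (p @ z)" "act s ws (p @ z) = Some es"
      using act_extend[OF z(2,3)] q by auto
    moreover have "is_path q v" using q p act_path by blast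
    ultimately show "(es, s) \<in> fixed_paths (ws @ us)"
      using z by (auto simp: fixed_paths_def act_append)
  qed
  then show ?thesis using act_path[OF p(1) q(1)] by (auto simp: fixed_at_def)
qed

text \<open>The trace is \<open>\<phi> v\<close> on \<open>p p\<^sup>*\<close> with \<open>p\<close> of source \<open>v\<close>, and \<open>0\<close> on all other monomials \<open>p q\<^sup>*\<close>. Expressed
  through fixed paths it needs no normal form of words; the sum has at most one term.\<close>

definition path_trace :: "('a \<Rightarrow> 'k::field) \<Rightarrow> ('a, 'b) lpa_gen list \<Rightarrow> 'k" where
  "path_trace \<phi> ws = (\<Sum>v\<in>{v \<in> verts G. fixed_at ws v}. \<phi> v)"

lemma path_trace_cone:
  assumes "is_path p v" "fixed_paths ws = cone p v"
  shows "path_trace \<phi> ws = (if v \<in> verts G then \<phi> v else 0)"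
proof -
  have "fixed_at ws u \<longleftrightarrow> u = v" for u
    using assms cone_inject unfolding fixed_at_def by metis
  then have "{u \<in> verts G. fixed_at ws u} = (if v \<in> verts G then {v} else {})" by auto
  then show ?thesis by (simp add: path_trace_def)
qed

lemma path_trace_empty: "fixed_paths ws = {} \<Longrightarrow> path_trace \<phi> ws = 0"
  using cone_self by (auto simp: path_trace_def fixed_at_def intro!: sum.neutral)

lemma path_trace_cong:
  assumes "\<And>s es. is_path es s \<Longrightarrow> act s ws es = act s ws' es"
  shows "path_trace \<phi> (us @ ws) = path_trace \<phi> (us @ ws')"
proof -
  have "fixed_paths (us @ ws) = fixed_paths (us @ ws')"
    using assms by (auto simp: fixed_paths_def act_append)
  then show ?thesis by (simp add: path_trace_def fixed_at_def)
qed

lemma path_trace_zero: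
  assumes "\<And>s es. is_path es s \<Longrightarrow> act s ws es = None"
  shows "path_trace \<phi> (us @ ws) = 0"
  using assms by (intro path_trace_empty) (auto simp: fixed_paths_def act_append)

text \<open>The fixed paths of \<open>us @ [Edge e, Ghost e]\<close> are those of \<open>us @ [Vertex v]\<close> that begin with \<open>e\<close>. If the
  latter form the cone of a nontrivial path, then only the first edge of this path contributes, and
  it contributes everything. If they form the cone of the trivial path \<open>v\<close>, then each \<open>e\<close> contributes
  \<open>\<phi>\<close> of its source, and the assumption on \<open>\<phi>\<close> applies.\<close>

lemma path_trace_regular:
  assumes v: "v \<in> verts G" and fin: "finite (in_arcs G v)"
    and \<phi>: "\<phi> v = (\<Sum>e\<in>in_arcs G v. \<phi> (tail G e))"
  shows "path_trace \<phi> (us @ [Vertex v]) = (\<Sum>e\<in>in_arcs G v. path_trace \<phi> (us @ [Edge e, Ghost e]))"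
proof -
  let ?F = "fixed_paths (us @ [Vertex v])"
  have F: "(es, s) \<in> ?F \<longleftrightarrow> is_path es s \<and> target es s = v \<and> act s us es = Some es" for es s
    by (auto simp: fixed_paths_def act_append)
  have Fe: "fixed_paths (us @ [Edge e, Ghost e]) = {(es, s) \<in> ?F. \<exists>fs. es = e # fs}"
    if e: "e \<in> in_arcs G v" for e
  proof -
    have "act s [Edge e, Ghost e] es = (if \<exists>fs. es = e # fs then Some es else None)"
      if "is_path es s" for s es using that by (cases es) auto
    then have "(es, s) \<in> fixed_paths (us @ [Edge e, Ghost e]) \<longleftrightarrow> (es, s) \<in> ?F \<and> (\<exists>fs. es = e # fs)" for es s
      unfolding F using e
      by (auto simp: fixed_paths_def act_append simp del: act.simps split: if_splits)
    then show ?thesis by auto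
  qed
  show ?thesis
  proof (cases "?F = {}")
    case True
    then have "path_trace \<phi> (us @ [Edge e, Ghost e]) = 0" if "e \<in> in_arcs G v" for e
      using Fe[OF that] by (intro path_trace_empty) auto
    then show ?thesis using True by (simp add: path_trace_empty)
  next
    case False
    then obtain p u where p: "is_path p u" "?F = cone p u"
      using fixed_paths_cone[of "us @ [Vertex v]"] by auto
    have pF: "(p, u) \<in> ?F" using p cone_self by simp
    show ?thesis
    proof (cases p)
      case Nil
      then have u: "u = v" using pF F by auto
      have "path_trace \<phi> (us @ [Edge e, Ghost e]) = \<phi> (tail G e)" if e: "e \<in> in_arcs G v" for e
      proof -
        have "fixed_paths (us @ [Edge e, Ghost e]) = cone [e] (tail G e)"
          unfolding Fe[OF e] p using e Nil u by (auto simp: cone_def)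
        moreover have "is_path [e] (tail G e)" "tail G e \<in> verts G" using e by auto
        ultimately show ?thesis using path_trace_cone[of "[e]" "tail G e"] by simp
      qed
      then have "(\<Sum>e\<in>in_arcs G v. path_trace \<phi> (us @ [Edge e, Ghost e])) =
          (\<Sum>e\<in>in_arcs G v. \<phi> (tail G e))" by (rule sum.cong[OF refl])
      then show ?thesis using path_trace_cone[OF p, of \<phi>] v u \<phi> by simp
    next
      case (Cons f p')
      have f: "f \<in> in_arcs G v" using pF F Cons by auto
      have "path_trace \<phi> (us @ [Edge e, Ghost e]) =
          (if e = f then path_trace \<phi> (us @ [Vertex v]) else 0)" if e: "e \<in> in_arcs G v" for e
      proof (cases "e = f")
        case True
        then have "fixed_paths (us @ [Edge e, Ghost e]) = cone p u"
          unfolding Fe[OF e] p Cons by (auto simp: cone_def)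
        then show ?thesis using True p by (simp add: path_trace_cone)
      next
        case False
        then have "fixed_paths (us @ [Edge e, Ghost e]) = {}"
          unfolding Fe[OF e] p Cons by (auto simp: cone_def)
        then show ?thesis using False by (simp add: path_trace_empty)
      qed
      then have "(\<Sum>e\<in>in_arcs G v. path_trace \<phi> (us @ [Edge e, Ghost e])) =
          (\<Sum>e\<in>in_arcs G v. if e = f then path_trace \<phi> (us @ [Vertex v]) else 0)"
        by (rule sum.cong[OF refl])
      also have "\<dots> = path_trace \<phi> (us @ [Vertex v])"
        using fin f by (simp only: sum.delta if_True)
      finally show ?thesis by simp
    qed
  qed
qed

lemma trace_functional_path_trace:
  assumes \<phi>: "\<And>v. v \<in> verts G \<Longrightarrow> regular_vertex G v \<Longrightarrow> \<phi> v = (\<Sum>e\<in>in_arcs G v. \<phi> (tail G e))"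
  shows "trace_functional G (path_trace \<phi>)"
proof
  fix us ws :: "('a, 'b) lpa_gen list"
  have "fixed_at (us @ ws) v \<longleftrightarrow> fixed_at (ws @ us) v" for v
    using fixed_at_rotate by blast
  then show "path_trace \<phi> (us @ ws) = path_trace \<phi> (ws @ us)" by (simp add: path_trace_def)
next
  fix us :: "('a, 'b) lpa_gen list" and v w
  show "path_trace \<phi> (us @ [Vertex v, Vertex w]) = (if v = w then path_trace \<phi> (us @ [Vertex w]) else 0)"
    by (auto intro!: path_trace_cong path_trace_zero)
next
  fix us :: "('a, 'b) lpa_gen list" and e assume e: "e \<in> arcs G"
  show "path_trace \<phi> (us @ [Vertex (head G e), Edge e]) = path_trace \<phi> (us @ [Edge e])"
    "path_trace \<phi> (us @ [Edge e, Vertex (tail G e)]) = path_trace \<phi> (us @ [Edge e])"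
    by (auto intro!: path_trace_cong)
  have "act s [Vertex (tail G e), Ghost e] es = act s [Ghost e] es"
    "act s [Ghost e, Vertex (head G e)] es = act s [Ghost e] es" for s es
    by (cases es; auto)+
  then show "path_trace \<phi> (us @ [Vertex (tail G e), Ghost e]) = path_trace \<phi> (us @ [Ghost e])"
    "path_trace \<phi> (us @ [Ghost e, Vertex (head G e)]) = path_trace \<phi> (us @ [Ghost e])"
    by (auto intro!: path_trace_cong simp del: act.simps)
next
  fix us :: "('a, 'b) lpa_gen list" and e f assume e: "e \<in> arcs G" "f \<in> arcs G"
  show "path_trace \<phi> (us @ [Ghost e, Edge f]) = (if e = f then path_trace \<phi> (us @ [Vertex (tail G e)]) else 0)"
    using e by (auto intro!: path_trace_cong path_trace_zero)
next
  fix us :: "('a, 'b) lpa_gen list" and v assume "v \<in> verts G" "regular_vertex G v"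
  then show "path_trace \<phi> (us @ [Vertex v]) = (\<Sum>e\<in>in_arcs G v. path_trace \<phi> (us @ [Edge e, Ghost e]))"
    using \<phi> by (intro path_trace_regular) (auto simp: regular_vertex_def)
qed

lemma path_trace_vertex: "v \<in> verts G \<Longrightarrow> path_trace \<phi> [Vertex v] = \<phi> v"
proof -
  have "fixed_paths [Vertex v] = cone [] v" by (auto simp: fixed_paths_def cone_def)
  then show "v \<in> verts G \<Longrightarrow> path_trace \<phi> [Vertex v] = \<phi> v"
    using path_trace_cone[of "[]" v] by simp
qed

end

section \<open>Leavitt path algebras as rings of endomorphisms\<close>

locale leavitt_quotient = wf_digraph G for G :: "('a, 'b) pre_digraph" +
  fixes \<kappa> :: "(('a, 'b) lpa_gen word \<Rightarrow>\<^sub>0 'k::field) \<Rightarrow> (('a, 'b) lpa_gen word, 'k) linear_endo"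
  assumes finite_vertices: "finite (verts G)"
    and \<kappa>_add: "\<kappa> (p + q) = \<kappa> p + \<kappa> q"
    and \<kappa>_scale: "\<kappa> (poly_scale c p) = endo_scale c (\<kappa> p)"
    and \<kappa>_mult: "p \<in> words \<Longrightarrow> q \<in> words \<Longrightarrow> \<kappa> (p * q) = \<kappa> p * \<kappa> q"
    and \<kappa>_kernel: "p \<in> words \<Longrightarrow> \<kappa> p = 0 \<longleftrightarrow> p \<in> lpa_ideal"
begin

lemma \<kappa>_0: "\<kappa> 0 = 0"
  using \<kappa>_add[of 0 0] by simp

lemma \<kappa>_minus: "\<kappa> (- p) = - \<kappa> p"
  using \<kappa>_add[of p "- p"] by (simp add: \<kappa>_0 eq_neg_iff_add_eq_0 add.commute)

lemma \<kappa>_diff: "\<kappa> (p - q) = \<kappa> p - \<kappa> q"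
  using \<kappa>_add[of p "- q"] by (simp add: \<kappa>_minus)

lemma \<kappa>_sum: "\<kappa> (\<Sum>x\<in>S. f x) = (\<Sum>x\<in>S. \<kappa> (f x))"
  by (induction S rule: infinite_finite_induct) (simp_all add: \<kappa>_add \<kappa>_0)

lemma \<kappa>_eqI: "p - q \<in> lpa_ideal \<Longrightarrow> \<kappa> p = \<kappa> q"
proof -
  assume pq: "p - q \<in> lpa_ideal"
  then have "\<kappa> (p - q) = 0" using \<kappa>_kernel lpa_ideal(1) by blast
  then show "\<kappa> p = \<kappa> q" by (simp add: \<kappa>_diff)
qed

sublocale unital_subalgebra "\<kappa> ` words" "\<kappa> vertex_sum" endo_scale
proof (intro unital_subalgebra.intro unital_subring.intro unital_subalgebra_axioms.intro endo_scale_vector_space)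
  show "additive_subgroup (\<kappa> ` words)"
  proof (rule additive_subgroupI)
    show "0 \<in> \<kappa> ` words" using \<kappa>_0 free_carrier_closed(1) by (metis image_eqI)
    show "x + y \<in> \<kappa> ` words" if "x \<in> \<kappa> ` words" "y \<in> \<kappa> ` words" for x y
      using that by (auto simp: \<kappa>_add[symmetric] intro!: imageI free_carrier_closed)
    show "- x \<in> \<kappa> ` words" if "x \<in> \<kappa> ` words" for x
      using that by (auto simp: \<kappa>_minus[symmetric] intro!: imageI free_carrier_neg)
  qed
  show "x * y \<in> \<kappa> ` words" if "x \<in> \<kappa> ` words" "y \<in> \<kappa> ` words" for x y
    using that by (auto simp: \<kappa>_mult[symmetric] intro!: imageI free_carrier_closed)
  show "\<kappa> vertex_sum \<in> \<kappa> ` words" by (rule imageI vertex_sum_in_words)+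
  show "\<kappa> vertex_sum * x = x" "x * \<kappa> vertex_sum = x" if x: "x \<in> \<kappa> ` words" for x
  proof -
    obtain p where p: "x = \<kappa> p" "p \<in> words" using x by blast
    show "\<kappa> vertex_sum * x = x" "x * \<kappa> vertex_sum = x"
      using \<kappa>_eqI[OF vertex_sum_unit(1)[OF finite_vertices p(2)]]
        \<kappa>_eqI[OF vertex_sum_unit(2)[OF finite_vertices p(2)]]
      by (simp_all add: p \<kappa>_mult vertex_sum_in_words)
  qed
  show "endo_scale c x \<in> \<kappa> ` words" if "x \<in> \<kappa> ` words" for x c
    using that by (auto simp: \<kappa>_scale[symmetric] intro!: imageI free_carrier_closed)
qed (rule endo_scale_mult)+

abbreviation R :: "(('a, 'b) lpa_gen word, 'k) linear_endo set" where "R \<equiv> \<kappa> ` words"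
abbreviation one :: "(('a, 'b) lpa_gen word, 'k) linear_endo" where "one \<equiv> \<kappa> vertex_sum"
abbreviation V :: "'a \<Rightarrow> (('a, 'b) lpa_gen word, 'k) linear_endo" where "V v \<equiv> \<kappa> (vtx v)"
abbreviation Ed :: "'b \<Rightarrow> (('a, 'b) lpa_gen word, 'k) linear_endo" where "Ed e \<equiv> \<kappa> (edg e)"
abbreviation Gh :: "'b \<Rightarrow> (('a, 'b) lpa_gen word, 'k) linear_endo" where "Gh e \<equiv> \<kappa> (gst e)"

lemma gens_in_R [simp]:
  "v \<in> verts G \<Longrightarrow> V v \<in> R" "e \<in> arcs G \<Longrightarrow> Ed e \<in> R" "e \<in> arcs G \<Longrightarrow> Gh e \<in> R"
  using gens_in_words by auto

lemma one_eq: "one = (\<Sum>v\<in>verts G. V v)"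
  by (simp add: vertex_sum_def \<kappa>_sum)

lemma relation: "p - q \<in> lpa_relations G \<Longrightarrow> \<kappa> p = \<kappa> q"
  by (rule \<kappa>_eqI) (rule lpa_ideal)

lemma V_V: "v \<in> verts G \<Longrightarrow> w \<in> verts G \<Longrightarrow> V v * V w = (if v = w then V w else 0)"
  using relation[OF lpa_relations.vertex_vertex[of v G w]]
  by (simp add: \<kappa>_mult gens_in_words \<kappa>_0 split: if_splits)

lemma V_Ed: "e \<in> arcs G \<Longrightarrow> V (head G e) * Ed e = Ed e"
  and Ed_V: "e \<in> arcs G \<Longrightarrow> Ed e * V (tail G e) = Ed e"
  using relation[OF lpa_relations.range_edge[of e G]] relation[OF lpa_relations.edge_source[of e G]]
  by (simp_all add: \<kappa>_mult gens_in_words)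

lemma Gh_Ed: "e \<in> arcs G \<Longrightarrow> f \<in> arcs G \<Longrightarrow> Gh e * Ed f = (if e = f then V (tail G e) else 0)"
  using relation[OF lpa_relations.ghost_edge[of e G f]]
  by (simp add: \<kappa>_mult gens_in_words \<kappa>_0 split: if_splits)

lemma V_regular: "v \<in> verts G \<Longrightarrow> regular_vertex G v \<Longrightarrow> V v = (\<Sum>e\<in>in_arcs G v. Ed e * Gh e)"
  using relation[OF lpa_relations.regular[of v G]]
  by (simp add: \<kappa>_mult gens_in_words \<kappa>_sum)

lemma one_notin_derived:
  assumes "trace_functional G t" and nz: "linear_extension (\<lambda>w. t (letters w)) (vertex_sum :: ('a, 'b) lpa_gen word \<Rightarrow>\<^sub>0 'k) \<noteq> 0"
  shows "one \<notin> derived"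
proof
  interpret trace_functional G t by fact
  let ?T = "linear_extension (\<lambda>w. t (letters w))"
  assume "one \<in> derived"
  then have "\<exists>p\<in>words. one = \<kappa> p \<and> ?T p = 0"
  proof (induction rule: derived_induct)
    case (base x y)
    then obtain a b where ab: "x = \<kappa> a" "y = \<kappa> b" "a \<in> words" "b \<in> words" by blast
    then have "bracket x y = \<kappa> (a * b - b * a)" by (simp add: bracket_def \<kappa>_mult \<kappa>_diff)
    moreover have "a * b - b * a \<in> words" using ab by (intro free_carrier_diff free_carrier_closed)
    moreover have "?T (a * b - b * a) = 0" by (simp add: linear_extension_diff commute[of a b])
    ultimately show ?case by blast
  next
    case zero
    show ?case using \<kappa>_0 free_carrier_closed(1) by (intro bexI[of _ 0]) auto
  next
    case (add x y)
    then obtain a b where "x = \<kappa> a" "y = \<kappa> b" "a \<in> words" "b \<in> words" "?T a = 0" "?T b = 0" by blast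
    then show ?case
      by (intro bexI[of _ "a + b"] conjI free_carrier_closed) (simp_all add: \<kappa>_add linear_extension_add)
  next
    case (minus x)
    then obtain a where "x = \<kappa> a" "a \<in> words" "?T a = 0" by blast
    then show ?case
      by (intro bexI[of _ "- a"] conjI free_carrier_neg) (simp_all add: \<kappa>_minus linear_extension_minus)
  qed
  then obtain p where p: "p \<in> words" "one = \<kappa> p" "?T p = 0" by blast
  then have "\<kappa> (vertex_sum - p) = 0" by (simp add: \<kappa>_diff)
  then have "vertex_sum - p \<in> lpa_ideal"
    using \<kappa>_kernel[OF free_carrier_diff[OF vertex_sum_in_words p(1)]] by blast
  then have "?T (vertex_sum - p) = 0" by (rule vanishes)
  then show False using nz p(3) by (simp add: linear_extension_diff)
qed

text \<open>A multiplicative trace functional with value \<open>1\<close> at the unit is a homomorphism from the algebra onto the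
  field; by simplicity it is injective.\<close>

lemma isomorphic_base_field:
  fixes c :: "('a, 'b) lpa_gen \<Rightarrow> 'k"
  assumes simple: "simple_algebra (set_algebra R endo_scale)"
    and c: "trace_functional G (\<lambda>ws. \<Prod>g\<leftarrow>ws. c g)"
    and nz: "(\<Sum>v\<in>verts G. c (Vertex v)) = 1"
  shows "isomorphic_algebras (set_algebra R endo_scale) (base_field_algebra :: ('k, 'k) k_algebra)"
proof -
  interpret trace_functional G "\<lambda>ws. \<Prod>g\<leftarrow>ws. c g" by fact
  let ?T = "linear_extension (\<lambda>w. \<Prod>g\<leftarrow>letters w. c g) :: (('a, 'b) lpa_gen word \<Rightarrow>\<^sub>0 'k) \<Rightarrow> 'k"
  have T_mult: "?T (p * q) = ?T p * ?T q" for p q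
  proof (induction p rule: poly_mapping_single_induct)
    case (single u a)
    show ?case
    proof (induction q rule: poly_mapping_single_induct)
      case (single w b)
      then show ?case by (simp add: mult_single plus_word_def)
    qed (simp add: distrib_left linear_extension_add)
  qed (simp add: distrib_right linear_extension_add)
  have T_one: "?T vertex_sum = 1"
    using nz by (simp add: vertex_sum_def linear_extension_sum free_gen_def)
  have T_eq: "?T p = ?T q" if "p \<in> words" "q \<in> words" "\<kappa> p = \<kappa> q" for p q
  proof -
    have "p - q \<in> lpa_ideal" using that \<kappa>_kernel[of "p - q"] by (simp add: \<kappa>_diff free_carrier_diff)
    then have "?T (p - q) = 0" by (rule vanishes)
    then show ?thesis by (simp add: linear_extension_diff)
  qed
  let ?I = "\<kappa> ` {p \<in> words. ?T p = 0}"
  have "two_sided_ideal ?I"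
    unfolding two_sided_ideal_def
  proof (intro conjI ballI)
    show "additive_subgroup ?I"
    proof (rule additive_subgroupI)
      show "0 \<in> ?I" using \<kappa>_0 free_carrier_closed(1) by (intro image_eqI[of _ _ 0]) auto
      show "x + y \<in> ?I" if "x \<in> ?I" "y \<in> ?I" for x y
        using that by (auto simp: \<kappa>_add[symmetric] linear_extension_add free_carrier_closed intro!: imageI)
      show "- x \<in> ?I" if "x \<in> ?I" for x
        using that by (auto simp: \<kappa>_minus[symmetric] linear_extension_minus free_carrier_neg intro!: imageI)
    qed
    fix a x assume "a \<in> R" "x \<in> ?I"
    then obtain p q where pq: "a = \<kappa> p" "x = \<kappa> q" "p \<in> words" "q \<in> words" "?T q = 0" by blast
    then have "p * q \<in> words" "q * p \<in> words" "?T (p * q) = 0" "?T (q * p) = 0"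
      by (simp_all add: T_mult free_carrier_closed)
    then have "\<kappa> (p * q) \<in> ?I" "\<kappa> (q * p) \<in> ?I" by blast+
    then show "a * x \<in> ?I" "x * a \<in> ?I" using pq by (simp_all add: \<kappa>_mult)
  qed blast
  then have "alg_ideal (set_algebra R endo_scale) ?I" by (rule two_sided_ideal_alg_ideal[THEN iffD1])
  from simple[unfolded simple_algebra_def set_algebra_simps, THEN conjunct2, rule_format, OF this]
  have dichotomy: "?I = {0} \<or> ?I = R" .
  have "one \<notin> ?I"
  proof
    assume "one \<in> ?I"
    then obtain p where p: "p \<in> words" "?T p = 0" "one = \<kappa> p" by blast
    then show False using T_eq[OF vertex_sum_in_words p(1,3)] T_one by simp
  qed
  then have nR: "?I \<noteq> R" using unit_closed by metis
  have I0: "?I = {0}" by (rule disjE[OF dichotomy]) (assumption, rule notE[OF nR])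
  have scalar: "\<kappa> p = endo_scale (?T p) one" if p: "p \<in> words" for p
  proof -
    have "?T (p - poly_scale (?T p) vertex_sum) = 0"
      by (simp add: linear_extension_diff linear_extension_scale T_one)
    moreover have "p - poly_scale (?T p) vertex_sum \<in> words"
      by (intro free_carrier_diff free_carrier_closed vertex_sum_in_words p)
    ultimately have "\<kappa> (p - poly_scale (?T p) vertex_sum) \<in> ?I" by blast
    then show ?thesis unfolding I0 by (simp add: \<kappa>_diff \<kappa>_scale)
  qed
  define h where "h x = ?T (SOME p. p \<in> words \<and> \<kappa> p = x)" for x
  have h: "h (\<kappa> p) = ?T p" if p: "p \<in> words" for p
  proof -
    have q: "(SOME q. q \<in> words \<and> \<kappa> q = \<kappa> p) \<in> words \<and> \<kappa> (SOME q. q \<in> words \<and> \<kappa> q = \<kappa> p) = \<kappa> p"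
      by (rule someI[of _ p]) (use p in simp)
    show ?thesis unfolding h_def by (rule T_eq[OF conjunct1[OF q] p conjunct2[OF q]])
  qed
  have "bij_betw h R UNIV"
  proof (rule bij_betwI')
    fix x y assume "x \<in> R" "y \<in> R"
    then obtain p q where pq: "x = \<kappa> p" "y = \<kappa> q" "p \<in> words" "q \<in> words" by blast
    show "(h x = h y) = (x = y)"
      unfolding pq h[OF pq(3)] h[OF pq(4)] using scalar[OF pq(3)] scalar[OF pq(4)] T_eq[OF pq(3,4)] by metis
  next
    fix a :: 'k
    have "poly_scale a vertex_sum \<in> words" by (intro free_carrier_closed vertex_sum_in_words)
    then show "\<exists>x\<in>R. a = h x"
      by (intro bexI[of _ "\<kappa> (poly_scale a vertex_sum)"] imageI)
        (simp_all add: h linear_extension_scale T_one)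
  qed auto
  moreover have "h (x + y) = h x + h y" "h (x * y) = h x * h y" if "x \<in> R" "y \<in> R" for x y
  proof -
    from that obtain p q where pq: "x = \<kappa> p" "y = \<kappa> q" "p \<in> words" "q \<in> words" by blast
    then show "h (x + y) = h x + h y" "h (x * y) = h x * h y"
      by (simp_all add: h free_carrier_closed linear_extension_add T_mult
          flip: \<kappa>_add \<kappa>_mult)
  qed
  moreover have "h (endo_scale a x) = a * h x" if "x \<in> R" for a x
  proof -
    from that obtain p where p: "x = \<kappa> p" "p \<in> words" by blast
    then show ?thesis
      by (simp add: h free_carrier_closed linear_extension_scale flip: \<kappa>_scale)
  qed
  ultimately have "h \<in> alg_iso (set_algebra R endo_scale) (base_field_algebra :: ('k, 'k) k_algebra)"
    by (simp add: alg_iso_def base_field_algebra_def)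
  then show ?thesis by (auto simp: isomorphic_algebras_def)
qed

text \<open>Suppose \<open>0\<close> and \<open>1\<close> are the only idempotents. The vertices are orthogonal idempotents with sum \<open>1\<close>, so
  one vertex \<open>v0\<close> is \<open>1\<close> and the others vanish. An edge \<open>e\<close> with source \<open>v0\<close> is a loop with \<open>e e\<^sup>* = 1\<close>, as
  \<open>e e\<^sup>*\<close> is an idempotent and not zero. A second such edge \<open>f\<close> would have \<open>f\<^sup>* = f\<^sup>* e e\<^sup>* = 0\<close>. Edges with
  another source vanish. Hence sending \<open>v0\<close> and, if there is one, the loop and its ghost to \<open>1\<close> and
  all other generators to \<open>0\<close> respects the relations.\<close>

theorem nontrivial_idempotent:
  assumes simple: "simple_algebra (set_algebra R endo_scale)"
    and nontrivial: "\<not> isomorphic_algebras (set_algebra R endo_scale) (base_field_algebra :: ('k, 'k) k_algebra)"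
  obtains e where "e \<in> R" "e * e = e" "e \<noteq> 0" "e \<noteq> one"
proof (rule ccontr)
  note witness = that
  assume "\<not> thesis"
  then have idem: "x = 0 \<or> x = one" if "x \<in> R" "x * x = x" for x using witness that by blast
  have one0: "one \<noteq> 0"
  proof
    assume 0: "one = 0"
    have "x = 0" if "x \<in> R" for x using unit_left[OF that] 0 by simp
    then show False using simple by (auto simp: simple_algebra_def)
  qed
  obtain v0 where v0: "v0 \<in> verts G" "V v0 \<noteq> 0"
    using one0 one_eq by (metis sum.neutral)
  then have Vv0: "V v0 = one" using idem[of "V v0"] V_V by simp
  have Vv: "V v = (if v = v0 then one else 0)" if "v \<in> verts G" for v
    using V_V[OF that v0(1)] Vv0 that unit_right[of "V v"] by auto
  have loop: "head G e = v0" "Ed e * Gh e = one" if e: "e \<in> arcs G" "tail G e = v0" for e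
  proof -
    have GE: "Gh e * Ed e = one" using Gh_Ed[of e e] e Vv0 by simp
    then have "Ed e \<noteq> 0" using one0 by auto
    then have "V (head G e) \<noteq> 0" using V_Ed[OF e(1)] by auto
    then show "head G e = v0" using Vv e by (metis head_in_verts)
    have "(Ed e * Gh e) * (Ed e * Gh e) = Ed e * (Gh e * Ed e) * Gh e" by (simp add: mult.assoc)
    also have "\<dots> = Ed e * Gh e" using GE e by simp
    finally have "Ed e * Gh e = 0 \<or> Ed e * Gh e = one" using e by (intro idem) auto
    moreover have "Ed e * Gh e \<noteq> 0"
    proof
      assume "Ed e * Gh e = 0"
      then have "Gh e * (Ed e * Gh e) * Ed e = 0" by simp
      moreover have "Gh e * (Ed e * Gh e) * Ed e = (Gh e * Ed e) * (Gh e * Ed e)" by (simp add: mult.assoc)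
      ultimately show False using GE one0 by simp
    qed
    ultimately show "Ed e * Gh e = one" by blast
  qed
  have unique: "e = f" if "e \<in> arcs G" "f \<in> arcs G" "tail G e = v0" "tail G f = v0" for e f
  proof (rule ccontr)
    assume "e \<noteq> f"
    have "Gh f = Gh f * (Ed e * Gh e)" using loop(2)[of e] that by simp
    also have "\<dots> = (Gh f * Ed e) * Gh e" by (simp add: mult.assoc)
    also have "\<dots> = 0" using Gh_Ed[of f e] that \<open>e \<noteq> f\<close> by auto
    finally have "Gh f * Ed f = 0" by (simp only: mult_zero_left)
    then show False using Gh_Ed[of f f] that(2,4) Vv0 one0 by (simp only: simp_thms if_True)
  qed
  have Ed0: "Ed e = 0" if "e \<in> arcs G" "tail G e \<noteq> v0" for e
  proof -
    have "V (tail G e) = 0" using Vv[OF tail_in_verts[OF that(1)]] that(2) by (simp only: if_False)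
    then have "Ed e * V (tail G e) = 0" by (simp only: mult_zero_right)
    then show ?thesis by (simp only: Ed_V[OF that(1)])
  qed
  define c :: "('a, 'b) lpa_gen \<Rightarrow> 'k" where
    "c g = (case g of Vertex v \<Rightarrow> of_bool (v = v0) | Edge e \<Rightarrow> of_bool (tail G e = v0)
      | Ghost e \<Rightarrow> of_bool (tail G e = v0))" for g
  have "trace_functional G (\<lambda>ws. \<Prod>g\<leftarrow>ws. c g)"
  proof
    fix us :: "('a, 'b) lpa_gen list" and v assume v: "v \<in> verts G" "regular_vertex G v"
    have "of_bool (v = v0) = (\<Sum>e\<in>in_arcs G v. of_bool (tail G e = v0) :: 'k)"
    proof (cases "v = v0")
      case True
      \<comment> \<open>The relation at a regular vertex requires exactly one loop; there is one because \<open>v0\<close> is not zero.\<close>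
      have "\<exists>e\<in>in_arcs G v. Ed e \<noteq> 0"
      proof (rule ccontr)
        assume "\<not> ?thesis"
        then have "(\<Sum>e\<in>in_arcs G v. Ed e * Gh e) = 0" by (intro sum.neutral) simp
        then show False using V_regular[OF v] Vv0 one0 True by (simp only: simp_thms)
      qed
      then obtain f where f: "f \<in> in_arcs G v" "tail G f = v0" using Ed0 by (metis in_in_arcs_conv)
      have "tail G e = v0 \<longleftrightarrow> e = f" if "e \<in> in_arcs G v" for e
        using that f unique by (metis in_in_arcs_conv)
      then have "(\<Sum>e\<in>in_arcs G v. of_bool (tail G e = v0) :: 'k) = (\<Sum>e\<in>in_arcs G v. if e = f then 1 else 0)"
        by (intro sum.cong refl) (simp only: of_bool_def)
      also have "\<dots> = 1"
        using f(1) v(2) by (simp only: regular_vertex_def sum.delta if_True)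
      finally have S: "(\<Sum>e\<in>in_arcs G v. of_bool (tail G e = v0) :: 'k) = 1" .
      show ?thesis unfolding S by (simp add: True)
    next
      case False
      then have "tail G e \<noteq> v0" if "e \<in> in_arcs G v" for e using that loop(1) by (metis in_in_arcs_conv)
      then have S: "(\<Sum>e\<in>in_arcs G v. of_bool (tail G e = v0) :: 'k) = 0" by (intro sum.neutral) simp
      show ?thesis unfolding S using False by simp
    qed
    then show "(\<Prod>g\<leftarrow>us @ [Vertex v]. c g) = (\<Sum>e\<in>in_arcs G v. \<Prod>g\<leftarrow>us @ [Edge e, Ghost e]. c g)"
      by (simp add: c_def sum_distrib_left[symmetric] del: sum_of_bool_eq flip: of_bool_conj)
  next
    fix us :: "('a, 'b) lpa_gen list" and e f assume "e \<in> arcs G" "f \<in> arcs G"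
    then have "of_bool (tail G e = v0) * of_bool (tail G f = v0) = (if e = f then of_bool (tail G e = v0) else 0 :: 'k)"
      using unique[of e f] by (cases "e = f") auto
    then show "(\<Prod>g\<leftarrow>us @ [Ghost e, Edge f]. c g) = (if e = f then \<Prod>g\<leftarrow>us @ [Vertex (tail G e)]. c g else 0)"
      by (simp add: c_def)
  next
    fix us :: "('a, 'b) lpa_gen list" and e assume e: "e \<in> arcs G"
    then have "of_bool (head G e = v0) * of_bool (tail G e = v0) = (of_bool (tail G e = v0) :: 'k)"
      using loop(1)[of e] by (cases "tail G e = v0") auto
    then show "(\<Prod>g\<leftarrow>us @ [Vertex (head G e), Edge e]. c g) = (\<Prod>g\<leftarrow>us @ [Edge e]. c g)"
      "(\<Prod>g\<leftarrow>us @ [Ghost e, Vertex (head G e)]. c g) = (\<Prod>g\<leftarrow>us @ [Ghost e]. c g)"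
      by (simp_all add: c_def mult.commute)
  qed (auto simp: c_def mult.commute)
  moreover have "(\<Sum>v\<in>verts G. c (Vertex v)) = 1"
    using v0 finite_vertices by (simp add: c_def of_bool_def)
  ultimately show False using isomorphic_base_field[OF simple] nontrivial by blast
qed

end

section \<open>The unit and the span of the rows\<close>

lemma linear_functional_separating:
  fixes S :: "('k::field ^ 'm) set" and x :: "'k ^ 'm"
  assumes "x \<notin> vec.span S"
  obtains \<phi> :: "'m \<Rightarrow> 'k" where "\<And>y. y \<in> S \<Longrightarrow> (\<Sum>j\<in>UNIV. y $ j * \<phi> j) = 0"
    "(\<Sum>j\<in>UNIV. x $ j * \<phi> j) \<noteq> 0"
proof -
  interpret pair: vector_space_pair "(*s) :: 'k \<Rightarrow> 'k ^ 'm \<Rightarrow> 'k ^ 'm" "(*) :: 'k \<Rightarrow> 'k \<Rightarrow> 'k" ..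
  obtain B where B: "B \<subseteq> S" "vec.independent B" "S \<subseteq> vec.span B"
    using vec.maximal_independent_subset[of S] by blast
  have x: "x \<notin> vec.span B" using assms B(1) vec.span_mono by blast
  then have "vec.independent (insert x B)" using B(2) by (simp add: vec.independent_insert)
  then obtain g where g: "Vector_Spaces.linear (*s) (*) g" "\<forall>b\<in>insert x B. g b = (if b = x then 1 else 0)"
    using pair.linear_independent_extend[of "insert x B" "\<lambda>b. if b = x then 1 else 0"] by blast
  interpret g: Vector_Spaces.linear "(*s)" "(*)" g by (rule g)
  have expand: "g y = (\<Sum>j\<in>UNIV. y $ j * g (axis j 1))" for y
  proof -
    have "y = (\<Sum>j\<in>UNIV. y $ j *s axis j 1)"
      by (simp add: vec_eq_iff axis_def vector_scalar_mult_def if_distrib cong: if_cong)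
    then have "g y = g (\<Sum>j\<in>UNIV. y $ j *s axis j 1)" by (rule arg_cong)
    then show ?thesis by (simp add: g.sum g.scale)
  qed
  have "g y = 0" if "y \<in> S" for y
  proof (rule pair.linear_eq_0_on_span[OF g(1), of B])
    show "g b = 0" if "b \<in> B" for b using g(2) that x vec.span_base by auto
    show "y \<in> vec.span B" using that B by blast
  qed
  moreover have "g x \<noteq> 0" using g(2) by simp
  ultimately show ?thesis using that[of "\<lambda>j. g (axis j 1)"] expand by metis
qed

context wf_digraph
begin

lemma in_arcs_by_tail:
  fixes v :: "'m::finite \<Rightarrow> 'a" and f :: "'a \<Rightarrow> 'c::comm_monoid_add"
  assumes "bij_betw v UNIV (verts G)" and "finite (in_arcs G u)"
  shows "(\<Sum>j\<in>UNIV. \<Sum>e\<in>{e \<in> arcs G. head G e = u \<and> tail G e = v j}. f (v j)) = (\<Sum>e\<in>in_arcs G u. f (tail G e))"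
proof -
  have inj: "inj v" and surj: "v ` UNIV = verts G" using assms(1) by (auto simp: bij_betw_def)
  have "(\<Sum>j\<in>UNIV. \<Sum>e\<in>{e \<in> arcs G. head G e = u \<and> tail G e = v j}. f (v j)) =
      (\<Sum>w\<in>v ` UNIV. \<Sum>e\<in>{e \<in> arcs G. head G e = u \<and> tail G e = w}. f w)"
    by (simp add: sum.reindex[OF inj])
  also have "\<dots> = (\<Sum>w\<in>v ` UNIV. \<Sum>e\<in>{e \<in> in_arcs G u. tail G e = w}. f (tail G e))"
    by (intro sum.cong) auto
  also have "\<dots> = (\<Sum>e\<in>in_arcs G u. f (tail G e))"
    by (rule sum.group[OF assms(2) finite_imageI[OF finite]]) (use surj in auto)
  finally show ?thesis .
qed

end

context leavitt_quotient
begin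

text \<open>For a row at a regular vertex the combination is \<open>\<Sum> (e\<^sup>* e - e e\<^sup>*)\<close> over the edges \<open>e\<close> with that range.\<close>

lemma combination_in_derived:
  fixes v :: "'m::finite \<Rightarrow> 'a" and B :: "'m \<Rightarrow> 'k ^ 'm"
  assumes enum: "bij_betw v UNIV (verts G)"
    and B_regular: "\<And>i. regular_vertex G (v i) \<Longrightarrow>
          B i = (\<chi> j. of_nat (card {e \<in> arcs G. head G e = v i \<and> tail G e = v j})) - axis i 1"
    and B_nonregular: "\<And>i. \<not> regular_vertex G (v i) \<Longrightarrow> B i = 0"
    and x: "x \<in> vec.span (range B)"
  shows "(\<Sum>j\<in>UNIV. endo_scale (x $ j) (V (v j))) \<in> derived"
  using x
proof (induction rule: vec.span_induct)
  case base
  show ?case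
  proof (rule vec.subspaceI)
    show "0 \<in> {x. (\<Sum>j\<in>UNIV. endo_scale (x $ j) (V (v j))) \<in> derived}"
      by (simp add: additive_subgroup_0[OF derived_subgroup])
    fix x y assume "x \<in> {x. (\<Sum>j\<in>UNIV. endo_scale (x $ j) (V (v j))) \<in> derived}"
      "y \<in> {x. (\<Sum>j\<in>UNIV. endo_scale (x $ j) (V (v j))) \<in> derived}"
    then show "x + y \<in> {x. (\<Sum>j\<in>UNIV. endo_scale (x $ j) (V (v j))) \<in> derived}"
      by (simp add: scale_left_distrib sum.distrib additive_subgroup_add[OF derived_subgroup])
  next
    fix c x assume "x \<in> {x. (\<Sum>j\<in>UNIV. endo_scale (x $ j) (V (v j))) \<in> derived}"
    then have "endo_scale c (\<Sum>j\<in>UNIV. endo_scale (x $ j) (V (v j))) \<in> derived"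
      by (simp add: derived_scale)
    then show "c *s x \<in> {x. (\<Sum>j\<in>UNIV. endo_scale (x $ j) (V (v j))) \<in> derived}"
      by (simp add: scale_sum_right)
  qed
next
  case (step y)
  then obtain i where y: "y = B i" by blast
  show ?case
  proof (cases "regular_vertex G (v i)")
    case False
    then show ?thesis using B_nonregular y by (simp add: additive_subgroup_0[OF derived_subgroup])
  next
    case True
    then have fin: "finite (in_arcs G (v i))" by (simp add: regular_vertex_def)
    have vi: "v i \<in> verts G" using enum by (auto simp: bij_betw_def)
    have card: "endo_scale (of_nat (card A)) x = (\<Sum>e\<in>A. x)" for A :: "'b set" and x :: "(('a, 'b) lpa_gen word, 'k) linear_endo"
      by (induction A rule: infinite_finite_induct) (simp_all add: scale_left_distrib)
    have "(\<Sum>j\<in>UNIV. endo_scale (axis i 1 $ j) (V (v j))) = (\<Sum>j\<in>UNIV. if j = i then V (v i) else 0)"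
      by (intro sum.cong) (auto simp: axis_def)
    then have ax: "(\<Sum>j\<in>UNIV. endo_scale (axis i 1 $ j) (V (v j))) = V (v i)" by simp
    have "(\<Sum>j\<in>UNIV. endo_scale (B i $ j) (V (v j))) =
        (\<Sum>j\<in>UNIV. \<Sum>e\<in>{e \<in> arcs G. head G e = v i \<and> tail G e = v j}. V (v j)) - V (v i)"
      using B_regular[OF True] by (simp add: scale_left_diff_distrib sum_subtractf ax card)
    also have "\<dots> = (\<Sum>e\<in>in_arcs G (v i). V (tail G e)) - (\<Sum>e\<in>in_arcs G (v i). Ed e * Gh e)"
      by (simp only: in_arcs_by_tail[OF enum fin, of V] V_regular[OF vi True])
    also have "\<dots> = (\<Sum>e\<in>in_arcs G (v i). bracket (Gh e) (Ed e))"
      unfolding sum_subtractf[symmetric] by (intro sum.cong) (auto simp: bracket_def Gh_Ed)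
    also have "\<dots> \<in> derived"
    proof -
      have "(\<Sum>e\<in>A. bracket (Gh e) (Ed e)) \<in> derived" if "A \<subseteq> arcs G" for A
        using that
        by (induction A rule: infinite_finite_induct)
          (auto intro: additive_subgroup_0[OF derived_subgroup] additive_subgroup_add[OF derived_subgroup])
      moreover have "in_arcs G (v i) \<subseteq> arcs G" by (auto simp: in_arcs_def)
      ultimately show ?thesis by blast
    qed
    finally show ?thesis by (simp add: y)
  qed
qed

text \<open>A functional that kills the rows is a weighting of the vertices for which the value at each
  regular vertex \<open>v\<close> is the sum of the values at the sources of the edges with range \<open>v\<close>. This is the
  condition for a trace with these values at the vertices, and the value of the trace at the unit is
  the value of the functional at \<open>(1, \<dots>, 1)\<close>.\<close>

theorem one_in_derived_iff:
  fixes v :: "'m::finite \<Rightarrow> 'a" and B :: "'m \<Rightarrow> 'k ^ 'm"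
  assumes enum: "bij_betw v UNIV (verts G)"
    and B_regular: "\<And>i. regular_vertex G (v i) \<Longrightarrow>
          B i = (\<chi> j. of_nat (card {e \<in> arcs G. head G e = v i \<and> tail G e = v j})) - axis i 1"
    and B_nonregular: "\<And>i. \<not> regular_vertex G (v i) \<Longrightarrow> B i = 0"
  shows "one \<in> derived \<longleftrightarrow> (\<chi> j. 1) \<in> vec.span (range B)"
proof
  have inj: "inj v" and surj: "verts G = v ` UNIV" using enum by (auto simp: bij_betw_def)
  show "one \<in> derived" if x: "(\<chi> j. 1) \<in> vec.span (range B)"
  proof -
    have "(\<Sum>j\<in>UNIV. endo_scale ((\<chi> j. 1) $ j) (V (v j))) \<in> derived"
      using combination_in_derived[OF enum B_regular B_nonregular x] by blast
    then show ?thesis by (simp add: one_eq surj sum.reindex[OF inj])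
  qed
  show "(\<chi> j. 1) \<in> vec.span (range B)" if one: "one \<in> derived"
  proof (rule ccontr)
    assume "(\<chi> j. 1) \<notin> vec.span (range B)"
    then obtain \<psi> :: "'m \<Rightarrow> 'k" where \<psi>: "\<And>y. y \<in> range B \<Longrightarrow> (\<Sum>j\<in>UNIV. y $ j * \<psi> j) = 0"
      "(\<Sum>j\<in>UNIV. (\<chi> j. 1) $ j * \<psi> j) \<noteq> 0" by (rule linear_functional_separating) blast
    define \<phi> where "\<phi> = \<psi> \<circ> inv v"
    have \<phi>v: "\<phi> (v j) = \<psi> j" for j by (simp add: \<phi>_def inj)
    have "\<phi> u = (\<Sum>e\<in>in_arcs G u. \<phi> (tail G e))" if u: "u \<in> verts G" "regular_vertex G u" for u
    proof -
      obtain i where i: "u = v i" using u surj by blast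
      have fin: "finite (in_arcs G (v i))" using u i by (simp add: regular_vertex_def)
      have "(\<Sum>j\<in>UNIV. axis i 1 $ j * \<psi> j) = (\<Sum>j\<in>UNIV. if j = i then \<psi> i else 0)"
        by (intro sum.cong) (auto simp: axis_def)
      then have ax: "(\<Sum>j\<in>UNIV. axis i 1 $ j * \<psi> j) = \<psi> i" by simp
      have "0 = (\<Sum>j\<in>UNIV. B i $ j * \<psi> j)" using \<psi>(1) by simp
      also have "\<dots> = (\<Sum>j\<in>UNIV. \<Sum>e\<in>{e \<in> arcs G. head G e = v i \<and> tail G e = v j}. \<phi> (v j)) - \<phi> (v i)"
        using B_regular u i by (simp add: left_diff_distrib sum_subtractf ax \<phi>v)
      finally show ?thesis
        by (simp only: in_arcs_by_tail[OF enum fin] i right_minus_eq eq_commute[of 0])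
    qed
    then have tr: "trace_functional G (path_trace \<phi>)" by (rule trace_functional_path_trace)
    have "linear_extension (\<lambda>w. path_trace \<phi> (letters w)) (vertex_sum :: ('a, 'b) lpa_gen word \<Rightarrow>\<^sub>0 'k) =
        (\<Sum>u\<in>verts G. \<phi> u)"
      by (simp add: vertex_sum_def linear_extension_sum free_gen_def path_trace_vertex)
    also have "\<dots> = (\<Sum>j\<in>UNIV. \<psi> j)" by (simp add: surj sum.reindex[OF inj] \<phi>v)
    finally show False using one_notin_derived[OF tr] one \<psi>(2) by simp
  qed
qed

end

theorem theorem3p7:
  fixes E :: "('v, 'e) pre_digraph"
    and v :: "'m::finite \<Rightarrow> 'v"
    and L :: "('k::field, (('v, 'e) lpa_gen word \<Rightarrow>\<^sub>0 'k) set) k_algebra"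
    and B :: "'m \<Rightarrow> 'k ^ 'm"
  assumes graph: "wf_digraph E"
    and enum: "bij_betw v UNIV (verts E)"
    and L: "L = leavitt_path_algebra TYPE('k) E"
    and simple: "simple_algebra L"
    and nontrivial: "\<not> isomorphic_algebras L (base_field_algebra :: ('k, 'k) k_algebra)"
    and B_regular: "\<And>i. regular_vertex E (v i) \<Longrightarrow>
          B i = (\<chi> j. of_nat (card {e \<in> arcs E. head E e = v i \<and> tail E e = v j})) - axis i 1"
    and B_nonregular: "\<And>i. \<not> regular_vertex E (v i) \<Longrightarrow> B i = 0"
  shows "simple_lie_algebra (commutator_lie_algebra L) \<longleftrightarrow>
         (\<chi> j. 1) \<notin> vec.span (range B)"
proof -
  interpret wf_digraph E by (rule graph)
  have fin: "finite (verts E)" using enum by (metis bij_betw_finite finite)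
  let ?W = "words :: (('v, 'e) lpa_gen word \<Rightarrow>\<^sub>0 'k) set"
  let ?N = "lpa_ideal :: (('v, 'e) lpa_gen word \<Rightarrow>\<^sub>0 'k) set"
  let ?F = "set_algebra ?W poly_scale"
  have F: "(free_algebra (lpa_gens E) :: ('k, ('v, 'e) lpa_gen word \<Rightarrow>\<^sub>0 'k) k_algebra) = ?F"
    by (rule free_algebra_set_algebra)
  have closed_F: "closed_algebra ?F" by (subst F[symmetric]) (rule closed_free_algebra)
  have ideal_F: "alg_ideal ?F ?N" by (subst F[symmetric]) (rule alg_ideal_lpa_ideal)
  have L_eq: "L = quotient_algebra ?F ?N"
    unfolding L leavitt_path_algebra_def lpa_ideal_def[symmetric] by (subst F) (rule refl)
  obtain \<kappa> :: "(('v, 'e) lpa_gen word \<Rightarrow>\<^sub>0 'k) \<Rightarrow> (('v, 'e) lpa_gen word, 'k) linear_endo"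
    where \<kappa>: "\<And>a b. \<kappa> (a + b) = \<kappa> a + \<kappa> b" "\<And>c a. \<kappa> (poly_scale c a) = endo_scale c (\<kappa> a)"
      "\<And>a b. a \<in> words \<Longrightarrow> b \<in> words \<Longrightarrow> \<kappa> (a * b) = \<kappa> a * \<kappa> b"
      "\<And>a. a \<in> words \<Longrightarrow> \<kappa> a = 0 \<longleftrightarrow> a \<in> lpa_ideal"
    using quotient_representation[OF closed_F ideal_F vertex_sum_in_words vertex_sum_unit(2)[OF fin]] by blast
  interpret leavitt_quotient E \<kappa>
    by unfold_locales (fact fin \<kappa>)+
  have "\<exists>h. algebra_iso L (set_algebra R endo_scale) h"
    unfolding L_eq by (rule quotient_iso_image[OF closed_F ideal_F]) (simp_all add: \<kappa> poly.scale_right_distrib)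
  then obtain h where h: "algebra_iso L (set_algebra R endo_scale) h" by blast
  then have simple': "simple_algebra (set_algebra R endo_scale)"
    using simple algebra_iso.simple_image by blast
  have "\<not> isomorphic_algebras (set_algebra R endo_scale) (base_field_algebra :: ('k, 'k) k_algebra)"
    using nontrivial algebra_iso.isomorphic_trans[OF h] by blast
  then obtain e where e: "e \<in> R" "e * e = e" "e \<noteq> 0" "e \<noteq> one"
    using nontrivial_idempotent[OF simple'] by metis
  have "simple_lie_algebra (commutator_lie_algebra L) \<longleftrightarrow>
      simple_lie_algebra (commutator_lie_algebra (set_algebra R endo_scale))"
    by (rule algebra_iso.simple_lie_image[OF commutator_lie_algebra_iso[OF h]])
  also have "\<dots> \<longleftrightarrow> one \<notin> derived" by (rule simple_lie_iff[OF simple' e])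
  also have "\<dots> \<longleftrightarrow> (\<chi> j. 1) \<notin> vec.span (range B)"
    using one_in_derived_iff[OF enum B_regular B_nonregular] by blast
  finally show ?thesis .
qed

end
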